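(* $\mathfrak{K}_t^{\infty,f}$ is a subalgebra of $\mathfrak{K}_t^\infty$, where $\mathfrak{K}_t^{\infty,f}$ is the $\mathbb{Z}[t^{\pm1}]$-submodule of the algebra $\mathfrak{K}_t^\infty$ generated by the elements having only a finite number of dominant monomials.
   Context: Cartan data. $I=\{1,\dots,n\}$, $C=(C_{i,j})$ a Cartan matrix of finite type, $r_i\in\mathbb{N}^*$ with $(r_iC_{i,j})$ symmetric, coprime on each indecomposable component. $z$ is an indeterminate, $[l]_z=\frac{z^l-z^{-l}}{z-z^{-1}}$, $C(z)_{i,i}=z^{r_i}+z^{-r_i}$, $C(z)_{i,j}=[C_{i,j}]_z$ ($i\neq j$), $\tilde C(z)=C(z)^{-1}$; $(\tilde C_{i,j})_r\in\mathbb{Z}$ is the coefficient of $z^r$ in the expansion of $\tilde C_{i,j}(z)$ in $\mathbb{Z}((z^{-1}))$. Monomials. $\mathcal{Y}=\mathbb{Z}[Y_{i,l}^{\pm1}]_{i\in I,l\in\mathbb{Z}}$ (commutative), $A$ is its set of Laurent monomials $m=\prod Y_{i,l}^{u_{i,l}(m)}$, and $$A_{i,l}=Y_{i,l-r_i}Y_{i,l+r_i}\prod_{C_{j,i}=-1}Y_{j,l}^{-1}\prod_{C_{j,i}=-2}Y_{j,l+1}^{-1}Y_{j,l-1}^{-1}\prod_{C_{j,i}=-3}Y_{j,l+2}^{-1}Y_{j,l}^{-1}Y_{j,l-2}^{-1}.$$ $B_i=\{m\in A:u_{i,l}(m)\ge0\ \forall l\}$, $B=\bigcap_{i\in I}B_i$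 (dominant monomials). The algebra $\mathcal{Y}_t$. It is the free $\mathbb{Z}[t^{\pm1}]$-module with basis $\{:\!m\!:\,\mid m\in A\}$ and $\mathbb{Z}[t^{\pm1}]$-bilinear associative product $:\!m_1\!:\,:\!m_2\!:\,=t^{\mathcal{N}(m_1,m_2)}:\!m_1m_2\!:$, where $\mathcal{N}:A\times A\to\mathbb{Z}$ is the bicharacter with $\mathcal{N}(Y_{i,l},Y_{j,k})=(\tilde C_{j,i})_{r_j+l-k}-(\tilde C_{j,i})_{-r_j+l-k}$. Put $\tilde Y_{i,l}=:\!Y_{i,l}\!:$, $\tilde A_{i,l}=:\!A_{i,l}\!:$ (invertible, $\tilde A_{i,l}^{-1}=:\!A_{i,l}^{-1}\!:$). The monomials of an element are the $m\in A$ such that $:\!m\!:$ has nonzero coefficient. $\overset{\rightarrow}{\prod}_{l}$ is the product ordered by increasing $l$. Completions. For $m\in B_i$ put $E_{i,t}(m)=\overset{\rightarrow}{\prod}_{l\in\mathbb{Z}}\bigl((\tilde Y_{i,l}(1+t\tilde A_{i,l+r_i}^{-1}))^{u_{i,l}(m)}\prod_{j\ne i}\tilde Y_{j,l}^{u_{j,l}(m)}\bigr)$. Let $\mathcal{Y}_t^{A,K}$ be the $\mathbb{Z}[t^{\pm1}]$-span of the $:\!a\!:$ with $a$ a product of $K$ elements $A_{j,l}^{-1}$, $\mathcal{Y}_t^{A,\infty}=\prod_{K\ge0}\mathcal{Y}_t^{A,K}$, and $\mathcal{Y}_t^\infty=\sum_{M\in A}:\!M\!:\mathcal{Y}_t^{A,\infty}\subset\prod_{m\in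 A}\mathbb{Z}[t^{\pm1}]:\!m\!:$ (finite sums over $M$); the product of $\mathcal{Y}_t$ extends to an algebra structure on $\mathcal{Y}_t^\infty$. $\mathfrak{K}_{i,t}^\infty\subset\mathcal{Y}_t^\infty$ is the set of finite sums, over $M\in A$, of elements $\sum_{K\ge0}\sum_a\lambda_a(t)E_{i,t}(Ma)$, where for each $K$ the inner sum is over finitely many products $a$ of $K$ elements $A_{j,l}^{-1}$ with $Ma\in B_i$, $\lambda_a(t)\in\mathbb{Z}[t^{\pm1}]$. $\mathfrak{K}_t^\infty=\bigcap_{i\in I}\mathfrak{K}_{i,t}^\infty$; it is a $\mathbb{Z}[t^{\pm1}]$-subalgebra of $\mathcal{Y}_t^\infty$. *)

theory Defs
  imports
    "HOL-Analysis.Analysis"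
    "HOL-Complex_Analysis.Complex_Analysis"
    "HOL-Library.Poly_Mapping"
    "HOL-Library.Function_Algebras"
    "HOL-Library.Multiset"
begin

unbundle no Formal_Power_Series.fps_syntax  (* would clash with the vector component notation *)

section \<open>Cartan data\<close>

text \<open>The index set is a finite linearly ordered type, that is
  \<open>I = {1, \<dots>, n}\<close> for an arbitrary \<open>n \<ge> 1\<close>.\<close>

definition finite_type_cartan :: "int ^ 'n::finite ^ 'n \<Rightarrow> bool" where
  "finite_type_cartan C \<longleftrightarrow>
     (\<forall>i. C $ i $ i = 2) \<and>
     (\<forall>i j. i \<noteq> j \<longrightarrow> C $ i $ j \<le> 0) \<and>
     (\<forall>i j. C $ i $ j = 0 \<longleftrightarrow> C $ j $ i = 0) \<and>
     (\<exists>d :: 'n \<Rightarrow> real.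
        (\<forall>i. d i > 0) \<and>
        (\<forall>i j. d i * of_int (C $ i $ j) = d j * of_int (C $ j $ i)) \<and>
        (\<forall>x :: real ^ 'n. x \<noteq> 0 \<longrightarrow>
            (\<Sum>i\<in>UNIV. \<Sum>j\<in>UNIV. x $ i * (d i * of_int (C $ i $ j)) * x $ j) > 0))"

definition component :: "int ^ 'n::finite ^ 'n \<Rightarrow> 'n \<Rightarrow> 'n set" where
  "component C i = {(j, k). C $ j $ k \<noteq> 0}\<^sup>* `` {i}"

definition coprime_symmetrizer :: "int ^ 'n::finite ^ 'n \<Rightarrow> ('n \<Rightarrow> nat) \<Rightarrow> bool" where
  "coprime_symmetrizer C r \<longleftrightarrow>
     (\<forall>i. r i > 0) \<and>
     (\<forall>i j. int (r i) * C $ i $ j = int (r j) * C $ j $ i) \<and>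
     (\<forall>i. Gcd (r ` component C i) = 1)"


section \<open>The quantum Cartan matrix\<close>

text \<open>We compute in \<open>\<int>((z\<^sup>-\<^sup>1))\<close>, represented by \<^typ>\<open>int fls\<close> with the formal
  variable \<^term>\<open>fls_X\<close> standing for \<open>z\<^sup>-\<^sup>1\<close>.\<close>

definition zpow :: "int \<Rightarrow> int fls" where
  "zpow l = fls_X_intpow (- l)"

definition zcoeff :: "int fls \<Rightarrow> int \<Rightarrow> int" where
  "zcoeff f s = fls_nth f (- s)"

text \<open>The quotient \<open>(z\<^sup>l - z\<^sup>-\<^sup>l) / (z - z\<^sup>-\<^sup>1)\<close>; it exists and is unique in \<open>\<int>((z\<^sup>-\<^sup>1))\<close>,
  see \<open>qint_mult\<close> below.\<close>

definition qint :: "int \<Rightarrow> int fls" where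
  "qint l = (THE q. q * (zpow 1 - zpow (-1)) = zpow l - zpow (- l))"

definition qcartan :: "int ^ 'n::finite ^ 'n \<Rightarrow> ('n \<Rightarrow> nat) \<Rightarrow> int fls ^ 'n ^ 'n" where
  "qcartan C r =
     (\<chi> i j. if i = j then zpow (int (r i)) + zpow (- int (r i)) else qint (C $ i $ j))"

text \<open>The inverse is taken directly over \<open>\<int>((z\<^sup>-\<^sup>1))\<close>: the expansion in \<open>z\<^sup>-\<^sup>1\<close> is an embedding
  of fields of \<open>\<rat>(z)\<close> into \<open>\<rat>((z\<^sup>-\<^sup>1))\<close>, and the determinant of the quantum Cartan matrix
  has leading coefficient 1.\<close>

definition qcartan_inv :: "int ^ 'n::finite ^ 'n \<Rightarrow> ('n \<Rightarrow> nat) \<Rightarrow> int fls ^ 'n ^ 'n" where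
  "qcartan_inv C r = matrix_inv (qcartan C r)"

lemma zpow_add: "zpow k * zpow l = zpow (k + l)"
  by (simp only: zpow_def fls_X_intpow_times_fls_X_intpow minus_add_distrib)

lemma zpow_0: "zpow 0 = 1"
  by (simp add: zpow_def)

lemma zpow_neq: "zpow 1 - zpow (-1) \<noteq> 0"
proof
  assume "zpow 1 - zpow (-1) = 0"
  then have "fls_subdegree (zpow 1) = fls_subdegree (zpow (-1))" by simp
  then show False by (simp add: zpow_def del: fls_shift_fls_shift)
qed

lemma qint_exists_nat:
  "\<exists>q. q * (zpow 1 - zpow (-1)) = zpow (int n) - zpow (- int n)"
proof (induction n rule: less_induct)
  case (less n)
  consider "n = 0" | "n = 1" | k where "n = Suc (Suc k)"
    by (cases n rule: nat.exhaust; metis One_nat_def not0_implies_Suc)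
  then show ?case
  proof cases
    case 1
    then show ?thesis by (intro exI[of _ 0]) simp
  next
    case 2
    then show ?thesis by (intro exI[of _ 1]) simp
  next
    case 3
    from less.IH[of k] 3 obtain q where
      q: "q * (zpow 1 - zpow (-1)) = zpow (int k) - zpow (- int k)" by auto
    have "(q + (zpow (int k + 1) + zpow (- int k - 1))) * (zpow 1 - zpow (-1))
        = (zpow (int k) - zpow (- int k))
          + (zpow (int k + 1) + zpow (- int k - 1)) * (zpow 1 - zpow (-1))"
      by (simp only: distrib_right q)
    also have "\<dots> = zpow (int n) - zpow (- int n)"
      using 3 by (simp add: algebra_simps zpow_add)
    finally show ?thesis by blast
  qed
qed

lemma qint_exists: "\<exists>q. q * (zpow 1 - zpow (-1)) = zpow l - zpow (- l)"
proof (cases "l \<ge> 0")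
  case True
  then show ?thesis using qint_exists_nat[of "nat l"] by simp
next
  case False
  then obtain q where "q * (zpow 1 - zpow (-1)) = zpow (- l) - zpow l"
    using qint_exists_nat[of "nat (- l)"] by auto
  then have "(- q) * (zpow 1 - zpow (-1)) = zpow l - zpow (- l)"
    by (metis minus_diff_eq mult_minus_left)
  then show ?thesis by blast
qed

lemma qint_mult: "qint l * (zpow 1 - zpow (-1)) = zpow l - zpow (- l)"
proof -
  have "\<exists>!q. q * (zpow 1 - zpow (-1)) = zpow l - zpow (- l)"
    using qint_exists[of l] mult_right_cancel[OF zpow_neq] by metis
  then show ?thesis unfolding qint_def by (rule theI')
qed


section \<open>Laurent monomials\<close>

text \<open>A Laurent monomial is its finitely supported family of exponents, so the group of
  monomials is written additively: \<open>m\<^sub>1 + m\<^sub>2\<close> is the product and \<open>0\<close> the monomial 1.\<close>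

type_synonym 'n monom = "('n \<times> int) \<Rightarrow>\<^sub>0 int"

definition uexp :: "'n monom \<Rightarrow> 'n \<Rightarrow> int \<Rightarrow> int" where
  "uexp m i l = Poly_Mapping.lookup m (i, l)"

definition Yvar :: "'n \<Rightarrow> int \<Rightarrow> 'n monom" where
  "Yvar i l = Poly_Mapping.single (i, l) 1"

definition Avar :: "int ^ 'n::finite ^ 'n \<Rightarrow> ('n \<Rightarrow> nat) \<Rightarrow> 'n \<Rightarrow> int \<Rightarrow> 'n monom" where
  "Avar C r i l =
     Yvar i (l - int (r i)) + Yvar i (l + int (r i))
     - (\<Sum>j | C $ j $ i = -1. Yvar j l)
     - (\<Sum>j | C $ j $ i = -2. Yvar j (l + 1) + Yvar j (l - 1))
     - (\<Sum>j | C $ j $ i = -3. Yvar j (l + 2) + Yvar j l + Yvar j (l - 2))"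

definition Bi :: "'n \<Rightarrow> 'n monom set" where
  "Bi i = {m. \<forall>l. uexp m i l \<ge> 0}"

definition dominant_monoms :: "'n monom set" where
  "dominant_monoms = (\<Inter>i. Bi i)"

definition Ainv_products :: "int ^ 'n::finite ^ 'n \<Rightarrow> ('n \<Rightarrow> nat) \<Rightarrow> nat \<Rightarrow> 'n monom set" where
  "Ainv_products C r K =
     {(\<Sum>(j, l)\<in>#S. - Avar C r j l) | S :: ('n \<times> int) multiset. size S = K}"


section \<open>The quantum torus and its completion\<close>

text \<open>\<open>\<int>[t\<^sup>\<plusminus>\<^sup>1]\<close> is the group ring of \<^typ>\<open>int\<close>: the product of \<^typ>\<open>int \<Rightarrow>\<^sub>0 int\<close> is convolution.\<close>

type_synonym laurent = "int \<Rightarrow>\<^sub>0 int"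

definition tpow :: "int \<Rightarrow> laurent" where
  "tpow k = Poly_Mapping.single k 1"

text \<open>An element of the product of all \<open>\<int>[t\<^sup>\<plusminus>\<^sup>1] :m:\<close> is its family of coefficients.\<close>

type_synonym 'n series = "'n monom \<Rightarrow> laurent"

definition monoms :: "'n series \<Rightarrow> 'n monom set" where
  "monoms f = {m. f m \<noteq> 0}"

definition nord :: "'n monom \<Rightarrow> 'n series" where
  "nord m = (\<lambda>m'. if m' = m then 1 else 0)"

definition tscale :: "laurent \<Rightarrow> 'n series \<Rightarrow> 'n series" where
  "tscale c f = (\<lambda>m. c * f m)"

interpretation series: module "tscale :: laurent \<Rightarrow> 'n series \<Rightarrow> 'n series"
  by unfold_locales (auto simp: tscale_def fun_eq_iff algebra_simps)

definition NY :: "int ^ 'n::finite ^ 'n \<Rightarrow> ('n \<Rightarrow> nat) \<Rightarrow> 'n \<Rightarrow> int \<Rightarrow> 'n \<Rightarrow> int \<Rightarrow> int" where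
  "NY C r i l j k =
     zcoeff (qcartan_inv C r $ j $ i) (int (r j) + l - k)
     - zcoeff (qcartan_inv C r $ j $ i) (- int (r j) + l - k)"

definition Nform :: "int ^ 'n::finite ^ 'n \<Rightarrow> ('n \<Rightarrow> nat) \<Rightarrow> 'n monom \<Rightarrow> 'n monom \<Rightarrow> int" where
  "Nform C r m\<^sub>1 m\<^sub>2 =
     (\<Sum>(i, l)\<in>Poly_Mapping.keys m\<^sub>1. \<Sum>(j, k)\<in>Poly_Mapping.keys m\<^sub>2.
        uexp m\<^sub>1 i l * uexp m\<^sub>2 j k * NY C r i l j k)"

text \<open>The bilinear product with \<open>:m\<^sub>1: :m\<^sub>2: = t\<^bsup>N(m\<^sub>1,m\<^sub>2)\<^esup> :m\<^sub>1m\<^sub>2:\<close>, extended to series.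
  On \<open>Yt_inf\<close> (hence on \<open>Yt\<close>) only finitely many pairs contribute to each coefficient,
  so that the sum is the intended one; outside of it the operation is never used.\<close>

definition tmult ::
  "int ^ 'n::finite ^ 'n \<Rightarrow> ('n \<Rightarrow> nat) \<Rightarrow> 'n series \<Rightarrow> 'n series \<Rightarrow> 'n series" where
  "tmult C r f g =
     (\<lambda>m. \<Sum>(m\<^sub>1, m\<^sub>2) | m\<^sub>1 \<in> monoms f \<and> m\<^sub>2 \<in> monoms g \<and> m\<^sub>1 + m\<^sub>2 = m.
            tpow (Nform C r m\<^sub>1 m\<^sub>2) * f m\<^sub>1 * g m\<^sub>2)"

definition tone :: "'n series" where
  "tone = nord 0"

definition Yt :: "'n series set" where
  "Yt = {f. finite (monoms f)}"

definition tinverse ::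
  "int ^ 'n::finite ^ 'n \<Rightarrow> ('n \<Rightarrow> nat) \<Rightarrow> 'n series \<Rightarrow> 'n series" where
  "tinverse C r f = (THE g. g \<in> Yt \<and> tmult C r f g = tone \<and> tmult C r g f = tone)"

definition tprod_list ::
  "int ^ 'n::finite ^ 'n \<Rightarrow> ('n \<Rightarrow> nat) \<Rightarrow> 'n series list \<Rightarrow> 'n series" where
  "tprod_list C r fs = foldr (tmult C r) fs tone"

text \<open>For negative exponents, note that \<open>:Y: :Y\<^sup>-\<^sup>1: \<noteq> 1\<close> in general, so that the inverse of
  \<open>:Y:\<close> is a multiple of \<open>:Y\<^sup>-\<^sup>1:\<close> by a power of \<open>t\<close>.\<close>

definition tpower_int ::
  "int ^ 'n::finite ^ 'n \<Rightarrow> ('n \<Rightarrow> nat) \<Rightarrow> 'n series \<Rightarrow> int \<Rightarrow> 'n series" where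
  "tpower_int C r f k =
     (if k \<ge> 0 then tprod_list C r (replicate (nat k) f)
      else tprod_list C r (replicate (nat (- k)) (tinverse C r f)))"

definition YtA :: "int ^ 'n::finite ^ 'n \<Rightarrow> ('n \<Rightarrow> nat) \<Rightarrow> nat \<Rightarrow> 'n series set" where
  "YtA C r K = series.span (nord ` Ainv_products C r K)"

text \<open>\<open>formal_sum g f\<close> states that \<open>f\<close> is the sum of the family \<open>g\<close>, which is required to be
  locally finite.\<close>

definition formal_sum :: "(nat \<Rightarrow> 'n series) \<Rightarrow> 'n series \<Rightarrow> bool" where
  "formal_sum g f \<longleftrightarrow>
     (\<forall>m. finite {K. g K m \<noteq> 0} \<and> f m = (\<Sum>K | g K m \<noteq> 0. g K m))"

text \<open>The \<open>A\<^sub>i\<^sub>,\<^sub>l\<close> are algebraically independent, hence the \<open>YtA C r K\<close> have pairwise disjoint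
  sets of monomials and their direct product consists of the formal sums.\<close>

definition YtA_inf :: "int ^ 'n::finite ^ 'n \<Rightarrow> ('n \<Rightarrow> nat) \<Rightarrow> 'n series set" where
  "YtA_inf C r = {f. \<exists>g. (\<forall>K. g K \<in> YtA C r K) \<and> formal_sum g f}"

definition Yt_inf :: "int ^ 'n::finite ^ 'n \<Rightarrow> ('n \<Rightarrow> nat) \<Rightarrow> 'n series set" where
  "Yt_inf C r =
     {(\<Sum>M\<in>F. tmult C r (nord M) (g M)) | F g. finite F \<and> (\<forall>M\<in>F. g M \<in> YtA_inf C r)}"


section \<open>The subalgebras\<close>

text \<open>The factors \<open>:Y\<^sub>j\<^sub>,\<^sub>l:\<close> with the same \<open>l\<close> commute, hence their order is irrelevant; we take
  increasing \<open>j\<close>. Values of \<open>l\<close> for which no \<open>Y\<^sub>j\<^sub>,\<^sub>l\<close> occurs in \<open>m\<close> contribute a factor 1.\<close>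

definition Et_factor ::
  "int ^ 'n::{finite,linorder} ^ 'n::{finite,linorder} \<Rightarrow> ('n \<Rightarrow> nat) \<Rightarrow> 'n \<Rightarrow> 'n monom \<Rightarrow> int \<Rightarrow> 'n series" where
  "Et_factor C r i m l =
     tmult C r
       (tpower_int C r
          (tmult C r (nord (Yvar i l))
             (tone + tscale (tpow 1) (tinverse C r (nord (Avar C r i (l + int (r i)))))))
          (uexp m i l))
       (tprod_list C r
          (map (\<lambda>j. tpower_int C r (nord (Yvar j l)) (uexp m j l))
             (sorted_list_of_set (UNIV - {i}))))"

definition Et ::
  "int ^ 'n::{finite,linorder} ^ 'n::{finite,linorder} \<Rightarrow> ('n \<Rightarrow> nat) \<Rightarrow> 'n \<Rightarrow> 'n monom \<Rightarrow> 'n series" where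
  "Et C r i m =
     tprod_list C r
       (map (Et_factor C r i m) (sorted_list_of_set (snd ` Poly_Mapping.keys m)))"

definition Ki_part ::
  "int ^ 'n::{finite,linorder} ^ 'n::{finite,linorder} \<Rightarrow> ('n \<Rightarrow> nat) \<Rightarrow> 'n \<Rightarrow> 'n monom \<Rightarrow> 'n series set" where
  "Ki_part C r i M =
     {f. \<exists>(S :: nat \<Rightarrow> 'n monom set) (c :: 'n monom \<Rightarrow> laurent).
          (\<forall>K. finite (S K) \<and> S K \<subseteq> {a \<in> Ainv_products C r K. M + a \<in> Bi i}) \<and>
          formal_sum (\<lambda>K. \<Sum>a\<in>S K. tscale (c a) (Et C r i (M + a))) f}"

definition Ki_inf ::
  "int ^ 'n::{finite,linorder} ^ 'n::{finite,linorder} \<Rightarrow> ('n \<Rightarrow> nat) \<Rightarrow> 'n \<Rightarrow> 'n series set" where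
  "Ki_inf C r i =
     {f \<in> Yt_inf C r. \<exists>F g. finite F \<and> (\<forall>M\<in>F. g M \<in> Ki_part C r i M) \<and> f = (\<Sum>M\<in>F. g M)}"

definition K_inf ::
  "int ^ 'n::{finite,linorder} ^ 'n::{finite,linorder} \<Rightarrow> ('n \<Rightarrow> nat) \<Rightarrow> 'n series set" where
  "K_inf C r = (\<Inter>i. Ki_inf C r i)"

definition K_inf_f ::
  "int ^ 'n::{finite,linorder} ^ 'n::{finite,linorder} \<Rightarrow> ('n \<Rightarrow> nat) \<Rightarrow> 'n series set" where
  "K_inf_f C r = series.span {f \<in> K_inf C r. finite (monoms f \<inter> dominant_monoms)}"

text \<open>Unital subalgebras over \<open>\<int>[t\<^sup>\<plusminus>\<^sup>1]\<close>, for the product \<^const>\<open>tmult\<close>.\<close>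

definition is_subalgebra ::
  "int ^ 'n::finite ^ 'n \<Rightarrow> ('n \<Rightarrow> nat) \<Rightarrow> 'n series set \<Rightarrow> 'n series set \<Rightarrow> bool" where
  "is_subalgebra C r S T \<longleftrightarrow>
     S \<subseteq> T \<and> series.subspace S \<and> tone \<in> S \<and> (\<forall>f\<in>S. \<forall>g\<in>S. tmult C r f g \<in> S)"

end

theory Submission
  imports Defs
begin

text \<open>Pairing weights with \<open>\<rho>\<^sup>\<or>\<close> gives an additive height on monomials which is 1 on every \<open>A\<^sub>i\<^sub>,\<^sub>l\<close> and,
  the inverse of a Cartan matrix of finite type being nonnegative, at least 0 on dominant monomials.
  An element of \<open>\<Y>\<^sub>t\<^sup>\<infinity>\<close> has finitely many monomials above any given height, hence always finitely many
  dominant ones, so the submodule in question is all of \<open>\<K>\<^sub>t\<^sup>\<infinity>\<close>. It remains to multiply in each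
  \<open>\<K>\<^sub>i\<^sub>,\<^sub>t\<^sup>\<infinity>\<close>. There \<open>X\<^sub>l = Y\<^sub>i\<^sub>,\<^sub>l (1 + t A\<^sub>i\<^sub>,\<^sub>l\<^sub>+\<^sub>r\<^sup>-\<^sup>1)\<close> and \<open>X\<^sub>k\<close> commute up to a power of \<open>t\<close> and, if
  \<open>\<bar>k - l\<bar> = 2r\<close>, a monomial without \<open>Y\<^sub>i\<close>; straightening words in the \<open>X\<^sub>l\<close> writes \<open>E\<^sub>i\<^sub>,\<^sub>t(m) E\<^sub>i\<^sub>,\<^sub>t(m')\<close>
  as a finite combination of \<open>E\<^sub>i\<^sub>,\<^sub>t(m'')\<close> with \<open>m'' \<in> m m' A\<^sup>-\<^sup>1\<cdots>A\<^sup>-\<^sup>1\<close>, and infinite sums reduce to finite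
  ones by truncation in height.\<close>

section \<open>Cartan matrices of finite type\<close>

text \<open>\<open>qcartan_inv\<close> is an inverse obtained by choice, so nothing is known about N
  until C(z) is shown invertible over Z((z^-1)). This needs the powers z^(r_j) on the diagonal to
  dominate their columns, that is -C_ij <= r_j for i different from j, and here the coprimality of
  the r_i enters: in finite type a connected diagram has at most one multiple edge, which forces r_i
  = 1 as soon as C_ij <= -2. The same fact makes diag(z^(-r_i) - z^(r_i)) C(z) symmetric, whence
  N(Y,A) = -N(A,Y) although N is not antisymmetric in general. The second obstacle is convergence.
  The product is shown to be bilinear only where the left factor is a finite sum. Straightening E(m)
  E(m') therefore has to control not just a span but the position of each m'' relative to m m', so
  that the product of two infinite sums is again a locally finite sum of the right shape. All
  reorderings are made up to powers of t, which are units and do not affect spans.\<close>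

definition cform :: "('n \<Rightarrow> real) \<Rightarrow> int ^ 'n::finite ^ 'n \<Rightarrow> ('n \<Rightarrow> real) \<Rightarrow> ('n \<Rightarrow> real) \<Rightarrow> real" where
  "cform d C x y = (\<Sum>i\<in>UNIV. \<Sum>j\<in>UNIV. x i * (d i * of_int (C $ i $ j)) * y j)"

lemma cform_add_left: "cform d C (\<lambda>i. x i + y i) z = cform d C x z + cform d C y z"
  by (simp add: cform_def algebra_simps sum.distrib)

lemma cform_add_right: "cform d C z (\<lambda>i. x i + y i) = cform d C z x + cform d C z y"
  by (simp add: cform_def algebra_simps sum.distrib)

lemma cform_scale_left: "cform d C (\<lambda>i. a * x i) z = a * cform d C x z"
  by (simp add: cform_def algebra_simps sum_distrib_left)

lemma cform_scale_right: "cform d C z (\<lambda>i. a * x i) = a * cform d C z x"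
  by (simp add: cform_def algebra_simps sum_distrib_left)

lemma cform_ind_left: "cform d C (\<lambda>i. of_bool (i = k)) y = (\<Sum>j\<in>UNIV. d k * of_int (C $ k $ j) * y j)"
proof -
  have "cform d C (\<lambda>i. of_bool (i = k)) y
      = (\<Sum>i\<in>UNIV. if i = k then (\<Sum>j\<in>UNIV. d i * of_int (C $ i $ j) * y j) else 0)"
    unfolding cform_def by (rule sum.cong) auto
  then show ?thesis by simp
qed

lemma cform_ind_ind: "cform d C (\<lambda>i. of_bool (i = k)) (\<lambda>i. of_bool (i = l)) = d k * of_int (C $ k $ l)"
proof -
  have "(\<Sum>j\<in>UNIV. d k * of_int (C $ k $ j) * of_bool (j = l))
      = (\<Sum>j\<in>UNIV. if j = l then d k * of_int (C $ k $ j) else 0)"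
    by (rule sum.cong) auto
  then show ?thesis unfolding cform_ind_left by simp
qed

text \<open>The real symmetrizer d that witnesses finite type is kept apart from the integers r_i:
  it carries positive definiteness, they carry coprimality.\<close>

locale finite_type =
  fixes C :: "int ^ 'n::finite ^ 'n" and d :: "'n \<Rightarrow> real"
  assumes diag: "C $ i $ i = 2"
    and off_diag: "i \<noteq> j \<Longrightarrow> C $ i $ j \<le> 0"
    and zero_iff: "C $ i $ j = 0 \<longleftrightarrow> C $ j $ i = 0"
    and d_pos: "d i > 0"
    and d_sym: "d i * of_int (C $ i $ j) = d j * of_int (C $ j $ i)"
    and pos_def: "x \<noteq> (\<lambda>_. 0) \<Longrightarrow> cform d C x x > 0"

lemma finite_type_cartanE:
  fixes C :: "int ^ 'n::finite ^ 'n"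
  assumes "finite_type_cartan C"
  obtains d :: "'n \<Rightarrow> real" where "finite_type C d"
proof -
  note ft = assms[unfolded finite_type_cartan_def]
  note C = conjunct1[OF ft] conjunct1[OF conjunct2[OF ft]] conjunct1[OF conjunct2[OF conjunct2[OF ft]]]
  from conjunct2[OF conjunct2[OF conjunct2[OF ft]]] obtain d :: "'n \<Rightarrow> real" where d:
    "(\<forall>i. d i > 0) \<and> (\<forall>i j. d i * of_int (C $ i $ j) = d j * of_int (C $ j $ i)) \<and>
     (\<forall>x :: real ^ 'n. x \<noteq> 0 \<longrightarrow>
        (\<Sum>i\<in>UNIV. \<Sum>j\<in>UNIV. x $ i * (d i * of_int (C $ i $ j)) * x $ j) > 0)"
    by (rule exE)
  note d' = conjunct1[OF d] conjunct1[OF conjunct2[OF d]] conjunct2[OF conjunct2[OF d]]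
  have "cform d C x x > 0" if "x \<noteq> (\<lambda>_. 0)" for x
  proof -
    have "(\<chi> i. x i) \<noteq> 0" using that by (auto simp: vec_eq_iff fun_eq_iff)
    from d'(3)[rule_format, OF this] show ?thesis by (simp add: cform_def)
  qed
  note pd = this
  have "finite_type C d"
    by (rule finite_type.intro)
      (rule C(1)[rule_format] C(2)[rule_format] C(3)[rule_format]
        d'(1)[rule_format] d'(2)[rule_format] pd; assumption)+
  then show ?thesis by (rule that)
qed

context finite_type
begin

lemma cform_sym: "cform d C x y = cform d C y x"
  unfolding cform_def
  by (subst sum.swap, intro sum.cong refl) (use d_sym in \<open>simp add: mult.commute mult.left_commute\<close>)

section \<open>Rank two: the possible pairs of off-diagonal entries\<close>

lemma prod_less_4:
  assumes "i \<noteq> j" shows "C $ i $ j * C $ j $ i < 4"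
proof -
  define a b where "a = real_of_int (C $ i $ j)" and "b = real_of_int (C $ j $ i)"
  \<comment> \<open>The vector 2 e_i - C_ji e_j is orthogonal to e_j, so its norm takes the closed
    form 2 d_i (4 - C_ij C_ji).\<close>
  define x where "x = (\<lambda>k. (2::real) * of_bool (k = i) + (- b) * of_bool (k = j))"
  have "x i = 2" using assms by (simp add: x_def)
  then have "x \<noteq> (\<lambda>_. 0)" by auto
  then have "0 < cform d C x x" by (rule pos_def)
  also have "cform d C x x = 4 * (d i * 2) - 2 * b * (d i * a) - 2 * b * (d j * b) + b * b * (d j * 2)"
    unfolding x_def cform_add_left cform_add_right cform_scale_left cform_scale_right cform_ind_ind
    by (simp add: diag a_def b_def algebra_simps)
  also have "\<dots> = 2 * d i * (4 - a * b)" by (simp add: algebra_simps)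
  finally have "a * b < 4" using d_pos[of i] by (simp add: zero_less_mult_iff)
  then have "real_of_int (C $ i $ j * C $ j $ i) < real_of_int 4" by (simp add: a_def b_def)
  then show ?thesis by (simp only: of_int_less_iff)
qed

text \<open>Two nonnegative integers that vanish together and have product below 4 leave only the
  types A_1 x A_1, A_2, B_2 and G_2, the last two in both orientations.\<close>

lemma off_diag_cases:
  assumes "i \<noteq> j"
  shows "C $ i $ j = 0 \<and> C $ j $ i = 0 \<or> C $ i $ j = -1 \<and> C $ j $ i = -1 \<or>
    C $ i $ j \<in> {-2, -3} \<and> C $ j $ i = -1 \<or> C $ i $ j = -1 \<and> C $ j $ i \<in> {-2, -3}"
proof -
  define a b where "a = - C $ i $ j" and "b = - C $ j $ i"
  have ab: "a * b < 4" "a \<ge> 0" "b \<ge> 0" "a = 0 \<longleftrightarrow> b = 0"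
    using prod_less_4[OF assms] off_diag[OF assms] off_diag[of j i] assms zero_iff[of i j]
    by (auto simp: a_def b_def)
  have *: "a \<le> 3 \<and> b \<le> 3 \<and> (a = 0 \<and> b = 0 \<or> a = 1 \<or> b = 1)"
  proof (cases "a = 0")
    case False
    then have pos: "a \<ge> 1" "b \<ge> 1" using ab by auto
    have "a \<le> a * b" "b \<le> a * b" using pos mult_left_mono[of 1 b a] mult_right_mono[of 1 a b] by auto
    moreover have "a = 1 \<or> b = 1"
    proof (rule ccontr)
      assume "\<not> ?thesis"
      then have "a \<ge> 2" "b \<ge> 2" using pos by auto
      then have "2 * 2 \<le> a * b" by (intro mult_mono) auto
      then show False using ab by auto
    qed
    ultimately show ?thesis using ab by auto
  qed (use ab in auto)
  then have "a = 0 \<or> a = 1 \<or> a = 2 \<or> a = 3" "b = 0 \<or> b = 1 \<or> b = 2 \<or> b = 3"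
    using ab by linarith+
  with * ab(4) have
    "a = 0 \<and> b = 0 \<or> a = 1 \<and> b = 1 \<or> (a = 2 \<or> a = 3) \<and> b = 1 \<or> a = 1 \<and> (b = 2 \<or> b = 3)"
    by linarith
  moreover have "C $ i $ j = - a" "C $ j $ i = - b" by (simp_all add: a_def b_def)
  ultimately show ?thesis by auto
qed

section \<open>Simple and multiple edges of the Dynkin diagram\<close>

definition simple_edge :: "('n \<times> 'n) set" where
  "simple_edge = {(i, j). C $ i $ j = -1 \<and> C $ j $ i = -1}"

lemma simple_edge_d: "(i, j) \<in> simple_edge\<^sup>* \<Longrightarrow> d i = d j"
proof (induction rule: rtrancl_induct)
  case (step y z)
  then show ?case using d_sym[of y z] by (auto simp: simple_edge_def)
qed auto

definition cind :: "'n set \<Rightarrow> 'n \<Rightarrow> real" where "cind T = (\<lambda>i. of_bool (i \<in> T))"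

text \<open>Since z lies outside T, every summand is nonpositive, and keeping only the one at x can
  only raise the value.\<close>

lemma cform_cind_bound:
  assumes "z \<notin> T" "x \<in> T"
  shows "cform d C (\<lambda>i. of_bool (i = z)) (cind T) \<le> d z * of_int (C $ z $ x)"
proof -
  have "cform d C (\<lambda>i. of_bool (i = z)) (cind T) = (\<Sum>j\<in>UNIV. d z * of_int (C $ z $ j) * of_bool (j \<in> T))"
    unfolding cform_ind_left by (simp add: cind_def)
  also have "\<dots> \<le> (\<Sum>j\<in>UNIV. if j = x then d z * of_int (C $ z $ x) else 0)"
  proof (rule sum_mono)
    fix j
    show "d z * of_int (C $ z $ j) * of_bool (j \<in> T) \<le> (if j = x then d z * of_int (C $ z $ x) else 0)"
      using assms off_diag[of z j] d_pos[of z]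
      by (cases "z = j") (auto simp: mult_nonneg_nonpos less_imp_le)
  qed
  also have "\<dots> = d z * of_int (C $ z $ x)" by simp
  finally show ?thesis .
qed

text \<open>The quadratic form does not grow when a vertex is added along a simple edge.\<close>

lemma simple_tree:
  assumes "(x, y) \<in> simple_edge\<^sup>*"
  shows "\<exists>T. x \<in> T \<and> y \<in> T \<and> T \<subseteq> simple_edge\<^sup>* `` {x} \<and> cform d C (cind T) (cind T) \<le> 2 * d x"
  using assms
proof (induction rule: rtrancl_induct)
  case base
  have "cind {x} = (\<lambda>i. of_bool (i = x))" by (auto simp: cind_def)
  then have "cform d C (cind {x}) (cind {x}) = 2 * d x" by (simp add: cform_ind_ind diag)
  then show ?case by (intro exI[of _ "{x}"]) auto
next
  case (step y z)
  then obtain T where T: "x \<in> T" "y \<in> T" "T \<subseteq> simple_edge\<^sup>* `` {x}"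
    "cform d C (cind T) (cind T) \<le> 2 * d x" by auto
  show ?case
  proof (cases "z \<in> T")
    case True
    with T show ?thesis by blast
  next
    case False
    have "(x, z) \<in> simple_edge\<^sup>*" using step by auto
    have dz: "d z = d x" using simple_edge_d[OF \<open>(x, z) \<in> simple_edge\<^sup>*\<close>] by simp
    have *: "cind (insert z T) = (\<lambda>i. cind T i + of_bool (i = z))"
      using False by (auto simp: cind_def)
    have "cform d C (cind (insert z T)) (cind (insert z T))
      = cform d C (cind T) (cind T) + 2 * cform d C (\<lambda>i. of_bool (i = z)) (cind T) + 2 * d z"
      unfolding * cform_add_left cform_add_right using cform_sym[of "cind T" "\<lambda>i. of_bool (i = z)"]
      by (simp add: cform_ind_ind diag)
    \<comment> \<open>The new vertex adds its own norm 2 d_z = 2 d_x. The cross term with T is at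
      most d_z C_zy = -d_x and counts twice, which cancels this.\<close>
    also have "\<dots> \<le> 2 * d x + 2 * (- d x) + 2 * d x"
      using cform_cind_bound[OF False \<open>y \<in> T\<close>] T(4) step(2) by (auto simp: dz simple_edge_def)
    finally have "cform d C (cind (insert z T)) (cind (insert z T)) \<le> 2 * d x" by simp
    with T show ?thesis using \<open>(x, z) \<in> simple_edge\<^sup>*\<close>
      by (intro exI[of _ "insert z T"]) auto
  qed
qed

text \<open>Join the two multiple edges by a set T of vertices as in \<open>simple_tree\<close>. Its
  indicator has norm at most 2 d_x0, and adding suitable multiples of e_w and e_y lowers the form by
  at least d_x0 each. The result is a nonzero vector on which the form is not positive.\<close>

lemma no_two_multiple_edges:
  assumes x: "(x0, x) \<in> simple_edge\<^sup>*"
    and w: "C $ x0 $ w * C $ w $ x0 \<ge> 2" "w \<noteq> x0"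
    and y: "C $ x $ y * C $ y $ x \<ge> 2" "y \<noteq> x"
    and "w \<noteq> y"
  shows False
proof -
  \<comment> \<open>The scalar d is constant along simple edges but differs at the two ends of a
    multiple edge.\<close>
  have notin: "b \<notin> simple_edge\<^sup>* `` {x0}"
    if "C $ a $ b * C $ b $ a \<ge> 2" "(x0, a) \<in> simple_edge\<^sup>*" "b \<noteq> a" for a b
  proof
    assume "b \<in> simple_edge\<^sup>* `` {x0}"
    then have "d a = d b" using simple_edge_d[of x0 a] simple_edge_d[of x0 b] that by auto
    then have "C $ a $ b = C $ b $ a" using d_sym[of a b] d_pos[of b] by simp
    then show False using off_diag_cases[of a b] that by auto
  qed
  obtain T where T: "x0 \<in> T" "x \<in> T" "T \<subseteq> simple_edge\<^sup>* `` {x0}"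
    "cform d C (cind T) (cind T) \<le> 2 * d x0" using simple_tree[OF x] by auto
  have wT: "w \<notin> T" and yT: "y \<notin> T" using notin[of x0 w] notin[of x y] w y x T(3) by auto
  let ?e = "\<lambda>k i. of_bool (i = k) :: real"
  have key: "\<exists>\<alpha>\<ge>0. \<alpha> * \<alpha> * cform d C (?e b) (?e b) + 2 * \<alpha> * cform d C (?e b) (cind T) \<le> - d x0"
    if ab: "C $ a $ b * C $ b $ a \<ge> 2" "(x0, a) \<in> simple_edge\<^sup>*" "b \<noteq> a" "a \<in> T" "b \<notin> T" for a b
  proof -
    define p q where "p = - real_of_int (C $ a $ b)" and "q = - real_of_int (C $ b $ a)"
    \<comment> \<open>The minimum of 2 d_b alpha^2 - 2 d_b q alpha is at alpha = q/2, with value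
      -d_b q^2 / 2 = -d_a p q / 2.\<close>
    define al where "al = q / 2"
    have "real_of_int (C $ a $ b * C $ b $ a) \<ge> real_of_int 2" using ab(1) by (simp only: of_int_le_iff)
    then have pq: "p * q \<ge> 2" by (simp add: p_def q_def)
    have q: "q \<ge> 0" using off_diag[of b a] ab by (simp add: q_def)
    have da: "d a = d x0" using simple_edge_d[OF ab(2)] by simp
    have dq: "d b * q = d a * p" using d_sym[of a b] by (simp add: p_def q_def)
    have "cform d C (?e b) (cind T) \<le> - (d b * q)"
      using cform_cind_bound[OF ab(5,4)] by (simp add: q_def)
    then have "al * al * cform d C (?e b) (?e b) + 2 * al * cform d C (?e b) (cind T)
        \<le> al * al * (2 * d b) + 2 * al * (- (d b * q))"
      using q by (intro add_mono mult_left_mono) (auto simp: al_def cform_ind_ind diag)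
    also have "\<dots> = - (d b * q) * q / 2" by (simp add: al_def field_simps)
    also have "\<dots> = - d x0 * (p * q) / 2" by (simp add: dq da)
    also have "\<dots> \<le> - d x0" using pq d_pos[of x0] by (simp add: field_simps)
    finally show ?thesis using q by (intro exI[of _ al]) (auto simp: al_def)
  qed
  obtain \<alpha> where \<alpha>: "\<alpha> \<ge> 0"
    "\<alpha> * \<alpha> * cform d C (?e w) (?e w) + 2 * \<alpha> * cform d C (?e w) (cind T) \<le> - d x0"
    using key[of x0 w] w T wT by auto
  obtain \<beta> where \<beta>: "\<beta> \<ge> 0"
    "\<beta> * \<beta> * cform d C (?e y) (?e y) + 2 * \<beta> * cform d C (?e y) (cind T) \<le> - d x0"
    using key[of x y] y x T yT by auto
  define v where "v = (\<lambda>i. (cind T i + \<alpha> * ?e w i) + \<beta> * ?e y i)"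
  have "v x0 > 0" using T(1) \<alpha>(1) \<beta>(1) by (auto simp: v_def cind_def add_pos_nonneg)
  then have "v \<noteq> (\<lambda>_. 0)" by auto
  then have "0 < cform d C v v" by (rule pos_def)
  also have "cform d C v v = cform d C (cind T) (cind T)
     + (\<alpha> * \<alpha> * cform d C (?e w) (?e w) + 2 * \<alpha> * cform d C (?e w) (cind T))
     + (\<beta> * \<beta> * cform d C (?e y) (?e y) + 2 * \<beta> * cform d C (?e y) (cind T))
     + 2 * \<alpha> * \<beta> * cform d C (?e w) (?e y)"
    unfolding v_def cform_add_left cform_add_right cform_scale_left cform_scale_right
    using cform_sym[of "cind T" "?e w"] cform_sym[of "cind T" "?e y"] cform_sym[of "?e y" "?e w"]
    by (simp add: algebra_simps)
  also have "\<dots> \<le> 2 * d x0 + (- d x0) + (- d x0) + 0"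
  proof (intro add_mono T(4) \<alpha>(2) \<beta>(2))
    have "cform d C (?e w) (?e y) \<le> 0"
      unfolding cform_ind_ind using off_diag[OF \<open>w \<noteq> y\<close>] d_pos[of w] by (simp add: mult_nonneg_nonpos)
    then show "2 * \<alpha> * \<beta> * cform d C (?e w) (?e y) \<le> 0"
      using \<alpha>(1) \<beta>(1) by (simp add: mult_nonneg_nonpos)
  qed
  finally show False by simp
qed

text \<open>Solve S e = (1, ..., 1) for the symmetrized matrix S and put c_i = d_i e_i.
  Nonnegativity is the usual argument for positive definite matrices with nonpositive off-diagonal
  entries: pair e with its negative part f. The result is the sum of the f_i, hence nonnegative, but
  it also equals form(f, g) - form(f, f) with g the positive part, which is negative unless f =
  0.\<close>

lemma height_weights:
  "\<exists>c :: 'n \<Rightarrow> real. (\<forall>i. c i \<ge> 0) \<and> (\<forall>j. (\<Sum>i\<in>UNIV. c i * of_int (C $ i $ j)) = 1)"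
proof -
  define S :: "real ^ 'n ^ 'n" where "S = (\<chi> i j. d i * of_int (C $ i $ j))"
  have form: "cform d C x (\<lambda>j. y $ j) = (\<Sum>i\<in>UNIV. x i * (S *v y) $ i)" for x y
    by (simp add: cform_def S_def matrix_vector_mult_def sum_distrib_left mult_ac)
  have "x = 0" if "S *v x = 0" for x
  proof (rule ccontr)
    assume "x \<noteq> 0"
    then have "(\<lambda>i. x $ i) \<noteq> (\<lambda>_. 0)" by (auto simp: vec_eq_iff fun_eq_iff)
    from pos_def[OF this] form[of "\<lambda>i. x $ i" x] that show False by simp
  qed
  then obtain B where "B ** S = mat 1"
    using matrix_left_invertible_ker[of S] by auto
  then have SB: "S ** B = mat 1" using matrix_left_right_inverse by blast
  define e where "e = B *v (\<chi> i. 1)"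
  have Se: "(S *v e) $ i = 1" for i
    unfolding e_def matrix_vector_mul_assoc SB by simp
  have nonneg: "e $ i \<ge> 0" for i
  proof (rule ccontr)
    assume neg: "\<not> e $ i \<ge> 0"
    define f where "f = (\<lambda>i. max 0 (- e $ i))"
    define g where "g = (\<lambda>i. max 0 (e $ i))"
    have e: "e $ i = g i + (-1) * f i" for i by (auto simp: f_def g_def)
    have "f i > 0" using neg by (simp add: f_def)
    then have "f \<noteq> (\<lambda>_. 0)" by auto
    then have "cform d C f f > 0" by (rule pos_def)
    \<comment> \<open>The parts f and g have disjoint supports, so only off-diagonal entries of C
      contribute.\<close>
    moreover have "cform d C f g \<le> 0"
      unfolding cform_def
    proof (intro sum_nonpos)
      fix i j
      show "f i * (d i * of_int (C $ i $ j)) * g j \<le> 0"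
      proof (cases "i = j")
        case True
        then show ?thesis by (auto simp: f_def g_def max_def)
      next
        case False
        then show ?thesis using off_diag[OF False] d_pos[of i]
          by (auto simp: f_def g_def mult_nonneg_nonpos mult_nonpos_nonneg)
      qed
    qed
    moreover have "cform d C f (\<lambda>i. e $ i) = (\<Sum>i\<in>UNIV. f i)"
      unfolding form Se by simp
    moreover have "(\<Sum>i\<in>UNIV. f i) \<ge> 0" by (intro sum_nonneg) (auto simp: f_def)
    moreover have "cform d C f (\<lambda>i. e $ i) = cform d C f g + (-1) * cform d C f f"
      unfolding e cform_add_right cform_scale_right ..
    ultimately show False by simp
  qed
  have "(\<Sum>i\<in>UNIV. (e $ i * d i) * of_int (C $ i $ j)) = 1" for j
  proof -
    have "(\<Sum>i\<in>UNIV. (e $ i * d i) * of_int (C $ i $ j)) = (\<Sum>i\<in>UNIV. S $ j $ i * e $ i)"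
      by (intro sum.cong refl) (use d_sym in \<open>simp add: S_def mult_ac\<close>)
    also have "\<dots> = (S *v e) $ j" by (simp add: matrix_vector_mult_def)
    finally show ?thesis by (simp add: Se)
  qed
  then show ?thesis using nonneg d_pos
    by (intro exI[of _ "\<lambda>i. e $ i * d i"]) (simp add: less_imp_le)
qed

end

section \<open>Consequences of coprimality for the r_i\<close>

locale cartan_datum = finite_type C d
  for C :: "int ^ 'n::finite ^ 'n" and d :: "'n \<Rightarrow> real" +
  fixes r :: "'n \<Rightarrow> nat"
  assumes coprime_sym: "coprime_symmetrizer C r"
begin

lemma r_pos: "r i > 0"
  and r_sym: "int (r i) * C $ i $ j = int (r j) * C $ j $ i"
  and r_Gcd: "Gcd (r ` component C i) = 1"
  using coprime_sym by (auto simp: coprime_symmetrizer_def)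

lemma simple_edge_r: "(i, j) \<in> simple_edge\<^sup>* \<Longrightarrow> r i = r j"
proof (induction rule: rtrancl_induct)
  case (step y z)
  then show ?case using r_sym[of y z] by (auto simp: simple_edge_def)
qed auto

text \<open>At most one edge of a connected Dynkin diagram is multiple, so along the component every
  \<open>r\<^sub>j\<close> is \<open>r\<^sub>i\<close> or \<open>r\<^sub>p\<close>, and both are multiples of \<open>r\<^sub>i\<close>.\<close>

lemma r_eq_1:
  assumes "i \<noteq> p" "C $ i $ p \<le> -2" shows "r i = 1"
proof -
  have ip: "C $ p $ i = -1" "C $ i $ p * C $ p $ i \<ge> 2" "C $ p $ i * C $ i $ p \<ge> 2"
    using off_diag_cases[OF assms(1)] assms(2) by auto
  have rp: "int (r p) = int (r i) * (- C $ i $ p)" using r_sym[of i p] ip by simp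
  then have "int (r i) dvd int (r p)" by (metis dvd_triv_left)
  then have dvd: "r i dvd r p" by simp
  \<comment> \<open>Vertices reachable by simple edges from either end of the multiple edge. They
    exhaust the component, since an edge leaving \<open>R\<close> would be a second multiple
    edge.\<close>
  define R where "R = simple_edge\<^sup>* `` {i} \<union> simple_edge\<^sup>* `` {p}"
  have closed: "y \<in> R" if "x \<in> R" "C $ x $ y \<noteq> 0" for x y
  proof (rule ccontr)
    assume yR: "y \<notin> R"
    then have "x \<noteq> y" using that by auto
    have "(x, y) \<notin> simple_edge" using that(1) yR by (auto simp: R_def intro: rtrancl_into_rtrancl)
    then have mult: "C $ x $ y * C $ y $ x \<ge> 2"
      using off_diag_cases[OF \<open>x \<noteq> y\<close>] that(2) by (auto simp: simple_edge_def)
    have "y \<noteq> i" "y \<noteq> p" using yR by (auto simp: R_def)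
    from that(1) consider "(i, x) \<in> simple_edge\<^sup>*" | "(p, x) \<in> simple_edge\<^sup>*"
      by (auto simp: R_def)
    then show False
    proof cases
      case 1
      from no_two_multiple_edges[OF 1 ip(2) _ mult] show False
        using assms(1) \<open>x \<noteq> y\<close> \<open>y \<noteq> p\<close> by auto
    next
      case 2
      from no_two_multiple_edges[OF 2 ip(3) _ mult] show False
        using assms(1) \<open>x \<noteq> y\<close> \<open>y \<noteq> i\<close> by auto
    qed
  qed
  have "q \<in> R" if "(i, q) \<in> {(j, k). C $ j $ k \<noteq> 0}\<^sup>*" for q
    using that
  proof (induction rule: rtrancl_induct)
    case base
    then show ?case by (auto simp: R_def)
  next
    case (step y z)
    then show ?case using closed by auto
  qed
  then have inR: "q \<in> R" if "q \<in> component C i" for q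
    using that by (simp add: component_def)
  have "r i dvd r q" if "q \<in> component C i" for q
  proof -
    from inR[OF that] consider "r i = r q" | "r p = r q"
      using simple_edge_r[of i q] simple_edge_r[of p q] by (auto simp: R_def)
    then show ?thesis using dvd by cases auto
  qed
  then have "r i dvd Gcd (r ` component C i)" by (intro Gcd_greatest) auto
  then show ?thesis by (simp add: r_Gcd)
qed

text \<open>The bound makes the degree -C_ij - 1 of a nonzero [C_ij]_z smaller than the degree r_j
  of the diagonal entry of column j. If C_ij <= -2, then r_i = 1 and C_ji = -1, so that symmetry
  gives equality.\<close>

lemma neg_le_r: assumes "i \<noteq> j" shows "- C $ i $ j \<le> int (r j)"
proof -
  consider "C $ i $ j \<ge> -1" | "C $ i $ j \<le> -2" by linarith
  then show ?thesis
  proof cases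
    case 1
    then show ?thesis using r_pos[of j] by linarith
  next
    case 2
    then have "r i = 1" "C $ j $ i = -1" using r_eq_1[of i j] off_diag_cases[of i j] assms by auto
    then show ?thesis using r_sym[of i j] by simp
  qed
qed

end

section \<open>The quantum torus\<close>

lemma tpow_0 [simp]: "tpow 0 = 1"
  by (simp add: tpow_def)

lemma tpow_add: "tpow (a + b) = tpow a * tpow b"
  by (simp add: tpow_def mult_single)

lemma tpow_neq_0 [simp]: "tpow a \<noteq> 0"
  by (simp add: tpow_def)

lemma tscale_1 [simp]: "tscale 1 f = f"
  by (simp add: tscale_def)

lemma tscale_tscale [simp]: "tscale a (tscale b f) = tscale (a * b) f"
  by (simp add: tscale_def fun_eq_iff mult.assoc)

lemma tscale_apply: "tscale c f m = c * f m"
  by (simp add: tscale_def)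

lemma series_sum_apply: "(\<Sum>x\<in>A. f x) m = (\<Sum>x\<in>A. f x m)" for f :: "'a \<Rightarrow> 'n series"
  by (induction A rule: infinite_finite_induct) auto

definition Npair :: "int ^ 'n::finite ^ 'n \<Rightarrow> ('n \<Rightarrow> nat) \<Rightarrow> 'n \<times> int \<Rightarrow> 'n \<times> int \<Rightarrow> int" where
  "Npair C r x y = NY C r (fst x) (snd x) (fst y) (snd y)"

text \<open>The supports over which \<open>Nform\<close> sums change under addition of monomials;
  over common finite supersets both arguments enter linearly.\<close>

lemma Nform_eq:
  assumes "finite F" "finite G" "Poly_Mapping.keys m\<^sub>1 \<subseteq> F" "Poly_Mapping.keys m\<^sub>2 \<subseteq> G"
  shows "Nform C r m\<^sub>1 m\<^sub>2 =
    (\<Sum>x\<in>F. \<Sum>y\<in>G. Poly_Mapping.lookup m\<^sub>1 x * Poly_Mapping.lookup m\<^sub>2 y * Npair C r x y)"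
proof -
  have "Nform C r m\<^sub>1 m\<^sub>2 = (\<Sum>x\<in>Poly_Mapping.keys m\<^sub>1. \<Sum>y\<in>Poly_Mapping.keys m\<^sub>2.
      Poly_Mapping.lookup m\<^sub>1 x * Poly_Mapping.lookup m\<^sub>2 y * Npair C r x y)"
    by (simp add: Nform_def uexp_def Npair_def case_prod_unfold)
  also have "\<dots> = (\<Sum>x\<in>Poly_Mapping.keys m\<^sub>1. \<Sum>y\<in>G.
      Poly_Mapping.lookup m\<^sub>1 x * Poly_Mapping.lookup m\<^sub>2 y * Npair C r x y)"
    using assms by (intro sum.cong refl sum.mono_neutral_left) (auto simp: in_keys_iff)
  also have "\<dots> = (\<Sum>x\<in>F. \<Sum>y\<in>G.
      Poly_Mapping.lookup m\<^sub>1 x * Poly_Mapping.lookup m\<^sub>2 y * Npair C r x y)"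
    using assms by (intro sum.mono_neutral_left) (auto simp: in_keys_iff)
  finally show ?thesis .
qed

lemma Nform_add_left: "Nform C r (m + m') n = Nform C r m n + Nform C r m' n"
proof -
  let ?F = "Poly_Mapping.keys m \<union> Poly_Mapping.keys m'"
  have "Poly_Mapping.keys (m + m') \<subseteq> ?F" by (rule keys_add)
  then show ?thesis
    by (simp add: Nform_eq[of ?F "Poly_Mapping.keys n"] lookup_add algebra_simps sum.distrib)
qed

lemma Nform_add_right: "Nform C r n (m + m') = Nform C r n m + Nform C r n m'"
proof -
  let ?F = "Poly_Mapping.keys m \<union> Poly_Mapping.keys m'"
  have "Poly_Mapping.keys (m + m') \<subseteq> ?F" by (rule keys_add)
  then show ?thesis
    by (simp add: Nform_eq[of "Poly_Mapping.keys n" ?F] lookup_add algebra_simps sum.distrib)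
qed

lemma Nform_0_left [simp]: "Nform C r 0 n = 0"
  using Nform_add_left[of C r 0 0 n] by simp

lemma Nform_0_right [simp]: "Nform C r n 0 = 0"
  using Nform_add_right[of C r n 0 0] by simp

lemma Nform_minus_left: "Nform C r (- m) n = - Nform C r m n"
  using Nform_add_left[of C r m "- m" n] by simp

lemma Nform_minus_right: "Nform C r n (- m) = - Nform C r n m"
  using Nform_add_right[of C r n m "- m"] by simp

lemma Nform_diff_left: "Nform C r (m - m') n = Nform C r m n - Nform C r m' n"
  using Nform_add_left[of C r m "- m'" n] by (simp add: Nform_minus_left)

lemma Nform_diff_right: "Nform C r n (m - m') = Nform C r n m - Nform C r n m'"
  using Nform_add_right[of C r n m "- m'"] by (simp add: Nform_minus_right)

lemma Nform_Yvar: "Nform C r (Yvar i l) (Yvar j k) = NY C r i l j k"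
  by (simp add: Nform_def Yvar_def uexp_def)

section \<open>Supports, bilinearity and associativity of the twisted product\<close>

lemma in_monoms: "m \<in> monoms f \<longleftrightarrow> f m \<noteq> 0"
  by (simp add: monoms_def)

lemma monoms_0 [simp]: "monoms 0 = {}"
  by (simp add: monoms_def)

lemma monoms_nord [simp]: "monoms (nord m) = {m}"
  by (auto simp: monoms_def nord_def)

lemma monoms_add: "monoms (f + g) \<subseteq> monoms f \<union> monoms g"
  by (auto simp: monoms_def)

lemma monoms_tscale: "monoms (tscale c f) \<subseteq> monoms f"
  by (auto simp: monoms_def tscale_def)

lemma monoms_tmult:
  assumes "m \<in> monoms (tmult C r f g)"
  obtains a b where "a \<in> monoms f" "b \<in> monoms g" "m = a + b"
proof (rule ccontr)
  assume "\<not> thesis"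
  then have "{(a, b). a \<in> monoms f \<and> b \<in> monoms g \<and> a + b = m} = {}" using that by auto
  then have "tmult C r f g m = 0" unfolding tmult_def by (simp only: sum.empty)
  then show False using assms by (simp add: in_monoms)
qed

text \<open>A factorization of m is determined by its first factor. Neither series has to be finite,
  as long as only finitely many first factors contribute to this one coefficient.\<close>

lemma tmult_eq:
  assumes "finite F" "\<And>a. f a \<noteq> 0 \<Longrightarrow> g (m - a) \<noteq> 0 \<Longrightarrow> a \<in> F"
  shows "tmult C r f g m = (\<Sum>a\<in>F. tpow (Nform C r a (m - a)) * f a * g (m - a))"
proof -
  let ?S = "{a. f a \<noteq> 0 \<and> g (m - a) \<noteq> 0}"
  have S: "{(a, b). a \<in> monoms f \<and> b \<in> monoms g \<and> a + b = m} = (\<lambda>a. (a, m - a)) ` ?S"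
    by (auto simp: in_monoms image_iff algebra_simps)
  have "tmult C r f g m = (\<Sum>a\<in>?S. tpow (Nform C r a (m - a)) * f a * g (m - a))"
    unfolding tmult_def S by (subst sum.reindex) (auto simp: inj_on_def)
  also have "\<dots> = (\<Sum>a\<in>F. tpow (Nform C r a (m - a)) * f a * g (m - a))"
    using assms by (intro sum.mono_neutral_left) auto
  finally show ?thesis .
qed

lemma Yt_finite: "f \<in> Yt \<longleftrightarrow> finite (monoms f)"
  by (simp add: Yt_def)

lemma Yt_0 [simp]: "0 \<in> Yt" and Yt_nord [simp]: "nord m \<in> Yt"
  by (auto simp: Yt_finite)

lemma Yt_add [intro]: "f \<in> Yt \<Longrightarrow> g \<in> Yt \<Longrightarrow> f + g \<in> Yt"
  unfolding Yt_finite using finite_subset[OF monoms_add] by blast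

lemma Yt_tscale [intro]: "f \<in> Yt \<Longrightarrow> tscale c f \<in> Yt"
  unfolding Yt_finite using finite_subset[OF monoms_tscale] by blast

lemma Yt_tone [simp]: "tone \<in> Yt"
  by (simp add: tone_def)

lemma Yt_tmult [intro]:
  assumes "f \<in> Yt" "g \<in> Yt" shows "tmult C r f g \<in> Yt"
proof -
  have "monoms (tmult C r f g) \<subseteq> (\<lambda>(a, b). a + b) ` (monoms f \<times> monoms g)"
    by (auto elim!: monoms_tmult)
  then show ?thesis using assms unfolding Yt_finite by (meson finite_SigmaI finite_imageI finite_subset)
qed

lemma Yt_sum [intro]: "(\<And>x. x \<in> A \<Longrightarrow> f x \<in> Yt) \<Longrightarrow> (\<Sum>x\<in>A. f x) \<in> Yt"
  by (induction A rule: infinite_finite_induct) (auto simp: Yt_add)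

lemma tmult_Yt_left:
  "f \<in> Yt \<Longrightarrow> monoms f \<subseteq> F \<Longrightarrow> finite F \<Longrightarrow>
    tmult C r f g m = (\<Sum>a\<in>F. tpow (Nform C r a (m - a)) * f a * g (m - a))"
  by (rule tmult_eq) (auto simp: in_monoms)

lemma tmult_add_left:
  assumes "f \<in> Yt" "f' \<in> Yt"
  shows "tmult C r (f + f') g = tmult C r f g + tmult C r f' g"
proof
  fix m
  let ?F = "monoms f \<union> monoms f'"
  have F: "finite ?F" using assms by (simp add: Yt_finite)
  show "tmult C r (f + f') g m = (tmult C r f g + tmult C r f' g) m"
    using assms monoms_add[of f f'] F
    by (simp add: tmult_Yt_left[of _ ?F] Yt_add algebra_simps sum.distrib)
qed

lemma tmult_add_right:
  assumes "f \<in> Yt" shows "tmult C r f (g + g') = tmult C r f g + tmult C r f g'"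
  using assms by (auto simp: tmult_Yt_left[of _ "monoms f"] fun_eq_iff algebra_simps sum.distrib Yt_finite)

lemma tmult_tscale_left:
  assumes "f \<in> Yt" shows "tmult C r (tscale c f) g = tscale c (tmult C r f g)"
proof
  fix m
  have fin: "finite (monoms f)" using assms by (simp add: Yt_finite)
  show "tmult C r (tscale c f) g m = tscale c (tmult C r f g) m"
    unfolding tscale_apply tmult_Yt_left[OF assms order_refl fin]
      tmult_Yt_left[OF Yt_tscale[OF assms] monoms_tscale fin]
    by (simp add: tscale_apply sum_distrib_left mult_ac)
qed

lemma tmult_tscale_right:
  assumes "f \<in> Yt" shows "tmult C r f (tscale c g) = tscale c (tmult C r f g)"
  using assms
  by (auto simp: tmult_Yt_left[of _ "monoms f"] fun_eq_iff tscale_apply sum_distrib_left Yt_finite mult_ac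
      intro!: sum.cong)

lemma tmult_0_left [simp]: "tmult C r 0 g = 0"
  by (simp add: tmult_def fun_eq_iff)

lemma tmult_0_right [simp]: "tmult C r f 0 = 0"
  by (simp add: tmult_def fun_eq_iff)

lemma tmult_sum_left:
  assumes "\<And>x. x \<in> A \<Longrightarrow> f x \<in> Yt"
  shows "tmult C r (\<Sum>x\<in>A. f x) g = (\<Sum>x\<in>A. tmult C r (f x) g)"
  using assms by (induction A rule: infinite_finite_induct) (auto simp: tmult_add_left Yt_sum)

lemma tmult_sum_right:
  assumes "f \<in> Yt"
  shows "tmult C r f (\<Sum>x\<in>A. g x) = (\<Sum>x\<in>A. tmult C r f (g x))"
  using assms by (induction A rule: infinite_finite_induct) (auto simp: tmult_add_right)

lemma tmult_nord_left: "tmult C r (nord a) g m = tpow (Nform C r a (m - a)) * g (m - a)"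
  by (subst tmult_Yt_left[of _ "{a}"]) (simp_all, simp add: nord_def)

lemma tmult_nord: "tmult C r (nord a) (nord b) = tscale (tpow (Nform C r a b)) (nord (a + b))"
proof
  fix m
  show "tmult C r (nord a) (nord b) m = tscale (tpow (Nform C r a b)) (nord (a + b)) m"
    unfolding tmult_nord_left tscale_apply by (auto simp: nord_def algebra_simps)
qed

lemma series_expand:
  assumes "finite F" "monoms f \<subseteq> F" shows "f = (\<Sum>m\<in>F. tscale (f m) (nord m))"
proof
  fix n
  have "(\<Sum>m\<in>F. tscale (f m) (nord m)) n = (\<Sum>m\<in>F. if m = n then f n else 0)"
    by (auto simp: series_sum_apply tscale_apply nord_def intro: sum.cong)
  also have "\<dots> = f n" using assms by (auto simp: in_monoms)
  finally show "f n = (\<Sum>m\<in>F. tscale (f m) (nord m)) n" ..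
qed

lemma Yt_induct [consumes 1, case_names zero add]:
  assumes "f \<in> Yt" "P 0" "\<And>f c m. f \<in> Yt \<Longrightarrow> P f \<Longrightarrow> P (tscale c (nord m) + f)"
  shows "P f"
proof -
  have "P (\<Sum>m\<in>F. tscale (f m) (nord m))" if "finite F" for F
    using that
  proof induction
    case empty
    show ?case unfolding sum.empty by (rule assms(2))
  next
    case (insert x F)
    show ?case unfolding sum.insert[OF insert.hyps]
      by (rule assms(3)[OF _ insert.IH]) (simp add: Yt_sum Yt_tscale)
  qed
  from this[of "monoms f"] show ?thesis
    using assms(1) series_expand[of "monoms f" f, symmetric] by (simp only: Yt_finite order_refl)
qed

text \<open>By trilinearity it suffices to treat basis elements, one argument at a time. There both
  sides carry the exponent N(a,b) + N(a,c) + N(b,c), because N is additive in each argument.\<close>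

lemma tmult_assoc:
  assumes "f \<in> Yt" "g \<in> Yt" "h \<in> Yt"
  shows "tmult C r (tmult C r f g) h = tmult C r f (tmult C r g h)"
proof -
  have 1: "tmult C r (tmult C r (nord a) (nord b)) (nord c) = tmult C r (nord a) (tmult C r (nord b) (nord c))"
    for a b c
    by (simp add: tmult_nord tmult_tscale_left tmult_tscale_right Nform_add_left Nform_add_right
        tpow_add[symmetric] add_ac)
  note bilinear = tmult_add_right tmult_add_left tmult_tscale_right tmult_tscale_left Yt_tmult
    Yt_tscale Yt_nord tmult_0_left tmult_0_right
  have 2: "tmult C r (tmult C r (nord a) (nord b)) h = tmult C r (nord a) (tmult C r (nord b) h)"
    for a b
    using assms(3) by (induction rule: Yt_induct) (simp_all only: 1 bilinear)
  have 3: "tmult C r (tmult C r (nord a) g) h = tmult C r (nord a) (tmult C r g h)" for a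
    using assms(2) by (induction rule: Yt_induct) (simp_all only: 2 bilinear assms)
  show ?thesis
    using assms(1) by (induction rule: Yt_induct) (simp_all only: 3 bilinear assms)
qed

lemma tmult_tone_left [simp]: "tmult C r tone f = f"
  by (simp add: fun_eq_iff tone_def tmult_nord_left)

lemma tmult_tone_right [simp]: "tmult C r f tone = f"
proof
  fix m
  show "tmult C r f tone m = f m"
    by (subst tmult_eq[of "{m}"]) (auto simp: tone_def nord_def split: if_splits)
qed

lemma tinverse_eqI:
  assumes "f \<in> Yt" "g \<in> Yt" "tmult C r f g = tone" "tmult C r g f = tone"
  shows "tinverse C r f = g"
  unfolding tinverse_def
proof (rule the_equality)
  fix h assume h: "h \<in> Yt \<and> tmult C r f h = tone \<and> tmult C r h f = tone"
  have "h = tmult C r (tmult C r g f) h" by (simp add: assms)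
  also have "\<dots> = tmult C r g (tmult C r f h)" using assms(1,2) h by (intro tmult_assoc) auto
  also have "\<dots> = g" using h by simp
  finally show "h = g" .
qed (use assms in auto)

lemma tinverse_nord: "tinverse C r (nord m) = tscale (tpow (Nform C r m m)) (nord (- m))"
  by (rule tinverse_eqI)
    (auto simp: tmult_nord tmult_tscale_left tmult_tscale_right tpow_add[symmetric] Nform_minus_left
      Nform_minus_right tone_def)

text \<open>Equality up to a unit t^k. Spans over the Laurent polynomials are insensitive to such
  units, so the exponents produced by reordering factors need not be recorded.\<close>

definition teq :: "'n series \<Rightarrow> 'n series \<Rightarrow> bool" where
  "teq f g \<longleftrightarrow> (\<exists>k. f = tscale (tpow k) g)"

lemma teq_refl [simp, intro]: "teq f f"
  unfolding teq_def by (rule exI[of _ 0]) simp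

lemma teq_tpow [simp, intro]: "teq (tscale (tpow k) f) f"
  unfolding teq_def by blast

lemma teq_sym: "teq f g \<Longrightarrow> teq g f"
  unfolding teq_def
proof safe
  fix k assume "f = tscale (tpow k) g"
  then show "\<exists>k'. g = tscale (tpow k') (tscale (tpow k) g)"
    by (intro exI[of _ "- k"]) (simp add: tpow_add[symmetric])
qed

lemma teq_trans [trans]: "teq f g \<Longrightarrow> teq g h \<Longrightarrow> teq f h"
  unfolding teq_def by (auto simp: tpow_add[symmetric])

lemma eq_teq_trans [trans]: "f = g \<Longrightarrow> teq g h \<Longrightarrow> teq f h"
  and teq_eq_trans [trans]: "teq f g \<Longrightarrow> g = h \<Longrightarrow> teq f h"
  by simp_all

lemma teq_Yt: "teq f g \<Longrightarrow> g \<in> Yt \<Longrightarrow> f \<in> Yt"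
  unfolding teq_def by auto

lemma teq_tmult:
  assumes "teq f f'" "teq g g'" "f' \<in> Yt" shows "teq (tmult C r f g) (tmult C r f' g')"
  using assms unfolding teq_def
  by (auto simp: tmult_tscale_left tmult_tscale_right Yt_tscale tpow_add[symmetric])

lemma tprod_list_simps [simp]:
  "tprod_list C r [] = tone" "tprod_list C r (f # fs) = tmult C r f (tprod_list C r fs)"
  by (simp_all add: tprod_list_def)

lemma Yt_tprod_list: "set fs \<subseteq> Yt \<Longrightarrow> tprod_list C r fs \<in> Yt"
  by (induction fs) auto

lemma tprod_list_append:
  "set fs \<subseteq> Yt \<Longrightarrow> set gs \<subseteq> Yt \<Longrightarrow>
    tprod_list C r (fs @ gs) = tmult C r (tprod_list C r fs) (tprod_list C r gs)"
  by (induction fs) (auto simp: tmult_assoc Yt_tprod_list)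

section \<open>The quantum Cartan matrix\<close>

text \<open>The coefficients of a right inverse of 1 + X, found by comparing coefficients in (1 + X)
  Y = 1. If X has no constant term, only lower coefficients of Y enter.\<close>

fun neumann :: "('n::finite \<Rightarrow> 'n \<Rightarrow> int fps) \<Rightarrow> nat \<Rightarrow> 'n \<Rightarrow> 'n \<Rightarrow> int" where
  "neumann X k a b = (if k = 0 then of_bool (a = b)
     else - (\<Sum>j\<in>{1..k}. \<Sum>c\<in>UNIV. fps_nth (X a c) j * neumann X (k - j) c b))"

declare neumann.simps [simp del]

lemma one_plus_right_inverse:
  fixes X :: "int fps ^ 'n::finite ^ 'n"
  assumes "\<And>i j. fps_nth (X $ i $ j) 0 = 0"
  shows "\<exists>Y. (mat 1 + X) ** Y = mat 1"
proof
  define x where "x = (\<lambda>i j. X $ i $ j)"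
  define y where "y = (\<lambda>i j. Abs_fps (\<lambda>k. neumann x k i j))"
  have y: "y a b + (\<Sum>c\<in>UNIV. x a c * y c b) = of_bool (a = b)" for a b
  proof (rule fps_ext)
    fix k
    have "fps_nth (y a b + (\<Sum>c\<in>UNIV. x a c * y c b)) k
        = neumann x k a b + (\<Sum>c\<in>UNIV. \<Sum>j\<in>{0..k}. fps_nth (x a c) j * neumann x (k - j) c b)"
      by (simp add: fps_sum_nth fps_mult_nth y_def)
    also have "(\<Sum>c\<in>UNIV. \<Sum>j\<in>{0..k}. fps_nth (x a c) j * neumann x (k - j) c b)
        = (\<Sum>j\<in>{0..k}. \<Sum>c\<in>UNIV. fps_nth (x a c) j * neumann x (k - j) c b)"
      by (rule sum.swap)
    also have "\<dots> = (\<Sum>j\<in>{1..k}. \<Sum>c\<in>UNIV. fps_nth (x a c) j * neumann x (k - j) c b)"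
      by (rule sum.mono_neutral_right) (auto simp: x_def assms not_less_eq_eq)
    finally show "fps_nth (y a b + (\<Sum>c\<in>UNIV. x a c * y c b)) k = fps_nth (of_bool (a = b)) k"
      unfolding neumann.simps[of x k a b] by (auto simp: of_bool_def)
  qed
  show "(mat 1 + X) ** (\<chi> i j. y i j) = mat 1"
    using y by (simp add: vec_eq_iff matrix_matrix_mult_def mat_def x_def distrib_right sum.distrib
        of_bool_def if_distrib[of "\<lambda>u. u * _"] cong: if_cong)
qed

text \<open>The recursion yields right inverses only. Applied to the transpose of X it gives a left
  inverse, and the two coincide.\<close>

lemma one_plus_invertible:
  fixes X :: "int fps ^ 'n::finite ^ 'n"
  assumes "\<And>i j. fps_nth (X $ i $ j) 0 = 0"
  shows "invertible (mat 1 + X)"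
proof -
  obtain Y where Y: "(mat 1 + X) ** Y = mat 1" using one_plus_right_inverse[of X] assms by auto
  obtain Z where "(mat 1 + transpose X) ** Z = mat 1"
    using one_plus_right_inverse[of "transpose X"] assms by (auto simp: transpose_def)
  then have "transpose ((mat 1 + transpose X) ** Z) = mat 1" by (simp add: transpose_mat)
  moreover have "transpose (mat 1 + transpose X) = mat 1 + X"
    by (auto simp: vec_eq_iff transpose_def mat_def)
  ultimately have Z: "transpose Z ** (mat 1 + X) = mat 1" by (simp add: matrix_transpose_mul)
  have "transpose Z = transpose Z ** ((mat 1 + X) ** Y)" by (simp add: Y)
  also have "\<dots> = Y" by (simp only: matrix_mul_assoc Z matrix_mul_lid)
  finally show ?thesis using Y Z unfolding invertible_def by blast
qed

text \<open>Membership in z^-1 Z[[z^-1]], since the formal variable stands for z^-1.\<close>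

definition small :: "int fls \<Rightarrow> bool" where
  "small f \<longleftrightarrow> (\<exists>x. fps_nth x 0 = 0 \<and> f = fps_to_fls x)"

lemma small_0: "small 0" unfolding small_def by (intro exI[of _ 0]) auto

lemma small_add: "small f \<Longrightarrow> small g \<Longrightarrow> small (f + g)"
  unfolding small_def by (metis add.right_neutral fps_to_fls_plus fps_add_nth)

lemma small_minus: "small f \<Longrightarrow> small (- f)"
  unfolding small_def by (metis fps_to_fls_uminus fps_neg_nth neg_equal_0_iff_equal)

lemma small_zpow: "k < 0 \<Longrightarrow> small (zpow k)"
  unfolding small_def zpow_def
  by (intro exI[of _ "fps_X ^ nat (- k)"])
    (simp_all add: fps_to_fls_power fls_X_power_conv_shift_1)

lemma zcoeff_zpow: "zcoeff (zpow a) s = of_bool (s = a)"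
  by (auto simp: zcoeff_def zpow_def)

lemma zcoeff_zpow_mult: "zcoeff (zpow a * f) s = zcoeff f (s - a)"
  by (simp add: zcoeff_def zpow_def fls_shifted_times_simps)

lemma zcoeff_mult_zpow: "zcoeff (f * zpow a) s = zcoeff f (s - a)"
  using zcoeff_zpow_mult[of a f s] by (simp add: mult.commute)

lemma zcoeff_add: "zcoeff (f + g) s = zcoeff f s + zcoeff g s"
  and zcoeff_diff: "zcoeff (f - g) s = zcoeff f s - zcoeff g s"
  and zcoeff_uminus: "zcoeff (- f) s = - zcoeff f s"
  and zcoeff_0: "zcoeff 0 s = 0"
  by (simp_all add: zcoeff_def)

lemma zcoeff_sum: "zcoeff (\<Sum>x\<in>A. f x) s = (\<Sum>x\<in>A. zcoeff (f x) s)"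
  by (induction A rule: infinite_finite_induct) (auto simp: zcoeff_add zcoeff_0)

lemma qint_eqI: "q * (zpow 1 - zpow (-1)) = zpow l - zpow (- l) \<Longrightarrow> qint l = q"
  using qint_mult[of l] mult_right_cancel[OF zpow_neq] by metis

lemma qint_0: "qint 0 = 0"
  by (rule qint_eqI) simp

lemma qint_m1: "qint (-1) = - 1"
  by (rule qint_eqI) simp

lemma qint_m2: "qint (-2) = - (zpow 1 + zpow (-1))"
  by (rule qint_eqI) (simp add: algebra_simps zpow_add)

lemma qint_m3: "qint (-3) = - (zpow 2 + zpow 0 + zpow (-2))"
  by (rule qint_eqI) (simp add: algebra_simps zpow_add)

section \<open>Invertibility of C(z), and the pairing of the A with the Y\<close>

context cartan_datum
begin

lemma entry_cases:
  assumes "i \<noteq> j"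
  obtains "C $ i $ j = 0" | "C $ i $ j = -1" | "C $ i $ j = -2" | "C $ i $ j = -3"
  using off_diag_cases[OF assms] by auto

lemma qcartan_invertible: "invertible (qcartan C r)"
proof -
  \<comment> \<open>Dividing column j by z^(r_j) gives C(z) = (1 + x) diag(z^(r_j)). The entries of
    x lie in z^-1 Z[[z^-1]], off the diagonal by \<open>neg_le_r\<close>.\<close>
  define x where "x = (\<lambda>i j. if i = j then zpow (- 2 * int (r i)) else qint (C $ i $ j) * zpow (- int (r j)))"
  have "small (x i j)" for i j
  proof (cases "i = j")
    case True
    then show ?thesis using r_pos[of i] by (auto simp: x_def intro!: small_zpow)
  next
    case False
    show ?thesis
      using False neg_le_r[OF False] r_pos[of j]
      by (cases rule: entry_cases[OF False])
        (auto simp: x_def qint_0 qint_m1 qint_m2 qint_m3 distrib_right zpow_add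
          simp del: minus_add_distrib
          intro!: small_0 small_add small_minus small_zpow)
  qed
  then obtain X where X: "\<And>i j. fps_nth (X i j) 0 = 0 \<and> x i j = fps_to_fls (X i j)"
    unfolding small_def by metis
  have "invertible (mat 1 + (\<chi> i j. X i j))"
    by (rule one_plus_invertible) (simp add: X)
  then obtain Y where
    Y: "(mat 1 + (\<chi> i j. X i j)) ** Y = mat 1" "Y ** (mat 1 + (\<chi> i j. X i j)) = mat 1"
    unfolding invertible_def by blast
  define E :: "int fls ^ 'n ^ 'n" where "E = mat 1 + (\<chi> i j. x i j)"
  define L :: "int fps ^ 'n ^ 'n \<Rightarrow> int fls ^ 'n ^ 'n" where "L = (\<lambda>A. \<chi> i j. fps_to_fls (A $ i $ j))"
  have fps_sum: "fps_to_fls (\<Sum>k\<in>UNIV. f k) = (\<Sum>k\<in>UNIV. fps_to_fls (f k))" for f :: "'n \<Rightarrow> int fps"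
    by (induction rule: finite_induct[OF finite_class.finite_UNIV]) auto
  have L_mult: "L A ** L B = L (A ** B)" for A B
    by (simp add: L_def vec_eq_iff matrix_matrix_mult_def fps_sum fls_times_fps_to_fls)
  have L_1: "L (mat 1) = mat 1" by (simp add: L_def vec_eq_iff mat_def)
  have E: "E = L (mat 1 + (\<chi> i j. X i j))"
    by (simp add: vec_eq_iff L_def E_def X mat_def)
  have "E ** L Y = mat 1" "L Y ** E = mat 1" unfolding E L_mult Y L_1 by auto
  then have invE: "invertible E" unfolding invertible_def by blast
  define D where "D = (\<lambda>s. \<chi> i j. if i = j then zpow (s * int (r i)) else 0 :: int fls ^ 'n ^ 'n)"
  have mult_D: "(A ** D s) $ i $ j = A $ i $ j * zpow (s * int (r j))" for A :: "int fls ^ 'n ^ 'n" and s i j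
    by (simp add: D_def matrix_matrix_mult_def if_distrib[of "\<lambda>u. _ * u"] cong: if_cong)
  have "D s ** D (- s) = mat 1" for s
    by (simp add: vec_eq_iff mult_D) (auto simp: D_def mat_def zpow_add zpow_0)
  from this[of 1] this[of "-1"] have "invertible (D 1)" unfolding invertible_def by auto
  with invE have "invertible (E ** D 1)" by (rule invertible_mult)
  also have "E ** D 1 = qcartan C r"
    by (auto simp: vec_eq_iff mult_D E_def qcartan_def mat_def x_def distrib_right mult.assoc
        zpow_add zpow_0)
  finally show ?thesis .
qed

lemma qcartan_inv: "qcartan C r ** qcartan_inv C r = mat 1" "qcartan_inv C r ** qcartan C r = mat 1"
proof -
  have "qcartan C r ** qcartan_inv C r = mat 1 \<and> qcartan_inv C r ** qcartan C r = mat 1"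
    using qcartan_invertible unfolding qcartan_inv_def matrix_inv_def invertible_def by (rule someI_ex)
  then show "qcartan C r ** qcartan_inv C r = mat 1" "qcartan_inv C r ** qcartan C r = mat 1" by auto
qed

text \<open>Multiplication by this element produces the difference of two coefficients that defines
  N on the variables. Up to the common factor z^-1 - z it is [r_i]_z, the symmetrizer of
  C(z).\<close>

definition zdiff :: "'n \<Rightarrow> int fls" where
  "zdiff i = zpow (- int (r i)) - zpow (int (r i))"

text \<open>The critical case is C_ij <= -2. Then r_i = 1, so the factor z^-1 - z cancels the
  denominator of [C_ij]_z and leaves z^(r_j) - z^(-r_j), which is also the other side because C_ji =
  -1.\<close>

lemma qcartan_symmetrizable:
  "zdiff i * qcartan C r $ i $ j = zdiff j * qcartan C r $ j $ i"
proof (cases "i = j")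
  case False
  have *: "zdiff i * qint (C $ i $ j) = zdiff j * qint (C $ j $ i)"
    if "i \<noteq> j" "C $ j $ i = -1" "C $ i $ j < 0" for i j
  proof -
    have rij: "int (r j) = - int (r i) * C $ i $ j" using r_sym[of i j] that by simp
    show ?thesis
    proof (cases "C $ i $ j = -1")
      case True
      then show ?thesis using rij that by (simp add: zdiff_def)
    next
      case False
      then have ri: "r i = 1" using r_eq_1[of i j] that by auto
      have "zdiff i * qint (C $ i $ j) = - (qint (C $ i $ j) * (zpow 1 - zpow (-1)))"
        by (simp add: zdiff_def ri algebra_simps)
      also have "\<dots> = zpow (- C $ i $ j) - zpow (C $ i $ j)" by (simp add: qint_mult)
      also have "\<dots> = zdiff j * qint (C $ j $ i)" using rij by (simp add: zdiff_def ri that qint_m1)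
      finally show ?thesis .
    qed
  qed
  show ?thesis
    using off_diag_cases[OF False] *[of i j] *[of j i] False
    by (auto simp: qcartan_def qint_0)
qed simp

text \<open>The part of A_{i,l} in the variables Y_{p,s}. Its exponents are the coefficients of the
  entry (p,i) of C(z), recentred at l.\<close>

definition Acomp :: "'n \<Rightarrow> 'n \<Rightarrow> int \<Rightarrow> 'n monom" where
  "Acomp p i l =
    (if p = i then Yvar p (l - int (r i)) + Yvar p (l + int (r i))
     else if C $ p $ i = -1 then - Yvar p l
     else if C $ p $ i = -2 then - (Yvar p (l + 1) + Yvar p (l - 1))
     else if C $ p $ i = -3 then - (Yvar p (l + 2) + Yvar p l + Yvar p (l - 2))
     else 0)"

lemma Avar_Acomp: "Avar C r i l = (\<Sum>p\<in>UNIV. Acomp p i l)"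
proof -
  have "(\<Sum>p\<in>UNIV. Acomp p i l) = (\<Sum>p\<in>UNIV.
      (if p = i then Yvar p (l - int (r i)) + Yvar p (l + int (r i)) else 0)
     - (if C $ p $ i = -1 then Yvar p l else 0)
     - (if C $ p $ i = -2 then Yvar p (l + 1) + Yvar p (l - 1) else 0)
     - (if C $ p $ i = -3 then Yvar p (l + 2) + Yvar p l + Yvar p (l - 2) else 0))"
    by (rule sum.cong) (auto simp: Acomp_def diag)
  also have "\<dots> = Avar C r i l"
    unfolding Avar_def sum_subtractf by (simp add: sum.If_cases)
  finally show ?thesis ..
qed

text \<open>If an additive map reads off coefficients of F on the variables Y_{p,s}, the shifts in
  \<open>Acomp\<close> multiply F by C(z)_{p,i}. They act here in the opposite direction to powers
  of z, which is harmless because the entries of C(z) are invariant under z -> z^-1.\<close>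

lemma additive_Acomp:
  assumes add: "\<And>m m'. \<phi> (m + m') = \<phi> m + (\<phi> m' :: int)" 
    and Y: "\<And>s. \<phi> (Yvar p s) = zcoeff F (s - k)"
  shows "\<phi> (Acomp p i l) = zcoeff (qcartan C r $ p $ i * F) (l - k)"
proof -
  have 0: "\<phi> 0 = 0" using add[of 0 0] by simp
  have neg: "\<phi> (- m) = - \<phi> m" for m using add[of m "- m"] 0 by simp
  show ?thesis
  proof (cases "p = i")
    case True
    then show ?thesis
      using Y[unfolded True] by (simp add: Acomp_def qcartan_def add distrib_right zcoeff_add
          zcoeff_zpow_mult) (simp add: algebra_simps)
  next
    case False
    then show ?thesis
      by (cases rule: entry_cases[OF False])
        (auto simp: Acomp_def qcartan_def add neg 0 Y qint_0 qint_m1 qint_m2 qint_m3 distrib_right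
          zcoeff_add zcoeff_0 zcoeff_zpow_mult zcoeff_mult_zpow zcoeff_uminus algebra_simps minus_add_distrib[symmetric]
          simp del: minus_add_distrib)
  qed
qed

text \<open>The counterpart for the second argument of N, where the index of the coefficient
  decreases as s grows.\<close>

lemma additive_Acomp':
  assumes add: "\<And>m m'. \<phi> (m + m') = \<phi> m + (\<phi> m' :: int)" 
    and Y: "\<And>s. \<phi> (Yvar p s) = zcoeff F (k - s)"
  shows "\<phi> (Acomp p i l) = zcoeff (qcartan C r $ p $ i * F) (k - l)"
proof -
  have 0: "\<phi> 0 = 0" using add[of 0 0] by simp
  have neg: "\<phi> (- m) = - \<phi> m" for m using add[of m "- m"] 0 by simp
  show ?thesis
  proof (cases "p = i")
    case True
    then show ?thesis
      using Y[unfolded True] by (simp add: Acomp_def qcartan_def add distrib_right zcoeff_add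
          zcoeff_zpow_mult) (simp add: algebra_simps)
  next
    case False
    then show ?thesis
      by (cases rule: entry_cases[OF False])
        (auto simp: Acomp_def qcartan_def add neg 0 Y qint_0 qint_m1 qint_m2 qint_m3 distrib_right
          zcoeff_add zcoeff_0 zcoeff_zpow_mult zcoeff_mult_zpow zcoeff_uminus algebra_simps minus_add_distrib[symmetric]
          simp del: minus_add_distrib)
  qed
qed

lemma zcoeff_zdiff_mult:
  "zcoeff (zdiff j * f) s = zcoeff f (int (r j) + s) - zcoeff f (- int (r j) + s)"
  by (simp add: zdiff_def left_diff_distrib zcoeff_diff zcoeff_zpow_mult add.commute)

lemma additive_sum:
  assumes "\<And>m m'. \<phi> (m + m') = \<phi> m + (\<phi> m' :: int)"
  shows "\<phi> (\<Sum>x\<in>A. f x) = (\<Sum>x\<in>A. \<phi> (f x :: 'a::ab_group_add))"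
proof -
  have "\<phi> 0 = 0" using assms[of 0 0] by simp
  then show ?thesis by (induction A rule: infinite_finite_induct) (auto simp: assms)
qed

text \<open>The shifts in A_{i,l} realize column i of C(z), so summing over p produces the entry
  (j,i) of the product of the inverse matrix with C(z). Only the factor z^(-r_j) - z^(r_j)
  survives.\<close>

lemma Nform_Avar_Yvar:
  "Nform C r (Avar C r i l) (Yvar j k) =
    (if i = j then of_bool (l - k = - int (r i)) - of_bool (l - k = int (r i)) else 0)"
proof -
  let ?\<phi> = "\<lambda>m. Nform C r m (Yvar j k)"
  have "?\<phi> (Avar C r i l) = (\<Sum>p\<in>UNIV. ?\<phi> (Acomp p i l))"
    unfolding Avar_Acomp by (rule additive_sum) (rule Nform_add_left)
  also have "\<dots> = (\<Sum>p\<in>UNIV. zcoeff (qcartan C r $ p $ i * (zdiff j * qcartan_inv C r $ j $ p)) (l - k))"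
    by (intro sum.cong refl additive_Acomp)
      (auto simp: Nform_add_left Nform_Yvar NY_def zcoeff_zdiff_mult algebra_simps)
  also have "\<dots> = zcoeff (zdiff j * (\<Sum>p\<in>UNIV. qcartan_inv C r $ j $ p * qcartan C r $ p $ i)) (l - k)"
    by (simp add: zcoeff_sum sum_distrib_left mult_ac)
  also have "(\<Sum>p\<in>UNIV. qcartan_inv C r $ j $ p * qcartan C r $ p $ i) = mat 1 $ j $ i"
    unfolding qcartan_inv(2)[symmetric] by (simp add: matrix_matrix_mult_def)
  finally show ?thesis by (auto simp: mat_def zcoeff_0 zdiff_def zcoeff_diff zcoeff_zpow)
qed

text \<open>Here the sum over p contracts the row index of both matrices, with a factor depending on
  p. Symmetrizability of C(z) pulls this factor out and restores a matrix product; the sign comes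
  from exchanging l - k with k - l.\<close>

lemma Nform_Yvar_Avar: "Nform C r (Yvar j k) (Avar C r i l) = - Nform C r (Avar C r i l) (Yvar j k)"
proof -
  let ?\<phi> = "\<lambda>m. Nform C r (Yvar j k) m"
  have "?\<phi> (Avar C r i l) = (\<Sum>p\<in>UNIV. ?\<phi> (Acomp p i l))"
    unfolding Avar_Acomp by (rule additive_sum) (rule Nform_add_right)
  also have "\<dots> = (\<Sum>p\<in>UNIV. zcoeff (qcartan C r $ p $ i * (zdiff p * qcartan_inv C r $ p $ j)) (k - l))"
    by (intro sum.cong refl additive_Acomp')
      (auto simp: Nform_add_right Nform_Yvar NY_def zcoeff_zdiff_mult algebra_simps)
  also have "\<dots> = zcoeff (zdiff i * (\<Sum>p\<in>UNIV. qcartan C r $ i $ p * qcartan_inv C r $ p $ j)) (k - l)"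
    unfolding zcoeff_sum sum_distrib_left mult.assoc[symmetric] qcartan_symmetrizable[of i]
    by (simp add: mult_ac)
  also have "(\<Sum>p\<in>UNIV. qcartan C r $ i $ p * qcartan_inv C r $ p $ j) = mat 1 $ i $ j"
    unfolding qcartan_inv(1)[symmetric] by (simp add: matrix_matrix_mult_def)
  finally show ?thesis
    unfolding Nform_Avar_Yvar by (auto simp: mat_def zcoeff_0 zdiff_def zcoeff_diff zcoeff_zpow)
qed

end

section \<open>Straightening\<close>

lemma additive_minus:
  assumes "\<And>m m'. \<phi> (m + m') = \<phi> m + (\<phi> m' :: 'b::ab_group_add)"
  shows "\<phi> (- m) = - \<phi> (m :: 'a::ab_group_add)"
  using assms[of 0 0] assms[of m "- m"] by (simp add: eq_neg_iff_add_eq_0 add.commute)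

lemma additive_single:
  fixes \<phi> :: "('a \<Rightarrow>\<^sub>0 int) \<Rightarrow> 'b::ring_1"
  assumes add: "\<And>m m'. \<phi> (m + m') = \<phi> m + \<phi> m'"
  shows "\<phi> (Poly_Mapping.single x k) = of_int k * \<phi> (Poly_Mapping.single x 1)"
proof -
  have 0: "\<phi> 0 = 0" using add[of 0 0] by simp
  have nat: "\<phi> (Poly_Mapping.single x (int n)) = of_nat n * \<phi> (Poly_Mapping.single x 1)" for n
    by (induction n) (simp_all add: 0 single_add add distrib_right)
  show ?thesis
    using nat[of "nat k"] nat[of "nat (- k)"] additive_minus[of \<phi> "Poly_Mapping.single x (- k)", OF add]
    by (cases "k \<ge> 0") (auto simp: single_uminus)
qed

lemma additive_monom:
  fixes \<phi> :: "'n monom \<Rightarrow> 'b::ring_1"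
  assumes add: "\<And>m m'. \<phi> (m + m') = \<phi> m + \<phi> m'"
  shows "\<phi> m = (\<Sum>x\<in>Poly_Mapping.keys m. of_int (Poly_Mapping.lookup m x) * \<phi> (Yvar (fst x) (snd x)))"
proof -
  have 0: "\<phi> 0 = 0" using add[of 0 0] by simp
  have sum: "\<phi> (\<Sum>x\<in>A. f x) = (\<Sum>x\<in>A. \<phi> (f x))" for A and f :: "_ \<Rightarrow> 'n monom"
    by (induction A rule: infinite_finite_induct) (auto simp: 0 add)
  have "m = (\<Sum>x\<in>Poly_Mapping.keys m. Poly_Mapping.single x (Poly_Mapping.lookup m x))"
    by (rule poly_mapping_eqI) (simp add: lookup_sum lookup_single when_def in_keys_iff)
  then have "\<phi> m = \<phi> (\<Sum>x\<in>Poly_Mapping.keys m. Poly_Mapping.single x (Poly_Mapping.lookup m x))"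
    by (rule arg_cong)
  also have "\<dots> = (\<Sum>x\<in>Poly_Mapping.keys m. of_int (Poly_Mapping.lookup m x) * \<phi> (Yvar (fst x) (snd x)))"
    unfolding sum by (intro sum.cong refl) (simp add: additive_single[OF add, of _ "Poly_Mapping.lookup m _"] Yvar_def)
  finally show ?thesis .
qed

lemma uexp_add: "uexp (m + m') i l = uexp m i l + uexp m' i l"
  and uexp_uminus: "uexp (- m) i l = - uexp m i l"
  and uexp_diff: "uexp (m - m') i l = uexp m i l - uexp m' i l"
  and uexp_0 [simp]: "uexp 0 i l = 0"
  and uexp_Yvar: "uexp (Yvar j k) i l = of_bool (i = j \<and> l = k)"
  and uexp_sum: "uexp (\<Sum>x\<in>A. f x) i l = (\<Sum>x\<in>A. uexp (f x) i l)"
  and uexp_single: "uexp (Poly_Mapping.single (j, k) e) i l = (if i = j \<and> l = k then e else 0)"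
  by (auto simp: uexp_def lookup_add lookup_minus Yvar_def lookup_single lookup_sum when_def)

lemma monom_eqI: "(\<And>i l. uexp m i l = uexp m' i l) \<Longrightarrow> m = m'"
  by (rule poly_mapping_eqI) (auto simp: uexp_def)

definition ifree :: "'n \<Rightarrow> 'n monom \<Rightarrow> bool" where
  "ifree i m \<longleftrightarrow> (\<forall>l. uexp m i l = 0)"

lemma ifree_0 [simp]: "ifree i 0"
  and ifree_add: "ifree i m \<Longrightarrow> ifree i m' \<Longrightarrow> ifree i (m + m')"
  by (auto simp: ifree_def uexp_add)

lemma ifree_sum_list: "(\<And>x. x \<in> set xs \<Longrightarrow> ifree i (f x)) \<Longrightarrow> ifree i (sum_list (map f xs))"
  by (induction xs) (auto simp: ifree_add)

lemma ifree_additive: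
  fixes \<phi> :: "'n monom \<Rightarrow> int"
  assumes "\<And>m m'. \<phi> (m + m') = \<phi> m + \<phi> m'" "\<And>j l. j \<noteq> i \<Longrightarrow> \<phi> (Yvar j l) = 0" "ifree i m"
  shows "\<phi> m = 0"
proof -
  have "\<phi> m = (\<Sum>x\<in>Poly_Mapping.keys m. of_int (Poly_Mapping.lookup m x) * \<phi> (Yvar (fst x) (snd x)))"
    by (rule additive_monom) (rule assms(1))
  also have "\<dots> = 0"
  proof (rule sum.neutral, rule ballI)
    fix x assume "x \<in> Poly_Mapping.keys m"
    then have "fst x \<noteq> i"
      using assms(3) by (cases x) (auto simp: ifree_def uexp_def in_keys_iff)
    then show "of_int (Poly_Mapping.lookup m x) * \<phi> (Yvar (fst x) (snd x)) = 0"
      by (simp add: assms(2))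
  qed
  finally show ?thesis .
qed

text \<open>The monoid generated by the inverses of the A_{j,l}. The condition
  \<open>m' - m \<in> Acone C r\<close> is the usual partial order on monomials, with m' below
  m.\<close>

definition Acone :: "int ^ 'n::finite ^ 'n \<Rightarrow> ('n \<Rightarrow> nat) \<Rightarrow> 'n monom set" where
  "Acone C r = (\<Union>K. Ainv_products C r K)"

lemma Ainv_products_add:
  assumes "a \<in> Ainv_products C r K" "b \<in> Ainv_products C r L"
  shows "a + b \<in> Ainv_products C r (K + L)"
proof -
  from assms obtain S T where
    "a = (\<Sum>(j, l)\<in>#S. - Avar C r j l)" "size S = K" "b = (\<Sum>(j, l)\<in>#T. - Avar C r j l)" "size T = L"
    by (auto simp: Ainv_products_def)
  then show ?thesis unfolding Ainv_products_def by (auto intro!: exI[of _ "S + T"])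
qed

lemma Ainv_products_0: "0 \<in> Ainv_products C r 0"
  by (auto simp: Ainv_products_def)

lemma Ainv_products_Avar: "- Avar C r j l \<in> Ainv_products C r 1"
  unfolding Ainv_products_def by (auto intro!: exI[of _ "{#(j, l)#}"])

lemma in_Acone: "a \<in> Acone C r \<longleftrightarrow> (\<exists>K. a \<in> Ainv_products C r K)"
  by (simp add: Acone_def)

lemma Acone_0 [simp]: "0 \<in> Acone C r"
  unfolding in_Acone by (intro exI) (rule Ainv_products_0)

lemma Acone_Avar [simp]: "- Avar C r j l \<in> Acone C r"
  unfolding in_Acone by (intro exI) (rule Ainv_products_Avar)

lemma Acone_add: "a \<in> Acone C r \<Longrightarrow> b \<in> Acone C r \<Longrightarrow> a + b \<in> Acone C r"
  unfolding in_Acone by (elim exE) (intro exI, rule Ainv_products_add)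

section \<open>Height, and commutation relations of the A_{i,l}\<close>

context cartan_datum
begin

definition cw :: "'n \<Rightarrow> real" where
  "cw = (SOME c. (\<forall>i. c i \<ge> 0) \<and> (\<forall>j. (\<Sum>i\<in>UNIV. c i * of_int (C $ i $ j)) = 1))"

lemma cw: "cw i \<ge> 0" "(\<Sum>i\<in>UNIV. cw i * of_int (C $ i $ j)) = 1"
proof -
  have "(\<forall>i. cw i \<ge> 0) \<and> (\<forall>j. (\<Sum>i\<in>UNIV. cw i * of_int (C $ i $ j)) = 1)"
    unfolding cw_def using height_weights by (rule someI_ex)
  then show "cw i \<ge> 0" "(\<Sum>i\<in>UNIV. cw i * of_int (C $ i $ j)) = 1" by auto
qed

text \<open>The pairing of the weight with \<open>\<rho>\<^sup>\<or>\<close>.\<close>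

definition height :: "'n monom \<Rightarrow> real" where
  "height m = (\<Sum>x\<in>Poly_Mapping.keys m. cw (fst x) * of_int (Poly_Mapping.lookup m x))"

lemma height_superset:
  assumes "finite F" "Poly_Mapping.keys m \<subseteq> F"
  shows "height m = (\<Sum>x\<in>F. cw (fst x) * of_int (Poly_Mapping.lookup m x))"
  unfolding height_def using assms by (intro sum.mono_neutral_left) (auto simp: in_keys_iff)

lemma height_add: "height (m + m') = height m + height m'"
proof -
  let ?F = "Poly_Mapping.keys m \<union> Poly_Mapping.keys m'"
  have "Poly_Mapping.keys (m + m') \<subseteq> ?F" by (rule keys_add)
  then show ?thesis by (simp add: height_superset[of ?F] lookup_add algebra_simps sum.distrib)
qed

lemma height_uminus: "height (- m) = - height m"
  by (rule additive_minus) (rule height_add)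

lemma height_0 [simp]: "height 0 = 0"
  by (simp add: height_def)

lemma height_diff: "height (m - m') = height m - height m'"
  using height_add[of m "- m'"] by (simp add: height_uminus)

lemma height_Yvar: "height (Yvar i l) = cw i"
  by (simp add: height_def Yvar_def)

lemma height_Acomp: "height (Acomp p i l) = cw p * of_int (C $ p $ i)"
proof (cases "p = i")
  case True
  then show ?thesis by (simp add: Acomp_def height_add height_Yvar diag)
next
  case False
  then show ?thesis
    by (cases rule: entry_cases[OF False])
      (auto simp: Acomp_def height_add height_uminus height_diff height_Yvar)
qed

lemma height_Avar: "height (Avar C r i l) = 1"
proof -
  have "height (\<Sum>p\<in>A. Acomp p i l) = (\<Sum>p\<in>A. cw p * of_int (C $ p $ i))" for A
    by (induction A rule: infinite_finite_induct) (auto simp: height_add height_Acomp)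
  then show ?thesis unfolding Avar_Acomp by (simp add: cw)
qed

lemma height_dominant: "m \<in> dominant_monoms \<Longrightarrow> height m \<ge> 0"
  unfolding height_def
  by (intro sum_nonneg) (auto simp: dominant_monoms_def Bi_def uexp_def cw)

lemma height_Ainv_products: "a \<in> Ainv_products C r K \<Longrightarrow> height a = - real K"
proof -
  have "height (\<Sum>(j, l)\<in>#S. - Avar C r j l) = - real (size S)" for S
    by (induction S) (auto simp: height_add height_uminus height_diff height_Avar)
  then show "a \<in> Ainv_products C r K \<Longrightarrow> height a = - real K"
    by (auto simp: Ainv_products_def)
qed

lemma height_Acone: "a \<in> Acone C r \<Longrightarrow> height a \<le> 0"
  by (auto simp: Acone_def height_Ainv_products)

lemma uexp_Avar: "uexp (Avar C r i l) i k = of_bool (k = l - int (r i)) + of_bool (k = l + int (r i))"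
proof -
  have "uexp (Acomp p i l) i k = (if p = i then of_bool (k = l - int (r i)) + of_bool (k = l + int (r i)) else 0)" for p
    by (auto simp: Acomp_def uexp_add uexp_diff uexp_uminus uexp_Yvar)
  then show ?thesis unfolding Avar_Acomp uexp_sum by simp
qed

text \<open>Only the two variables Y_{i,b-r_i} and Y_{i,b+r_i} of A_{i,b} pair with A_{i,a}, and
  their contributions at a = b cancel.\<close>

lemma Nform_Avar_Avar:
  "Nform C r (Avar C r i a) (Avar C r i b)
    = of_bool (a - b = - 2 * int (r i)) - of_bool (a - b = 2 * int (r i))"
proof -
  let ?\<phi> = "Nform C r (Avar C r i a)"
  have *: "?\<phi> (Acomp p i b) = (if p = i then ?\<phi> (Yvar i (b - int (r i))) + ?\<phi> (Yvar i (b + int (r i))) else 0)" for p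
    by (auto simp: Acomp_def Nform_add_right Nform_diff_right Nform_minus_right Nform_Avar_Yvar)
  have "?\<phi> (Avar C r i b) = (\<Sum>p\<in>UNIV. ?\<phi> (Acomp p i b))"
    unfolding Avar_Acomp by (rule additive_sum) (rule Nform_add_right)
  also have "\<dots> = ?\<phi> (Yvar i (b - int (r i))) + ?\<phi> (Yvar i (b + int (r i)))"
    unfolding * by simp
  finally show ?thesis using r_pos[of i] by (auto simp: Nform_Avar_Yvar)
qed

text \<open>Consequently both terms of X_l pick up the same power of t when moved past a monomial
  without Y_i, and X_l commutes with it up to a power of t.\<close>

lemma Nform_ifree:
  assumes "ifree i n" shows "Nform C r (Avar C r i l) n = 0" "Nform C r n (Avar C r i l) = 0"
proof -
  show "Nform C r (Avar C r i l) n = 0"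
    by (rule ifree_additive[OF _ _ assms]) (auto simp: Nform_add_right Nform_Avar_Yvar)
  show "Nform C r n (Avar C r i l) = 0"
    by (rule ifree_additive[OF _ _ assms]) (auto simp: Nform_add_left Nform_Yvar_Avar Nform_Avar_Yvar)
qed

definition Xser :: "'n \<Rightarrow> int \<Rightarrow> 'n series" where
  "Xser i l = nord (Yvar i l) + nord (Yvar i l - Avar C r i (l + int (r i)))"

lemma Xser_Yt [simp]: "Xser i l \<in> Yt"
  by (simp add: Xser_def Yt_add)

text \<open>As N(Y_{i,l}, A_{i,l+r_i}) = 1 and N(A,A) = 0, the explicit t in the definition of E
  cancels the twist, and both terms of X_l have coefficient 1.\<close>

lemma Xser_eq:
  "tmult C r (nord (Yvar i l))
     (tone + tscale (tpow 1) (tinverse C r (nord (Avar C r i (l + int (r i)))))) = Xser i l"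
proof -
  let ?A = "Avar C r i (l + int (r i))"
  have "Nform C r ?A ?A = 0" "Nform C r (Yvar i l) ?A = 1"
    using r_pos[of i] by (auto simp: Nform_Avar_Avar Nform_Yvar_Avar Nform_Avar_Yvar)
  then show ?thesis
    by (simp add: tmult_add_right tinverse_nord tmult_tscale_right tmult_nord Nform_minus_right
        tpow_add[symmetric] Xser_def)
qed

section \<open>Words in the X_l with monomial coefficients\<close>

definition word :: "'n \<Rightarrow> int list \<Rightarrow> 'n series" where
  "word i ls = tprod_list C r (map (Xser i) ls)"

definition wordY :: "'n \<Rightarrow> int list \<Rightarrow> 'n monom" where
  "wordY i ls = sum_list (map (Yvar i) ls)"

text \<open>For n without Y_i and ls increasing these are, up to powers of t, the E_{i,t}(m).
  Allowing arbitrary ls gives a family stable under products up to powers of t, which is then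
  reduced to the increasing case.\<close>

definition nword :: "'n \<Rightarrow> 'n monom \<Rightarrow> int list \<Rightarrow> 'n series" where
  "nword i n ls = tmult C r (nord n) (word i ls)"

lemma word_Yt [simp]: "word i ls \<in> Yt"
  unfolding word_def by (rule Yt_tprod_list) auto

lemma nword_Yt [simp]: "nword i n ls \<in> Yt"
  by (simp add: nword_def Yt_tmult)

lemma word_simps [simp]: "word i [] = tone" "word i (l # ls) = tmult C r (Xser i l) (word i ls)"
  by (simp_all add: word_def)

lemma word_append: "word i (xs @ ys) = tmult C r (word i xs) (word i ys)"
  unfolding word_def map_append by (rule tprod_list_append) auto

lemma wordY_simps [simp]:
  "wordY i [] = 0" "wordY i (l # ls) = Yvar i l + wordY i ls" "wordY i (xs @ ys) = wordY i xs + wordY i ys"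
  by (simp_all add: wordY_def)

lemma uexp_wordY: "uexp (wordY i ls) j l = (if i = j then int (count (mset ls) l) else 0)"
  by (induction ls) (auto simp: uexp_add uexp_Yvar)

lemma wordY_perm: "mset xs = mset ys \<Longrightarrow> wordY i xs = wordY i ys"
  by (rule monom_eqI) (simp add: uexp_wordY)

lemma Xser_nord_commute:
  assumes "ifree i n"
  shows "teq (tmult C r (Xser i l) (nord n)) (tmult C r (nord n) (Xser i l))"
proof -
  let ?s = "nord (n + Yvar i l) + nord (n + Yvar i l - Avar C r i (l + int (r i)))"
  have "tmult C r (Xser i l) (nord n) = tscale (tpow (Nform C r (Yvar i l) n)) ?s"
    unfolding Xser_def
    by (simp add: tmult_add_left tmult_nord Nform_diff_left Nform_ifree[OF assms] algebra_simps
        series.scale_right_distrib)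
  moreover have "tmult C r (nord n) (Xser i l) = tscale (tpow (Nform C r n (Yvar i l))) ?s"
    unfolding Xser_def
    by (simp add: tmult_add_right tmult_nord Nform_diff_right Nform_ifree[OF assms] algebra_simps
        series.scale_right_distrib)
  ultimately show ?thesis using teq_trans[OF teq_tpow teq_sym[OF teq_tpow]] by simp
qed

lemma word_nord_commute:
  assumes "ifree i n"
  shows "teq (tmult C r (word i ls) (nord n)) (tmult C r (nord n) (word i ls))"
proof (induction ls)
  case (Cons l ls)
  have "tmult C r (word i (l # ls)) (nord n) = tmult C r (Xser i l) (tmult C r (word i ls) (nord n))"
    by (simp add: tmult_assoc)
  also have "teq \<dots> (tmult C r (Xser i l) (tmult C r (nord n) (word i ls)))"
    by (intro teq_tmult Cons.IH) auto
  also have "tmult C r (Xser i l) (tmult C r (nord n) (word i ls))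
      = tmult C r (tmult C r (Xser i l) (nord n)) (word i ls)"
    by (simp add: tmult_assoc)
  also have "teq \<dots> (tmult C r (tmult C r (nord n) (Xser i l)) (word i ls))"
    by (intro teq_tmult Xser_nord_commute assms) auto
  also have "tmult C r (tmult C r (nord n) (Xser i l)) (word i ls) = tmult C r (nord n) (word i (l # ls))"
    by (simp add: tmult_assoc)
  finally show ?case .
qed auto

lemma nword_mult:
  assumes "ifree i b"
  shows "teq (tmult C r (nword i a xs) (nword i b ys)) (nword i (a + b) (xs @ ys))"
proof -
  have "tmult C r (nword i a xs) (nword i b ys)
      = tmult C r (nord a) (tmult C r (tmult C r (word i xs) (nord b)) (word i ys))"
    by (simp add: nword_def tmult_assoc Yt_tmult)
  also have "teq \<dots> (tmult C r (nord a) (tmult C r (tmult C r (nord b) (word i xs)) (word i ys)))"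
    by (intro teq_tmult word_nord_commute assms) auto
  also have "tmult C r (nord a) (tmult C r (tmult C r (nord b) (word i xs)) (word i ys))
      = tmult C r (tmult C r (nord a) (nord b)) (word i (xs @ ys))"
    by (simp add: tmult_assoc Yt_tmult word_append)
  also have "teq \<dots> (nword i (a + b) (xs @ ys))"
    unfolding nword_def by (intro teq_tmult) (auto simp: tmult_nord)
  finally show ?thesis .
qed

text \<open>The third hypothesis says that the exponents p and -q cancel against N(a,a') in the
  product of the two lower terms, so that the last term has the same coefficient as the
  first.\<close>

lemma binomial_mult:
  assumes "Nform C r y a' = - p" "Nform C r a y' = q" "Nform C r a a' = q - p"
  shows "tmult C r (nord y + nord (y - a)) (nord y' + nord (y' - a')) = tscale (tpow (Nform C r y y'))
    (nord (y + y') + tscale (tpow p) (nord (y + y' - a')) + tscale (tpow (- q)) (nord (y + y' - a))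
     + nord (y + y' - a - a'))"
  by (simp add: tmult_add_left tmult_add_right Yt_add tmult_nord series.scale_right_distrib
      Nform_diff_left Nform_diff_right assms tpow_add[symmetric] algebra_simps)

text \<open>The straightening relation; the correction term appears only for \<open>\<bar>k - l\<bar> = 2r\<^sub>i\<close>.\<close>

lemma Xser_swap:
  "\<exists>u c b. tmult C r (Xser i k) (Xser i l) = tscale (tpow u) (tmult C r (Xser i l) (Xser i k))
       + tscale c (nord (Yvar i k + Yvar i l - Avar C r i b))
     \<and> (c \<noteq> 0 \<longrightarrow> ifree i (Yvar i k + Yvar i l - Avar C r i b))"
proof (cases "k = l")
  case True
  then show ?thesis by (intro exI[of _ 0]) (auto simp: fun_eq_iff tscale_apply)
next
  case False
  define R where "R = int (r i)"
  have R: "R > 0" using r_pos[of i] by (simp add: R_def)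
  define P where "P = Yvar i k + Yvar i l"
  have form: "tmult C r (Xser i k) (Xser i l) = tscale (tpow (Nform C r (Yvar i k) (Yvar i l)))
    (nord (Yvar i k + Yvar i l)
     + tscale (tpow (of_bool (k = l + 2 * R))) (nord (Yvar i k + Yvar i l - Avar C r i (l + R)))
     + tscale (tpow (- of_bool (l = k + 2 * R))) (nord (Yvar i k + Yvar i l - Avar C r i (k + R)))
     + nord (Yvar i k + Yvar i l - Avar C r i (k + R) - Avar C r i (l + R)))" if "k \<noteq> l" for k l
  proof -
    have N: "Nform C r (Yvar i k) (Avar C r i (l + R)) = - of_bool (k = l + 2 * R)"
      "Nform C r (Avar C r i (k + R)) (Yvar i l) = of_bool (l = k + 2 * R)"
      "Nform C r (Avar C r i (k + R)) (Avar C r i (l + R)) = of_bool (l = k + 2 * R) - of_bool (k = l + 2 * R)"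
      using that R by (auto simp: Nform_Yvar_Avar Nform_Avar_Yvar Nform_Avar_Avar R_def[symmetric])
    show ?thesis
      using binomial_mult[OF N] by (simp add: Xser_def R_def)
  qed
  \<comment> \<open>The exponent for exchanging the two variables. After this rescaling the highest
    and lowest terms of both products agree, and only the two middle terms can differ.\<close>
  define u where "u = Nform C r (Yvar i k) (Yvar i l) - Nform C r (Yvar i l) (Yvar i k)"
  have n: "tpow (Nform C r (Yvar i k) (Yvar i l)) = tpow u * tpow (Nform C r (Yvar i l) (Yvar i k))"
    by (simp add: u_def tpow_add[symmetric])
  have comm: "Yvar i l + Yvar i k = Yvar i k + Yvar i l"
    "Yvar i k + Yvar i l - Avar C r i (l + R) - Avar C r i (k + R)
      = Yvar i k + Yvar i l - Avar C r i (k + R) - Avar C r i (l + R)"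
    by (simp_all add: algebra_simps)
  consider "k = l + 2 * R" | "l = k + 2 * R" | "k \<noteq> l + 2 * R" "l \<noteq> k + 2 * R" by blast
  then show ?thesis
  proof cases
    case 1
    show ?thesis
    proof (intro exI conjI impI)
      \<comment> \<open>The term with A_{i,l+R} has relative coefficient t in one order and t^-1 in
        the other; the term with A_{i,k+R} has relative coefficient 1 in both.\<close>
      show "tmult C r (Xser i k) (Xser i l) = tscale (tpow u) (tmult C r (Xser i l) (Xser i k))
         + tscale (tpow (Nform C r (Yvar i k) (Yvar i l)) * (tpow 1 - tpow (-1)))
             (nord (Yvar i k + Yvar i l - Avar C r i (l + R)))"
        unfolding form[OF False] form[OF False[symmetric]] comm n
        using 1 R by (simp add: fun_eq_iff tscale_apply algebra_simps)
      \<comment> \<open>The Y_i-part of A_{i,l+R} is Y_{i,l} Y_{i,l+2R}, which is exactly Y_{i,l}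
        Y_{i,k}.\<close>
      show "ifree i (Yvar i k + Yvar i l - Avar C r i (l + R))"
        using 1 R by (auto simp: ifree_def uexp_diff uexp_add uexp_Yvar uexp_Avar R_def[symmetric])
    qed
  next
    case 2
    show ?thesis
    proof (intro exI conjI impI)
      show "tmult C r (Xser i k) (Xser i l) = tscale (tpow u) (tmult C r (Xser i l) (Xser i k))
         + tscale (tpow (Nform C r (Yvar i k) (Yvar i l)) * (tpow (-1) - tpow 1))
             (nord (Yvar i k + Yvar i l - Avar C r i (k + R)))"
        unfolding form[OF False] form[OF False[symmetric]] comm n
        using 2 R by (simp add: fun_eq_iff tscale_apply algebra_simps)
      show "ifree i (Yvar i k + Yvar i l - Avar C r i (k + R))"
        using 2 R by (auto simp: ifree_def uexp_diff uexp_add uexp_Yvar uexp_Avar R_def[symmetric])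
    qed
  next
    case 3
    have "tmult C r (Xser i k) (Xser i l) = tscale (tpow u) (tmult C r (Xser i l) (Xser i k))"
      unfolding form[OF False] form[OF False[symmetric]] comm n
      using 3 R by (simp add: fun_eq_iff tscale_apply algebra_simps)
    then show ?thesis by (intro exI[of _ u] exI[of _ 0]) (auto simp: fun_eq_iff tscale_apply)
  qed
qed

text \<open>A nonzero correction term replaces two letters by a monomial without Y_i, which can be
  carried to the front. The word becomes shorter, and this drives the induction in
  \<open>nword_in_Vspan\<close>.\<close>

lemma nword_swap:
  "\<exists>u c b. nword i n (xs @ k # l # ys) = tscale (tpow u) (nword i n (xs @ l # k # ys))
       + tscale c (nword i (n + (Yvar i k + Yvar i l - Avar C r i b)) (xs @ ys))
     \<and> (c \<noteq> 0 \<longrightarrow> ifree i (Yvar i k + Yvar i l - Avar C r i b))"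
proof -
  obtain u c b where *: "tmult C r (Xser i k) (Xser i l) = tscale (tpow u) (tmult C r (Xser i l) (Xser i k))
       + tscale c (nord (Yvar i k + Yvar i l - Avar C r i b))"
    "c \<noteq> 0 \<longrightarrow> ifree i (Yvar i k + Yvar i l - Avar C r i b)"
    using Xser_swap by blast
  define a where "a = Yvar i k + Yvar i l - Avar C r i b"
  have split: "nword i n (xs @ k # l # ys)
      = tmult C r (nord n) (tmult C r (word i xs) (tmult C r (tmult C r (Xser i k) (Xser i l)) (word i ys)))" for k l
    by (simp add: nword_def word_append tmult_assoc Yt_tmult)
  have "nword i n (xs @ k # l # ys) = tscale (tpow u) (nword i n (xs @ l # k # ys))
    + tscale c (tmult C r (nord n) (tmult C r (word i xs) (tmult C r (nord a) (word i ys))))"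
    unfolding split *(1) a_def
    by (simp add: tmult_add_left tmult_add_right tmult_tscale_left tmult_tscale_right Yt_tmult Yt_add Yt_tscale)
  moreover have "\<exists>v. tscale c (tmult C r (nord n) (tmult C r (word i xs) (tmult C r (nord a) (word i ys))))
    = tscale (c * tpow v) (nword i (n + a) (xs @ ys))"
  proof (cases "c = 0")
    case True
    then show ?thesis by (intro exI[of _ 0]) (simp add: fun_eq_iff tscale_apply)
  next
    case False
    have "teq (tmult C r (nword i n xs) (nword i a ys)) (nword i (n + a) (xs @ ys))"
      using False *(2) by (intro nword_mult) (simp add: a_def)
    then show ?thesis unfolding teq_def by (auto simp: nword_def tmult_assoc Yt_tmult)
  qed
  ultimately have "\<exists>v. nword i n (xs @ k # l # ys) = tscale (tpow u) (nword i n (xs @ l # k # ys))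
      + tscale (c * tpow v) (nword i (n + a) (xs @ ys))" by auto
  then obtain v where "nword i n (xs @ k # l # ys) = tscale (tpow u) (nword i n (xs @ l # k # ys))
      + tscale (c * tpow v) (nword i (n + a) (xs @ ys))" by blast
  moreover have "c * tpow v \<noteq> 0 \<longrightarrow> ifree i a" using *(2) by (auto simp: a_def)
  ultimately show ?thesis unfolding a_def by blast
qed

end

text \<open>Adjacent transpositions bring the first letter of xs to the front of ys; the prefix lets
  the induction continue behind the letters already placed.\<close>

lemma perm_by_swaps:
  assumes "\<And>xs k l ys. P (xs @ l # k # ys) \<Longrightarrow> P (xs @ k # l # ys)"
  shows "mset xs = mset ys \<Longrightarrow> P (pre @ ys) \<Longrightarrow> P (pre @ xs)"
proof (induction xs arbitrary: ys pre)
  case (Cons x xs)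
  then have "x \<in> set ys" by (metis list.set_intros(1) set_mset_mset)
  then obtain us vs where ys: "ys = us @ x # vs" by (meson split_list)
  have move: "P (pre @ us @ x # vs) \<Longrightarrow> P (pre @ x # us @ vs)" for pre us
  proof (induction us arbitrary: pre)
    case (Cons u us)
    from Cons.IH[of "pre @ [u]"] Cons.prems have "P (pre @ u # x # us @ vs)" by simp
    from assms[OF this] show ?case by simp
  qed simp
  have "P ((pre @ [x]) @ us @ vs)" using move[of pre us] Cons.prems(2) by (simp add: ys)
  from Cons.IH[OF _ this] show ?case using Cons.prems(1) by (simp add: ys)
qed auto

lemma count_concat_replicate:
  "distinct L \<Longrightarrow> count (mset (concat (map (\<lambda>l. replicate (f l) l) L))) k = (if k \<in> set L then f k else 0)"
  by (induction L) auto

lemma uexp_sum_list: "uexp (sum_list xs) j k = sum_list (map (\<lambda>m. uexp m j k) xs)"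
  by (induction xs) (auto simp: uexp_add)

lemma teq_tprod_nord:
  assumes "\<And>x. x \<in> set xs \<Longrightarrow> teq (f x) (nord (g x))"
  shows "teq (tprod_list C r (map f xs)) (nord (sum_list (map g xs)))"
  using assms
proof (induction xs)
  case (Cons x xs)
  have "teq (tprod_list C r (map f (x # xs))) (tmult C r (nord (g x)) (nord (sum_list (map g xs))))"
    using Cons by (auto intro!: teq_tmult)
  also have "teq \<dots> (nord (sum_list (map g (x # xs))))" by (simp add: tmult_nord)
  finally show ?case .
qed (simp add: tone_def)

lemma tpower_int_nord: "teq (tpower_int C r (nord (Yvar j l)) k) (nord (Poly_Mapping.single (j, l) k))"
proof -
  have sum: "sum_list (replicate n (Poly_Mapping.single x c)) = Poly_Mapping.single x (int n * c)"
    for n and x :: "'a \<times> int" and c :: int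
    by (induction n) (auto simp: single_add[symmetric] algebra_simps)
  have *: "teq (tprod_list C r (replicate n f)) (nord (Poly_Mapping.single (j, l) (int n * c)))"
    if "teq f (nord (Poly_Mapping.single (j, l) c))" for n f c
    using teq_tprod_nord[of "replicate n ()" "\<lambda>_. f" "\<lambda>_. Poly_Mapping.single (j, l) c" C r] that
    by (simp add: sum)
  show ?thesis
  proof (cases "k \<ge> 0")
    case True
    then show ?thesis using *[of "nord (Yvar j l)" 1 "nat k"] by (simp add: tpower_int_def Yvar_def)
  next
    case False
    have "teq (tinverse C r (nord (Yvar j l))) (nord (Poly_Mapping.single (j, l) (- 1)))"
      by (simp add: tinverse_nord Yvar_def single_uminus)
    from *[OF this, of "nat (- k)"] False show ?thesis by (simp add: tpower_int_def)
  qed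
qed

lemma teq_span: "teq f g \<Longrightarrow> g \<in> series.span S \<Longrightarrow> f \<in> series.span S"
  unfolding teq_def by (auto intro: series.span_scale)

section \<open>The elements E_{i,t}(m) as increasing words\<close>

locale cartan_linorder = cartan_datum C d r
  for C :: "int ^ 'n::{finite,linorder} ^ 'n::{finite,linorder}" and d r
begin

text \<open>Intended for m in B_i, where the exponents are nonnegative and \<open>nat\<close> loses
  nothing.\<close>

definition iword :: "'n \<Rightarrow> 'n monom \<Rightarrow> int list" where
  "iword i m = concat (map (\<lambda>l. replicate (nat (uexp m i l)) l) (sorted_list_of_set (snd ` Poly_Mapping.keys m)))"

definition npart :: "'n \<Rightarrow> 'n monom \<Rightarrow> 'n monom" where
  "npart i m = m - wordY i (iword i m)"

lemma count_iword:
  assumes "m \<in> Bi i" shows "int (count (mset (iword i m)) l) = uexp m i l"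
proof -
  have "uexp m i l = 0" if "l \<notin> snd ` Poly_Mapping.keys m"
  proof (rule ccontr)
    assume "uexp m i l \<noteq> 0"
    then have "(i, l) \<in> Poly_Mapping.keys m" by (simp add: uexp_def in_keys_iff)
    then have "snd (i, l) \<in> snd ` Poly_Mapping.keys m" by (rule imageI)
    then show False using that by simp
  qed
  then show ?thesis using assms
    by (auto simp: iword_def count_concat_replicate Bi_def)
qed

lemma npart_ifree: "m \<in> Bi i \<Longrightarrow> ifree i (npart i m)"
  by (simp add: ifree_def npart_def uexp_diff uexp_wordY count_iword)

lemma npart_iword: "npart i m + wordY i (iword i m) = m"
  by (simp add: npart_def)

lemma ifree_plus_wordY_Bi: "ifree i n \<Longrightarrow> n + wordY i ls \<in> Bi i"
  by (simp add: Bi_def ifree_def uexp_add uexp_wordY)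

lemma iword_unique:
  assumes "ifree i n"
  shows "mset (iword i (n + wordY i ls)) = mset ls" "npart i (n + wordY i ls) = n"
proof -
  have "int (count (mset (iword i (n + wordY i ls))) l) = int (count (mset ls) l)" for l
    using count_iword[OF ifree_plus_wordY_Bi[OF assms], of ls l] assms
    by (simp add: uexp_add uexp_wordY ifree_def)
  then show *: "mset (iword i (n + wordY i ls)) = mset ls" by (simp add: multiset_eq_iff)
  show "npart i (n + wordY i ls) = n" using wordY_perm[OF *] by (simp add: npart_def)
qed

definition layer :: "'n \<Rightarrow> 'n monom \<Rightarrow> int \<Rightarrow> 'n monom" where
  "layer i m l = sum_list (map (\<lambda>j. Poly_Mapping.single (j, l) (uexp m j l)) (sorted_list_of_set (UNIV - {i})))"

lemma uexp_layer: "uexp (layer i m l) j k = (if j \<noteq> i \<and> k = l then uexp m j l else 0)"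
proof -
  have "uexp (layer i m l) j k = (\<Sum>p\<in>UNIV - {i}. uexp (Poly_Mapping.single (p, l) (uexp m p l)) j k)"
    unfolding layer_def uexp_sum_list map_map comp_def
    by (subst sum_list_distinct_conv_sum_set) auto
  also have "\<dots> = (\<Sum>p\<in>UNIV - {i}. if p = j then (if k = l then uexp m j l else 0) else 0)"
    by (rule sum.cong) (auto simp: uexp_single)
  finally show ?thesis by (auto simp: sum.delta)
qed

lemma Et_factor_teq:
  assumes "m \<in> Bi i"
  shows "teq (Et_factor C r i m l) (nword i (layer i m l) (replicate (nat (uexp m i l)) l))"
proof -
  have X: "tpower_int C r (tmult C r (nord (Yvar i l))
     (tone + tscale (tpow 1) (tinverse C r (nord (Avar C r i (l + int (r i))))))) (uexp m i l)
     = word i (replicate (nat (uexp m i l)) l)"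
    using assms by (simp add: Xser_eq tpower_int_def word_def Bi_def)
  have "teq (Et_factor C r i m l) (tmult C r (word i (replicate (nat (uexp m i l)) l)) (nord (layer i m l)))"
    unfolding Et_factor_def X layer_def
    by (intro teq_tmult teq_refl teq_tprod_nord tpower_int_nord) simp
  also have "teq \<dots> (nword i (layer i m l) (replicate (nat (uexp m i l)) l))"
    unfolding nword_def by (rule word_nord_commute) (simp add: ifree_def uexp_layer)
  finally show ?thesis .
qed

text \<open>In each factor of the ordered product the monomial in the other variables moves to the
  left of the X_l, and then across the factors before it. Each move costs a power of t, while the
  order of the X_l stays increasing.\<close>

lemma Et_teq:
  assumes "m \<in> Bi i" shows "teq (Et C r i m) (nword i (npart i m) (iword i m))"
proof -
  let ?L = "sorted_list_of_set (snd ` Poly_Mapping.keys m)"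
  have free: "ifree i (sum_list (map (layer i m) L))" for L
    by (rule ifree_sum_list) (simp add: ifree_def uexp_layer)
  have prod: "teq (tprod_list C r (map (Et_factor C r i m) L))
     (nword i (sum_list (map (layer i m) L)) (concat (map (\<lambda>l. replicate (nat (uexp m i l)) l) L)))" for L
  proof (induction L)
    case Nil
    then show ?case by (simp add: nword_def) (simp add: tone_def)
  next
    case (Cons l L)
    have "teq (tprod_list C r (map (Et_factor C r i m) (l # L)))
       (tmult C r (nword i (layer i m l) (replicate (nat (uexp m i l)) l))
         (nword i (sum_list (map (layer i m) L)) (concat (map (\<lambda>l. replicate (nat (uexp m i l)) l) L))))"
      unfolding list.map tprod_list_simps by (intro teq_tmult Et_factor_teq assms Cons.IH) simp
    also have "teq \<dots> (nword i (sum_list (map (layer i m) (l # L)))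
        (concat (map (\<lambda>l. replicate (nat (uexp m i l)) l) (l # L))))"
      unfolding list.map sum_list.Cons concat.simps by (rule nword_mult) (rule free)
    finally show ?case .
  qed
  have sum: "sum_list (map (layer i m) ?L) = npart i m"
  proof (rule monom_eqI)
    fix j k
    have "uexp (sum_list (map (layer i m) ?L)) j k = (\<Sum>l\<in>snd ` Poly_Mapping.keys m. uexp (layer i m l) j k)"
      unfolding uexp_sum_list map_map comp_def by (subst sum_list_distinct_conv_sum_set) auto
    also have "\<dots> = (\<Sum>l\<in>snd ` Poly_Mapping.keys m. if l = k then (if j = i then 0 else uexp m j k) else 0)"
      by (rule sum.cong) (auto simp: uexp_layer)
    also have "\<dots> = (if j = i then 0 else uexp m j k)"
    proof (cases "k \<in> snd ` Poly_Mapping.keys m")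
      case False
      have "uexp m j k = 0"
      proof (rule ccontr)
        assume "uexp m j k \<noteq> 0"
        then have "(j, k) \<in> Poly_Mapping.keys m" by (simp add: uexp_def in_keys_iff)
        then have "snd (j, k) \<in> snd ` Poly_Mapping.keys m" by (rule imageI)
        then show False using False by simp
      qed
      then show ?thesis by (simp add: sum.delta)
    qed (simp add: sum.delta)
    also have "\<dots> = uexp (npart i m) j k"
      using count_iword[OF assms] by (simp add: npart_def uexp_diff uexp_wordY)
    finally show "uexp (sum_list (map (layer i m) ?L)) j k = uexp (npart i m) j k" .
  qed
  show ?thesis using prod[of ?L] unfolding sum by (simp only: Et_def iword_def)
qed

lemma Et_Yt: "m \<in> Bi i \<Longrightarrow> Et C r i m \<in> Yt"
  by (rule teq_Yt[OF Et_teq]) auto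

lemma monoms_teq: "teq f g \<Longrightarrow> monoms f \<subseteq> monoms g"
  unfolding teq_def using monoms_tscale by blast

lemma monoms_nword:
  assumes "a \<in> monoms (nword i n ls)" shows "a - (n + wordY i ls) \<in> Acone C r"
proof -
  have word: "a - wordY i ls \<in> Acone C r" if "a \<in> monoms (word i ls)" for a
    using that
  proof (induction ls arbitrary: a)
    case Nil
    then show ?case by (simp add: tone_def)
  next
    case (Cons l ls)
    from Cons.prems obtain b c where bc: "b \<in> monoms (Xser i l)" "c \<in> monoms (word i ls)" "a = b + c"
      by (auto elim: monoms_tmult)
    have "b \<in> {Yvar i l, Yvar i l - Avar C r i (l + int (r i))}"
      using bc(1) subsetD[OF monoms_add[of "nord (Yvar i l)"]] by (fastforce simp: Xser_def)
    then have "b - Yvar i l \<in> Acone C r" by auto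
    from Acone_add[OF this Cons.IH[OF bc(2)]] show ?case by (simp add: bc(3) algebra_simps)
  qed
  from assms obtain c where "c \<in> monoms (word i ls)" "a = n + c"
    unfolding nword_def by (auto elim: monoms_tmult)
  then show ?thesis using word by (simp add: algebra_simps)
qed

lemma monoms_Et:
  assumes "m \<in> Bi i" "a \<in> monoms (Et C r i m)" shows "a - m \<in> Acone C r"
  using monoms_nword[of a i "npart i m" "iword i m"] monoms_teq[OF Et_teq[OF assms(1)]] assms(2)
  by (auto simp: npart_iword)

text \<open>The bound by m is kept besides the span because it gives the height and support
  estimates needed for infinite sums.\<close>

definition Vspan :: "'n \<Rightarrow> 'n monom \<Rightarrow> 'n series set" where
  "Vspan i m = series.span (Et C r i ` {b \<in> Bi i. b - m \<in> Acone C r})"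

lemma Vspan_mono:
  assumes "m' - m \<in> Acone C r" shows "Vspan i m' \<subseteq> Vspan i m"
proof -
  have "b - m \<in> Acone C r" if "b - m' \<in> Acone C r" for b
    using Acone_add[OF that assms] by simp
  then show ?thesis unfolding Vspan_def by (intro series.span_mono image_mono) auto
qed

lemma Et_in_Vspan: "m \<in> Bi i \<Longrightarrow> Et C r i m \<in> Vspan i m"
  unfolding Vspan_def by (rule series.span_base) simp

text \<open>Induction on the length of the word. The increasing rearrangement gives E_{i,t}(m) up to
  a power of t, and every adjacent swap changes the element by a power of t and a multiple of a word
  two letters shorter.\<close>

lemma nword_in_Vspan: "ifree i n \<Longrightarrow> nword i n ls \<in> Vspan i (n + wordY i ls)"
proof (induction "length ls" arbitrary: n ls rule: less_induct)
  case less
  define m where "m = n + wordY i ls"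
  have m: "m \<in> Bi i" unfolding m_def by (rule ifree_plus_wordY_Bi) (rule less.prems)
  have "teq (nword i n (iword i m)) (Et C r i m)"
    using teq_sym[OF Et_teq[OF m]] iword_unique(2)[OF less.prems, of ls] by (simp add: m_def)
  then have base: "nword i n (iword i m) \<in> Vspan i m"
    using Et_in_Vspan[OF m] unfolding Vspan_def by (rule teq_span)
  \<comment> \<open>The multiset is fixed inside \<open>P\<close>, so that all words considered
    belong to the same monomial m.\<close>
  define P where "P = (\<lambda>w. mset w = mset ls \<longrightarrow> nword i n w \<in> Vspan i m)"
  have "P (xs @ k # l # ys)" if "P (xs @ l # k # ys)" for xs k l ys
    unfolding P_def
  proof
    assume w: "mset (xs @ k # l # ys) = mset ls"
    with that have "nword i n (xs @ l # k # ys) \<in> Vspan i m" by (simp add: P_def add_mset_commute)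
    moreover obtain u c b where
      eq: "nword i n (xs @ k # l # ys) = tscale (tpow u) (nword i n (xs @ l # k # ys))
         + tscale c (nword i (n + (Yvar i k + Yvar i l - Avar C r i b)) (xs @ ys))"
      and c: "c \<noteq> 0 \<longrightarrow> ifree i (Yvar i k + Yvar i l - Avar C r i b)"
      using nword_swap by blast
    moreover have "tscale c (nword i (n + (Yvar i k + Yvar i l - Avar C r i b)) (xs @ ys)) \<in> Vspan i m"
    proof (cases "c = 0")
      case True
      then have "tscale c (nword i (n + (Yvar i k + Yvar i l - Avar C r i b)) (xs @ ys)) = 0"
        by (simp add: fun_eq_iff tscale_apply)
      then show ?thesis using series.span_zero by (simp add: Vspan_def)
    next
      case False
      let ?n = "n + (Yvar i k + Yvar i l - Avar C r i b)"
      have free: "ifree i ?n" using c False less.prems by (auto intro: ifree_add)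
      have "length (xs @ ys) < length ls" using mset_eq_length[OF w] by simp
      from less.hyps[OF this free] have "nword i ?n (xs @ ys) \<in> Vspan i (?n + wordY i (xs @ ys))" .
      \<comment> \<open>The correction term belongs to the monomial m A_{i,b}^-1, which lies below
        m, so its span is contained in that of m.\<close>
      moreover have diff: "?n + wordY i (xs @ ys) - m = - Avar C r i b"
        unfolding m_def wordY_perm[OF w[symmetric]] by (simp add: algebra_simps)
      have "Vspan i (?n + wordY i (xs @ ys)) \<subseteq> Vspan i m"
        by (rule Vspan_mono) (simp only: diff Acone_Avar)
      ultimately show ?thesis unfolding Vspan_def by (auto intro: series.span_scale)
    qed
    ultimately show "nword i n (xs @ k # l # ys) \<in> Vspan i m"
      unfolding eq Vspan_def by (intro series.span_add[OF series.span_scale])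
  qed
  moreover have "P (iword i m)" using base by (simp add: P_def)
  moreover have "mset ls = mset (iword i m)"
    using iword_unique(1)[OF less.prems, of ls] by (simp add: m_def)
  ultimately have "P ([] @ ls)" using perm_by_swaps[of P ls "iword i m" "[]"] by simp
  then show ?case by (simp add: P_def m_def)
qed

lemma Et_mult:
  assumes "m \<in> Bi i" "m' \<in> Bi i"
  shows "tmult C r (Et C r i m) (Et C r i m') \<in> Vspan i (m + m')"
proof -
  have "teq (tmult C r (Et C r i m) (Et C r i m'))
     (tmult C r (nword i (npart i m) (iword i m)) (nword i (npart i m') (iword i m')))"
    by (intro teq_tmult Et_teq assms) simp
  also have "teq \<dots> (nword i (npart i m + npart i m') (iword i m @ iword i m'))"
    by (rule nword_mult) (rule npart_ifree[OF assms(2)])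
  finally have *: "teq (tmult C r (Et C r i m) (Et C r i m')) \<dots>" .
  have "(npart i m + npart i m') + wordY i (iword i m @ iword i m') = m + m'"
    using npart_iword[of i m] npart_iword[of i m'] by (simp add: algebra_simps)
  moreover have "nword i (npart i m + npart i m') (iword i m @ iword i m')
      \<in> Vspan i ((npart i m + npart i m') + wordY i (iword i m @ iword i m'))"
    by (intro nword_in_Vspan ifree_add npart_ifree assms)
  ultimately show ?thesis using teq_span[OF *] unfolding Vspan_def by simp
qed

lemma Et_0: "Et C r i 0 = tone"
  by (simp add: Et_def)

end

section \<open>The completion\<close>

lemma formal_sum_unique:
  assumes "formal_sum g f" "formal_sum g f'" shows "f = f'"
proof
  fix m
  show "f m = f' m" using assms by (simp add: formal_sum_def)
qed

lemma in_Yt_span: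
  assumes "f \<in> Yt" "monoms f \<subseteq> S" shows "f \<in> series.span (nord ` S)"
proof -
  have "(\<Sum>m\<in>monoms f. tscale (f m) (nord m)) \<in> series.span (nord ` S)"
    using assms(2) by (intro series.span_sum series.span_scale series.span_base imageI) auto
  then show ?thesis using series_expand[of "monoms f" f] assms(1) by (simp only: Yt_finite order_refl)
qed

lemma monoms_span_nord:
  assumes "f \<in> series.span (nord ` S)" shows "finite (monoms f)" "monoms f \<subseteq> S"
proof -
  have "series.subspace {f. finite (monoms f) \<and> monoms f \<subseteq> S}"
  proof (rule series.subspaceI)
    fix f g assume "f \<in> {f. finite (monoms f) \<and> monoms f \<subseteq> S}" "g \<in> {f. finite (monoms f) \<and> monoms f \<subseteq> S}"
    then show "f + g \<in> {f. finite (monoms f) \<and> monoms f \<subseteq> S}"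
      using monoms_add[of f g] finite_subset[OF monoms_add[of f g]] by blast
  next
    fix c f assume "f \<in> {f. finite (monoms f) \<and> monoms f \<subseteq> S}"
    then show "tscale c f \<in> {f. finite (monoms f) \<and> monoms f \<subseteq> S}"
      using monoms_tscale[of c f] finite_subset[OF monoms_tscale[of c f]] by blast
  qed simp
  then have "series.span (nord ` S) \<subseteq> {f. finite (monoms f) \<and> monoms f \<subseteq> S}"
    by (intro series.span_minimal) auto
  then show "finite (monoms f)" "monoms f \<subseteq> S" using assms by auto
qed

text \<open>This expresses through supports that only finitely many M occur in the sums defining the
  completion.\<close>

definition cone_supp :: "int ^ 'n::finite ^ 'n \<Rightarrow> ('n \<Rightarrow> nat) \<Rightarrow> 'n series \<Rightarrow> bool" where
  "cone_supp C r f \<longleftrightarrow> (\<exists>F. finite F \<and> (\<forall>m\<in>monoms f. \<exists>M\<in>F. m - M \<in> Acone C r))"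

lemma cone_supp_subset: "cone_supp C r f \<Longrightarrow> monoms g \<subseteq> monoms f \<Longrightarrow> cone_supp C r g"
  unfolding cone_supp_def by (elim exE, rule exI) auto

lemma cone_supp_add:
  assumes "cone_supp C r f" "cone_supp C r g" shows "cone_supp C r (f + g)"
proof -
  from assms obtain F G where FG: "finite F" "\<And>m. m \<in> monoms f \<Longrightarrow> \<exists>M\<in>F. m - M \<in> Acone C r"
    "finite G" "\<And>m. m \<in> monoms g \<Longrightarrow> \<exists>M\<in>G. m - M \<in> Acone C r"
    unfolding cone_supp_def by auto
  have "\<exists>M\<in>F \<union> G. m - M \<in> Acone C r" if "m \<in> monoms (f + g)" for m
    using FG(2)[of m] FG(4)[of m] subsetD[OF monoms_add that] by auto
  then show ?thesis unfolding cone_supp_def using FG by (intro exI[of _ "F \<union> G"]) auto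
qed

lemma cone_supp_0: "cone_supp C r 0"
  unfolding cone_supp_def by (rule exI[of _ "{}"]) simp

lemma cone_supp_sum: "(\<And>x. x \<in> A \<Longrightarrow> cone_supp C r (f x)) \<Longrightarrow> cone_supp C r (\<Sum>x\<in>A. f x)"
proof (induction A rule: infinite_finite_induct)
  case (insert x A)
  then show ?case unfolding sum.insert[OF insert.hyps] by (intro cone_supp_add) auto
qed (simp_all only: sum.infinite sum.empty cone_supp_0 not_False_eq_True)

lemma cone_supp_trans:
  assumes "cone_supp C r f" "\<And>m. m \<in> monoms g \<Longrightarrow> \<exists>n\<in>monoms f. m - n \<in> Acone C r"
  shows "cone_supp C r g"
proof -
  from assms(1) obtain F where F: "finite F" "\<And>m. m \<in> monoms f \<Longrightarrow> \<exists>M\<in>F. m - M \<in> Acone C r"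
    unfolding cone_supp_def by auto
  have "\<exists>M\<in>F. m - M \<in> Acone C r" if "m \<in> monoms g" for m
  proof -
    from assms(2)[OF that] obtain n where n: "n \<in> monoms f" "m - n \<in> Acone C r" by auto
    from F(2)[OF n(1)] obtain M where M: "M \<in> F" "n - M \<in> Acone C r" by auto
    have "m - M \<in> Acone C r" using Acone_add[OF n(2) M(2)] by simp
    with M(1) show ?thesis by auto
  qed
  then show ?thesis unfolding cone_supp_def using F(1) by auto
qed

lemma cone_supp_mult:
  assumes "cone_supp C r f" "cone_supp C r g"
    "\<And>m. m \<in> monoms h \<Longrightarrow> \<exists>a\<in>monoms f. \<exists>b\<in>monoms g. m - (a + b) \<in> Acone C r"
  shows "cone_supp C r h"
proof -
  from assms obtain F G where FG: "finite F" "\<And>m. m \<in> monoms f \<Longrightarrow> \<exists>M\<in>F. m - M \<in> Acone C r"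
    "finite G" "\<And>m. m \<in> monoms g \<Longrightarrow> \<exists>M\<in>G. m - M \<in> Acone C r"
    unfolding cone_supp_def by auto
  have "\<exists>M\<in>(\<lambda>(M, N). M + N) ` (F \<times> G). m - M \<in> Acone C r" if m: "m \<in> monoms h" for m
  proof -
    obtain a b where ab: "a \<in> monoms f" "b \<in> monoms g" "m - (a + b) \<in> Acone C r" using assms(3)[OF m] by auto
    obtain M N where MN: "M \<in> F" "a - M \<in> Acone C r" "N \<in> G" "b - N \<in> Acone C r"
      using FG(2)[OF ab(1)] FG(4)[OF ab(2)] by auto
    have "m - (M + N) = (m - (a + b)) + ((a - M) + (b - N))" by simp
    with Acone_add[OF ab(3) Acone_add[OF MN(2,4)]] have "m - (M + N) \<in> Acone C r" by (simp only:)
    then show ?thesis using MN(1,3) by force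
  qed
  moreover have "finite ((\<lambda>(M, N). M + N) ` (F \<times> G))" using FG by simp
  ultimately show ?thesis unfolding cone_supp_def by blast
qed

context cartan_datum
begin

text \<open>A series is good if it lies in the completion of the quantum torus for the height
  filtration.\<close>

definition good :: "'n series \<Rightarrow> bool" where
  "good f \<longleftrightarrow> (\<forall>c. finite {m \<in> monoms f. c \<le> height m})"

lemma good_Yt: "f \<in> Yt \<Longrightarrow> good f"
  by (simp add: good_def Yt_finite)

lemma good_subset:
  assumes "good f" "monoms g \<subseteq> monoms f" shows "good g"
  unfolding good_def
proof
  fix c
  have "{m \<in> monoms g. c \<le> height m} \<subseteq> {m \<in> monoms f. c \<le> height m}" using assms(2) by auto
  then show "finite {m \<in> monoms g. c \<le> height m}"
    by (rule finite_subset) (use assms(1) in \<open>simp add: good_def\<close>)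
qed

lemma good_add: "good f \<Longrightarrow> good g \<Longrightarrow> good (f + g)"
  unfolding good_def
proof
  fix c assume "\<forall>c. finite {m \<in> monoms f. c \<le> height m}" "\<forall>c. finite {m \<in> monoms g. c \<le> height m}"
  then have "finite ({m \<in> monoms f. c \<le> height m} \<union> {m \<in> monoms g. c \<le> height m})" by simp
  moreover have "{m \<in> monoms (f + g). c \<le> height m}
      \<subseteq> {m \<in> monoms f. c \<le> height m} \<union> {m \<in> monoms g. c \<le> height m}"
    using monoms_add[of f g] by auto
  ultimately show "finite {m \<in> monoms (f + g). c \<le> height m}" by (rule finite_subset[rotated])
qed

lemma good_sum: "(\<And>x. x \<in> A \<Longrightarrow> good (f x)) \<Longrightarrow> good (\<Sum>x\<in>A. f x)"
proof (induction A rule: infinite_finite_induct)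
  case (insert x A)
  then show ?case unfolding sum.insert[OF insert.hyps] by (intro good_add) auto
qed (simp_all only: sum.infinite sum.empty good_Yt[OF Yt_0] not_False_eq_True)

lemma good_bound:
  assumes "good f" obtains b where "\<And>m. m \<in> monoms f \<Longrightarrow> height m \<le> b"
proof -
  let ?S = "{m \<in> monoms f. 0 \<le> height m}"
  \<comment> \<open>The extra 0 keeps the set nonempty and bounds the monomials of negative
    height.\<close>
  have fin: "finite (insert 0 (height ` ?S))" using assms by (simp add: good_def)
  have "height m \<le> Max (insert 0 (height ` ?S))" if "m \<in> monoms f" for m
  proof (cases "0 \<le> height m")
    case True
    then show ?thesis using that fin by (intro Max_ge) auto
  next
    case False
    then show ?thesis using Max_ge[OF fin, of 0] by simp
  qed
  then show ?thesis by (rule that)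
qed

lemma good_finite_dominant: "good f \<Longrightarrow> finite (monoms f \<inter> dominant_monoms)"
  unfolding good_def by (rule finite_subset[of _ "{m \<in> monoms f. 0 \<le> height m}"])
    (auto simp: height_dominant)

section \<open>Truncation by height, and products of good series\<close>

definition trunc :: "real \<Rightarrow> 'n series \<Rightarrow> 'n series" where
  "trunc c f = (\<lambda>m. if c \<le> height m then f m else 0)"

lemma monoms_trunc: "monoms (trunc c f) = {m \<in> monoms f. c \<le> height m}"
  by (auto simp: monoms_def trunc_def)

text \<open>If all heights are at most b, then in a factorization of m each factor has height at
  least that of m minus b. Lower terms cannot contribute to this coefficient.\<close>

lemma tmult_trunc:
  assumes "\<And>m. m \<in> monoms f \<Longrightarrow> height m \<le> b" "\<And>m. m \<in> monoms g \<Longrightarrow> height m \<le> b"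
    "c \<le> height m - b"
  shows "tmult C r (trunc c f) (trunc c g) m = tmult C r f g m"
proof -
  have *: "c \<le> height a \<and> c \<le> height a'" if "a \<in> monoms f" "a' \<in> monoms g" "a + a' = m" for a a'
    using assms(1)[OF that(1)] assms(2)[OF that(2)] assms(3) that(3) by (auto simp: height_add)
  then have "{(m\<^sub>1, m\<^sub>2). m\<^sub>1 \<in> monoms (trunc c f) \<and> m\<^sub>2 \<in> monoms (trunc c g) \<and> m\<^sub>1 + m\<^sub>2 = m}
      = {(m\<^sub>1, m\<^sub>2). m\<^sub>1 \<in> monoms f \<and> m\<^sub>2 \<in> monoms g \<and> m\<^sub>1 + m\<^sub>2 = m}"
    by (auto simp: monoms_trunc)
  then show ?thesis unfolding tmult_def
    by (intro sum.cong) (auto simp: trunc_def dest: *)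
qed

text \<open>Here h need not be a product; \<open>T a b\<close> is a finite set of monomials that the
  pair (a,b) may produce. It is a singleton for \<open>tmult\<close>, and for the coefficients in
  \<open>Ki_inf_tmult\<close> it is the support of the expansion of E(a) E(b).\<close>

lemma good_mult:
  assumes "good f" "good g"
    "\<And>m. m \<in> monoms h \<Longrightarrow> \<exists>a\<in>monoms f. \<exists>b\<in>monoms g. height m \<le> height a + height b \<and> m \<in> T a b"
    "\<And>a b. a \<in> monoms f \<Longrightarrow> b \<in> monoms g \<Longrightarrow> finite (T a b)"
  shows "good h"
  unfolding good_def
proof
  fix c
  obtain bf where bf: "\<And>m. m \<in> monoms f \<Longrightarrow> height m \<le> bf" using good_bound[OF assms(1)] by blast
  obtain bg where bg: "\<And>m. m \<in> monoms g \<Longrightarrow> height m \<le> bg" using good_bound[OF assms(2)] by blast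
  let ?F = "{m \<in> monoms f. c - bg \<le> height m}" and ?G = "{m \<in> monoms g. c - bf \<le> height m}"
  have "{m \<in> monoms h. c \<le> height m} \<subseteq> (\<Union>a\<in>?F. \<Union>b\<in>?G. T a b)"
  proof
    fix m assume m: "m \<in> {m \<in> monoms h. c \<le> height m}"
    then obtain a b where ab: "a \<in> monoms f" "b \<in> monoms g" "height m \<le> height a + height b" "m \<in> T a b"
      using assms(3)[of m] by auto
    with m bf[OF ab(1)] bg[OF ab(2)] have "a \<in> ?F" "b \<in> ?G" by auto
    with ab(4) show "m \<in> (\<Union>a\<in>?F. \<Union>b\<in>?G. T a b)" by blast
  qed
  moreover have "finite (\<Union>a\<in>?F. \<Union>b\<in>?G. T a b)"
    using assms(1,2,4) by (auto simp: good_def)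
  ultimately show "finite {m \<in> monoms h. c \<le> height m}" by (rule finite_subset)
qed

lemma good_tmult:
  assumes "good f" "good g" shows "good (tmult C r f g)"
proof (rule good_mult[OF assms, where T = "\<lambda>a b. {a + b}"])
  fix m assume "m \<in> monoms (tmult C r f g)"
  then obtain a b where "a \<in> monoms f" "b \<in> monoms g" "m = a + b" by (rule monoms_tmult)
  then show "\<exists>a\<in>monoms f. \<exists>b\<in>monoms g. height m \<le> height a + height b \<and> m \<in> {a + b}"
    by (auto simp: height_add)
qed simp

section \<open>The completion described by supports alone\<close>

lemma YtA_inf_monoms:
  assumes "f \<in> YtA_inf C r" shows "good f" "monoms f \<subseteq> Acone C r"
proof -
  from assms obtain g where g: "\<And>K. g K \<in> YtA C r K" "formal_sum g f"
    unfolding YtA_inf_def by auto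
  have gK: "finite (monoms (g K))" "monoms (g K) \<subseteq> Ainv_products C r K" for K
    using monoms_span_nord[of "g K" "Ainv_products C r K"] g(1)[of K] by (simp_all add: YtA_def)
  have ex: "\<exists>K. m \<in> monoms (g K)" if "m \<in> monoms f" for m
  proof (rule ccontr)
    assume "\<not> ?thesis"
    then have "{K. g K m \<noteq> 0} = {}" by (auto simp: in_monoms)
    then have "f m = 0" using g(2) by (simp add: formal_sum_def)
    then show False using that by (simp add: in_monoms)
  qed
  show "monoms f \<subseteq> Acone C r"
  proof
    fix m assume "m \<in> monoms f"
    then obtain K where "m \<in> monoms (g K)" using ex by auto
    with gK(2) show "m \<in> Acone C r" unfolding in_Acone by (intro exI[of _ K]) auto
  qed
  show "good f"
    unfolding good_def
  proof
    fix c
    have "{m \<in> monoms f. c \<le> height m} \<subseteq> (\<Union>K\<in>{..nat \<lceil>- c\<rceil>}. monoms (g K))"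
    proof
      fix m assume m: "m \<in> {m \<in> monoms f. c \<le> height m}"
      then obtain K where K: "m \<in> monoms (g K)" using ex by auto
      then have "height m = - real K" using gK(2) height_Ainv_products by auto
      then have "real K \<le> - c" using m by auto
      then have "K \<le> nat \<lceil>- c\<rceil>" by linarith
      with K show "m \<in> (\<Union>K\<in>{..nat \<lceil>- c\<rceil>}. monoms (g K))" by auto
    qed
    then show "finite {m \<in> monoms f. c \<le> height m}" by (rule finite_subset) (simp add: gK(1))
  qed
qed

lemma Ainv_products_disjoint: "a \<in> Ainv_products C r K \<Longrightarrow> a \<in> Ainv_products C r L \<Longrightarrow> K = L"
  using height_Ainv_products[of a K] height_Ainv_products[of a L] by simp

text \<open>The family is obtained by cutting f into slices with K factors. Height -K separates the
  slices, so each monomial receives exactly one summand, and goodness makes each slice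
  finite.\<close>

lemma YtA_infI:
  assumes "good f" "monoms f \<subseteq> Acone C r" shows "f \<in> YtA_inf C r"
proof -
  define g where "g = (\<lambda>K m. if m \<in> Ainv_products C r K then f m else 0)"
  have "g K \<in> YtA C r K" for K
  proof -
    have "monoms (g K) \<subseteq> {m \<in> monoms f. - real K \<le> height m}"
      by (auto simp: g_def in_monoms height_Ainv_products split: if_splits)
    then have "g K \<in> Yt" using assms(1) finite_subset by (auto simp: Yt_finite good_def)
    then show ?thesis unfolding YtA_def
      by (rule in_Yt_span) (auto simp: g_def in_monoms split: if_splits)
  qed
  moreover have "formal_sum g f"
    unfolding formal_sum_def
  proof (rule allI)
    fix m
    show "finite {K. g K m \<noteq> 0} \<and> f m = (\<Sum>K | g K m \<noteq> 0. g K m)"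
    proof (cases "m \<in> monoms f")
      case True
      then have "m \<in> Acone C r" using assms(2) by auto
      then obtain K where K: "m \<in> Ainv_products C r K" unfolding in_Acone by (rule exE)
      have "m \<in> Ainv_products C r L \<longleftrightarrow> L = K" for L
      proof
        show "L = K" if "m \<in> Ainv_products C r L" using Ainv_products_disjoint[OF that K] .
      qed (simp only: K)
      then have "{K. g K m \<noteq> 0} = {K}"
        using True by (simp add: g_def in_monoms)
      then show ?thesis using K by (simp add: g_def)
    next
      case False
      then have "{K. g K m \<noteq> 0} = {}" by (auto simp: g_def in_monoms)
      then show ?thesis using False by (simp add: in_monoms)
    qed
  qed
  ultimately show ?thesis unfolding YtA_inf_def by blast
qed

lemma good_shift:
  assumes "good f" "\<And>m. m \<in> monoms g \<Longrightarrow> M + m \<in> monoms f" shows "good g"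
  unfolding good_def
proof
  fix c
  have "(+) M ` {m \<in> monoms g. c \<le> height m} \<subseteq> {m \<in> monoms f. c + height M \<le> height m}"
    using assms(2) by (auto simp: height_add)
  moreover have "finite {m \<in> monoms f. c + height M \<le> height m}"
    using assms(1) by (simp add: good_def)
  ultimately have "finite ((+) M ` {m \<in> monoms g. c \<le> height m})" by (rule finite_subset)
  then show "finite {m \<in> monoms g. c \<le> height m}" by (rule finite_imageD) (simp add: inj_on_def)
qed

text \<open>Translates of the cone may overlap, so a choice function s assigns each monomial of f to
  a single M.\<close>

lemma cone_split:
  assumes "finite F" "\<And>m. m \<in> monoms f \<Longrightarrow> \<exists>M\<in>F. m - M \<in> Acone C r"
  obtains g where "f = (\<Sum>M\<in>F. g M)" "\<And>M. monoms (g M) \<subseteq> monoms f"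
    "\<And>M m. m \<in> monoms (g M) \<Longrightarrow> m - M \<in> Acone C r"
proof -
  obtain s where s: "\<And>m. m \<in> monoms f \<Longrightarrow> s m \<in> F \<and> m - s m \<in> Acone C r"
    using assms(2) by metis
  define g where "g = (\<lambda>M m. if s m = M then f m else 0)"
  have "f m = (\<Sum>M\<in>F. g M) m" for m
  proof (cases "m \<in> monoms f")
    case True
    then show ?thesis using s[OF True] assms(1) by (simp add: series_sum_apply g_def)
  next
    case False
    then have "f m = 0" by (simp add: in_monoms)
    then have "g M m = 0" for M by (simp add: g_def)
    with \<open>f m = 0\<close> show ?thesis by (simp add: series_sum_apply)
  qed
  then have "f = (\<Sum>M\<in>F. g M)" by (rule ext)
  moreover have "monoms (g M) \<subseteq> monoms f" for M
    by (auto simp: g_def in_monoms split: if_splits)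
  moreover have "m - M \<in> Acone C r" if "m \<in> monoms (g M)" for m M
    using that s[of m] by (auto simp: g_def in_monoms split: if_splits)
  ultimately show ?thesis by (rule that)
qed

text \<open>With this criterion membership in the completion reduces to two conditions on supports,
  both compatible with sums.\<close>

lemma Yt_inf_iff: "f \<in> Yt_inf C r \<longleftrightarrow> good f \<and> cone_supp C r f"
proof
  assume "f \<in> Yt_inf C r"
  then obtain F g where f: "f = (\<Sum>M\<in>F. tmult C r (nord M) (g M))" and F: "finite F"
    and g: "\<And>M. M \<in> F \<Longrightarrow> g M \<in> YtA_inf C r"
    unfolding Yt_inf_def by auto
  have "good (tmult C r (nord M) (g M))" "cone_supp C r (tmult C r (nord M) (g M))" if "M \<in> F" for M
  proof -
    show "good (tmult C r (nord M) (g M))"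
      using YtA_inf_monoms(1)[OF g[OF that]] by (intro good_tmult good_Yt[OF Yt_nord])
    have "m - M \<in> Acone C r" if "m \<in> monoms (tmult C r (nord M) (g M))" for m
      using that YtA_inf_monoms(2)[OF g[OF \<open>M \<in> F\<close>]] by (auto elim!: monoms_tmult)
    then show "cone_supp C r (tmult C r (nord M) (g M))"
      unfolding cone_supp_def by (intro exI[of _ "{M}"]) auto
  qed
  then show "good f \<and> cone_supp C r f" unfolding f by (intro conjI good_sum cone_supp_sum)
next
  assume f: "good f \<and> cone_supp C r f"
  then obtain F where F: "finite F" "\<And>m. m \<in> monoms f \<Longrightarrow> \<exists>M\<in>F. m - M \<in> Acone C r"
    unfolding cone_supp_def by auto
  obtain h where h: "f = (\<Sum>M\<in>F. h M)" "\<And>M. monoms (h M) \<subseteq> monoms f"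
    "\<And>M m. m \<in> monoms (h M) \<Longrightarrow> m - M \<in> Acone C r"
    using cone_split[OF F] by blast
  \<comment> \<open>The factor t^(-N(M,a)) undoes the twist of left multiplication by :M:.\<close>
  define g where "g = (\<lambda>M a. tpow (- Nform C r M a) * h M (M + a))"
  have "tmult C r (nord M) (g M) = h M" for M
    by (rule ext) (simp add: tmult_nord_left g_def mult.assoc[symmetric] tpow_add[symmetric])
  then have "f = (\<Sum>M\<in>F. tmult C r (nord M) (g M))" using h(1) by simp
  moreover have "g M \<in> YtA_inf C r" for M
  proof (rule YtA_infI)
    have *: "M + a \<in> monoms (h M)" if "a \<in> monoms (g M)" for a
      using that by (auto simp: g_def in_monoms)
    show "good (g M)"
    proof (rule good_shift)
      show "good f" using f by simp
      show "M + a \<in> monoms f" if "a \<in> monoms (g M)" for a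
        using *[OF that] h(2) by auto
    qed
    show "monoms (g M) \<subseteq> Acone C r"
    proof
      fix a assume "a \<in> monoms (g M)"
      from h(3)[OF *[OF this]] show "a \<in> Acone C r" by simp
    qed
  qed
  ultimately show "f \<in> Yt_inf C r" unfolding Yt_inf_def using F(1) by blast
qed

end

section \<open>Infinite sums of the \<open>E\<^sub>i\<^sub>,\<^sub>t(m)\<close>\<close>

context cartan_linorder
begin

text \<open>The sum \<open>\<Sum>\<^sub>n u\<^sub>n E\<^sub>i\<^sub>,\<^sub>t(n)\<close>; a monomial of height \<open>h\<close> occurs only in the \<open>E\<^sub>i\<^sub>,\<^sub>t(n)\<close> with \<open>n\<close> of height at
  least \<open>h\<close>.\<close>

definition Esum :: "'n \<Rightarrow> 'n series \<Rightarrow> 'n series" where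
  "Esum i u = (\<lambda>m. \<Sum>n | n \<in> monoms u \<and> height m \<le> height n. u n * Et C r i n m)"

text \<open>The coefficient families whose sums make up K_i, by \<open>Ki_inf_iff\<close>. Working
  with them avoids the two nested sums over M and K.\<close>

definition admissible :: "'n \<Rightarrow> 'n series \<Rightarrow> bool" where
  "admissible i u \<longleftrightarrow> good u \<and> cone_supp C r u \<and> monoms u \<subseteq> Bi i"

lemma height_Et: "n \<in> Bi i \<Longrightarrow> Et C r i n m \<noteq> 0 \<Longrightarrow> height m \<le> height n"
  using height_Acone[OF monoms_Et[of n i m]] by (simp add: in_monoms height_diff)

text \<open>The finite index set may be enlarged freely, since an E(n) of height below that of m
  does not contain m. This puts several sums on a common index set.\<close>

lemma Esum_eq:
  assumes "monoms u \<subseteq> Bi i" "finite S" "\<And>n. n \<in> monoms u \<Longrightarrow> height m \<le> height n \<Longrightarrow> n \<in> S"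
  shows "Esum i u m = (\<Sum>n\<in>S. u n * Et C r i n m)"
  unfolding Esum_def
proof (rule sum.mono_neutral_left)
  show "finite S" "{n \<in> monoms u. height m \<le> height n} \<subseteq> S" using assms(2,3) by auto
  show "\<forall>n\<in>S - {n \<in> monoms u. height m \<le> height n}. u n * Et C r i n m = 0"
  proof
    fix n assume n: "n \<in> S - {n \<in> monoms u. height m \<le> height n}"
    show "u n * Et C r i n m = 0"
    proof (cases "n \<in> monoms u")
      case True
      then have "n \<in> Bi i" using assms(1) by auto
      then show ?thesis using True n height_Et[of n i m] by auto
    next
      case False
      then show ?thesis by (simp add: in_monoms)
    qed
  qed
qed

lemma Esum_Yt:
  assumes "monoms u \<subseteq> Bi i" "finite S" "monoms u \<subseteq> S"
  shows "Esum i u = (\<Sum>n\<in>S. tscale (u n) (Et C r i n))"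
  by (rule ext, subst Esum_eq[of _ _ S]) (use assms in \<open>auto simp: series_sum_apply tscale_apply\<close>)

lemma Esum_nord: "n \<in> Bi i \<Longrightarrow> Esum i (nord n) = Et C r i n"
  by (subst Esum_Yt[of _ _ "{n}"]) (simp_all, simp add: nord_def)

lemma Esum_add:
  assumes "good u" "good v" "monoms u \<subseteq> Bi i" "monoms v \<subseteq> Bi i"
  shows "Esum i (u + v) = Esum i u + Esum i v"
proof
  fix m
  let ?S = "{n \<in> monoms u. height m \<le> height n} \<union> {n \<in> monoms v. height m \<le> height n}"
  have S: "finite ?S" using assms(1,2) by (simp add: good_def)
  have Bi: "monoms (u + v) \<subseteq> Bi i" using monoms_add[of u v] assms(3,4) by auto
  have *: "n \<in> ?S" if "n \<in> monoms (u + v)" "height m \<le> height n" for n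
    using that monoms_add[of u v] by auto
  have "Esum i (u + v) m = (\<Sum>n\<in>?S. (u + v) n * Et C r i n m)"
    by (rule Esum_eq[OF Bi S *])
  moreover have "Esum i u m = (\<Sum>n\<in>?S. u n * Et C r i n m)"
    by (rule Esum_eq[OF assms(3) S]) simp
  moreover have "Esum i v m = (\<Sum>n\<in>?S. v n * Et C r i n m)"
    by (rule Esum_eq[OF assms(4) S]) simp
  ultimately show "Esum i (u + v) m = (Esum i u + Esum i v) m"
    by (simp only: plus_fun_apply distrib_right sum.distrib)
qed

lemma Esum_tscale:
  assumes "good u" "monoms u \<subseteq> Bi i"
  shows "Esum i (tscale c u) = tscale c (Esum i u)"
proof
  fix m
  let ?S = "{n \<in> monoms u. height m \<le> height n}"
  have S: "finite ?S" using assms(1) by (simp add: good_def)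
  have Bi: "monoms (tscale c u) \<subseteq> Bi i" using monoms_tscale[of c u] assms(2) by auto
  have *: "n \<in> ?S" if "n \<in> monoms (tscale c u)" "height m \<le> height n" for n
    using that monoms_tscale[of c u] by auto
  have "Esum i (tscale c u) m = (\<Sum>n\<in>?S. tscale c u n * Et C r i n m)"
    by (rule Esum_eq[OF Bi S *])
  moreover have "Esum i u m = (\<Sum>n\<in>?S. u n * Et C r i n m)"
    by (rule Esum_eq[OF assms(2) S]) simp
  ultimately show "Esum i (tscale c u) m = tscale c (Esum i u) m"
    by (simp only: tscale_apply sum_distrib_left mult.assoc)
qed

lemma admissible_add: "admissible i u \<Longrightarrow> admissible i v \<Longrightarrow> admissible i (u + v)"
  unfolding admissible_def using monoms_add[of u v] by (auto intro: good_add cone_supp_add)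

lemma admissible_subset: "admissible i u \<Longrightarrow> monoms v \<subseteq> monoms u \<Longrightarrow> admissible i v"
  unfolding admissible_def using good_subset[of u v] cone_supp_subset[of C r u v] by auto

lemma admissible_0: "admissible i 0"
  by (simp add: admissible_def good_Yt cone_supp_0)

lemma Esum_0: "Esum i 0 = 0"
  by (simp add: Esum_def fun_eq_iff)

lemma admissible_sum:
  assumes "finite F" "\<And>M. M \<in> F \<Longrightarrow> admissible i (u M)"
  shows "admissible i (\<Sum>M\<in>F. u M) \<and> Esum i (\<Sum>M\<in>F. u M) = (\<Sum>M\<in>F. Esum i (u M))"
  using assms
proof (induction F)
  case (insert M F)
  then have *: "admissible i (u M)" "admissible i (\<Sum>M\<in>F. u M)"
    "Esum i (\<Sum>M\<in>F. u M) = (\<Sum>M\<in>F. Esum i (u M))" by auto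
  show ?case
    unfolding sum.insert[OF insert.hyps]
  proof
    show "admissible i (u M + (\<Sum>M\<in>F. u M))" by (rule admissible_add[OF *(1,2)])
    show "Esum i (u M + (\<Sum>M\<in>F. u M)) = Esum i (u M) + (\<Sum>M\<in>F. Esum i (u M))"
      unfolding *(3)[symmetric] by (rule Esum_add) (use *(1,2) in \<open>auto simp: admissible_def\<close>)
  qed
qed (simp only: sum.empty admissible_0 Esum_0)

lemma monoms_Esum:
  assumes "monoms u \<subseteq> Bi i" "m \<in> monoms (Esum i u)"
  obtains n where "n \<in> monoms u" "m \<in> monoms (Et C r i n)" "m - n \<in> Acone C r" "height m \<le> height n"
proof -
  have "\<exists>n\<in>{n. n \<in> monoms u \<and> height m \<le> height n}. u n * Et C r i n m \<noteq> 0"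
  proof (rule ccontr)
    assume "\<not> ?thesis"
    then have "Esum i u m = 0" unfolding Esum_def by (intro sum.neutral) blast
    then show False using assms(2) by (simp add: in_monoms)
  qed
  then obtain n where n: "n \<in> monoms u" "height m \<le> height n" "u n * Et C r i n m \<noteq> 0" by blast
  then have m: "m \<in> monoms (Et C r i n)" by (auto simp: in_monoms)
  have "n \<in> Bi i" using assms(1) n(1) by auto
  from that[OF n(1) m monoms_Et[OF this m] n(2)] show ?thesis .
qed

lemma Esum_Yt_inf:
  assumes "admissible i u" shows "Esum i u \<in> Yt_inf C r"
  unfolding Yt_inf_iff
proof
  have u: "good u" "cone_supp C r u" "monoms u \<subseteq> Bi i" using assms by (auto simp: admissible_def)
  show "cone_supp C r (Esum i u)"
    by (rule cone_supp_trans[OF u(2)]) (use u(3) in \<open>auto elim: monoms_Esum\<close>)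
  show "good (Esum i u)"
    unfolding good_def
  proof
    fix c
    have "{m \<in> monoms (Esum i u). c \<le> height m} \<subseteq> (\<Union>n\<in>{n \<in> monoms u. c \<le> height n}. monoms (Et C r i n))"
    proof
      fix m assume m: "m \<in> {m \<in> monoms (Esum i u). c \<le> height m}"
      then have "m \<in> monoms (Esum i u)" by simp
      with u(3) obtain n where "n \<in> monoms u" "m \<in> monoms (Et C r i n)" "height m \<le> height n"
        by (rule monoms_Esum)
      with m show "m \<in> (\<Union>n\<in>{n \<in> monoms u. c \<le> height n}. monoms (Et C r i n))" by auto
    qed
    moreover have "finite (\<Union>n\<in>{n \<in> monoms u. c \<le> height n}. monoms (Et C r i n))"
      using u Et_Yt by (auto simp: good_def Yt_finite)
    ultimately show "finite {m \<in> monoms (Esum i u). c \<le> height m}" by (rule finite_subset)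
  qed
qed

text \<open>The definition of K_i groups the terms by the number K of factors A^-1,
  \<open>Esum\<close> by the index monomial. For fixed M the two agree because K can be read off
  from the height.\<close>

lemma formal_sum_Esum:
  assumes S: "\<And>K. finite (S K)" "\<And>K. S K \<subseteq> {a \<in> Ainv_products C r K. M + a \<in> Bi i}"
    and u: "\<And>K a. a \<in> S K \<Longrightarrow> u (M + a) = c a" "\<And>n. n \<in> monoms u \<Longrightarrow> \<exists>K. n - M \<in> S K"
  shows "formal_sum (\<lambda>K. \<Sum>a\<in>S K. tscale (c a) (Et C r i (M + a))) (Esum i u)"
  unfolding formal_sum_def
proof (rule allI)
  fix m
  let ?g = "\<lambda>K. (\<Sum>a\<in>S K. tscale (c a) (Et C r i (M + a))) m"
  have Bi: "monoms u \<subseteq> Bi i"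
  proof
    fix n assume "n \<in> monoms u"
    then obtain K where "n - M \<in> S K" using u(2) by blast
    then have "M + (n - M) \<in> Bi i" using S(2) by blast
    then show "n \<in> Bi i" by simp
  qed
  have h: "height (M + a) = height M - real K" if "a \<in> S K" for a K
    using that S(2)[of K] by (auto simp: height_add height_Ainv_products)
  \<comment> \<open>M a has height \<open>height M - K\<close>, so terms with K beyond this bound
    are too low to contain m.\<close>
  define K0 where "K0 = nat \<lceil>height M - height m\<rceil>"
  have K0: "K \<le> K0" if "a \<in> S K" "height m \<le> height (M + a)" for a K
    using h[OF that(1)] that(2) unfolding K0_def by linarith
  have g: "?g K = (\<Sum>a\<in>S K. c a * Et C r i (M + a) m)" for K
    by (simp add: series_sum_apply tscale_apply)
  have gK: "K \<le> K0" if "?g K \<noteq> 0" for K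
  proof (rule ccontr)
    assume K: "\<not> K \<le> K0"
    have "c a * Et C r i (M + a) m = 0" if "a \<in> S K" for a
    proof (rule ccontr)
      assume "c a * Et C r i (M + a) m \<noteq> 0"
      then have "Et C r i (M + a) m \<noteq> 0" by auto
      moreover have "M + a \<in> Bi i" using that S(2) by blast
      ultimately have "height m \<le> height (M + a)" by (rule height_Et[rotated])
      then show False using K0[OF that] K by simp
    qed
    then have "?g K = 0" unfolding g by (rule sum.neutral[rule_format])
    then show False using that by simp
  qed
  have "{K. ?g K \<noteq> 0} \<subseteq> {..K0}"
  proof
    fix K assume "K \<in> {K. ?g K \<noteq> 0}"
    then have "K \<le> K0" by (intro gK) (simp only: mem_Collect_eq not_False_eq_True)
    then show "K \<in> {..K0}" by simp
  qed
  then have fin: "finite {K. ?g K \<noteq> 0}" by (rule finite_subset) simp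
  have disj: "\<forall>K\<in>{..K0}. \<forall>L\<in>{..K0}. K \<noteq> L \<longrightarrow> (+) M ` S K \<inter> (+) M ` S L = {}"
  proof (intro ballI impI)
    fix K L :: nat assume "K \<noteq> L"
    have "K = L" if "a \<in> S K" "a \<in> S L" for a
    proof (rule Ainv_products_disjoint)
      show "a \<in> Ainv_products C r K" "a \<in> Ainv_products C r L" using that S(2) by blast+
    qed
    with \<open>K \<noteq> L\<close> show "(+) M ` S K \<inter> (+) M ` S L = {}" by auto
  qed
  have "Esum i u m = (\<Sum>n\<in>(\<Union>K\<in>{..K0}. (+) M ` S K). u n * Et C r i n m)"
  proof (rule Esum_eq[OF Bi])
    show "finite (\<Union>K\<in>{..K0}. (+) M ` S K)" using S(1) by simp
    fix n assume n: "n \<in> monoms u" "height m \<le> height n"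
    then obtain K where K: "n - M \<in> S K" using u(2) by blast
    then have "K \<le> K0" using K0[OF K] n(2) by simp
    moreover have "n = M + (n - M)" by simp
    ultimately show "n \<in> (\<Union>K\<in>{..K0}. (+) M ` S K)" using K by blast
  qed
  also have "\<dots> = (\<Sum>K\<in>{..K0}. \<Sum>n\<in>(+) M ` S K. u n * Et C r i n m)"
    using S(1) disj by (intro sum.UNION_disjoint) auto
  also have "\<dots> = (\<Sum>K\<in>{..K0}. ?g K)"
  proof (rule sum.cong[OF refl])
    fix K
    have "(\<Sum>n\<in>(+) M ` S K. u n * Et C r i n m) = (\<Sum>a\<in>S K. u (M + a) * Et C r i (M + a) m)"
      by (subst sum.reindex) (auto simp: inj_on_def)
    also have "\<dots> = ?g K" unfolding g by (rule sum.cong) (auto simp: u(1))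
    finally show "(\<Sum>n\<in>(+) M ` S K. u n * Et C r i n m) = ?g K" .
  qed
  also have "\<dots> = (\<Sum>K | ?g K \<noteq> 0. ?g K)"
    by (rule sum.mono_neutral_right) (use gK in auto)
  finally show "finite {K. ?g K \<noteq> 0} \<and> Esum i u m = (\<Sum>K | ?g K \<noteq> 0. ?g K)" using fin by blast
qed

text \<open>The finiteness of each S K corresponds to goodness of u: the terms with K factors all
  have the height of M minus K, and only finitely many K stay above a given height.\<close>

lemma Ki_part_iff:
  "f \<in> Ki_part C r i M \<longleftrightarrow>
    (\<exists>u. good u \<and> (\<forall>n\<in>monoms u. n - M \<in> Acone C r) \<and> monoms u \<subseteq> Bi i \<and> f = Esum i u)"
proof
  assume "f \<in> Ki_part C r i M"
  then obtain S c where S: "\<And>K. finite (S K)" "\<And>K. S K \<subseteq> {a \<in> Ainv_products C r K. M + a \<in> Bi i}"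
    and f: "formal_sum (\<lambda>K. \<Sum>a\<in>S K. tscale (c a) (Et C r i (M + a))) f"
    unfolding Ki_part_def by blast
  define u where "u = (\<lambda>n. if n - M \<in> (\<Union>K. S K) then c (n - M) else 0)"
  have supp: "\<exists>K. n - M \<in> S K" if "n \<in> monoms u" for n
    using that by (auto simp: u_def in_monoms split: if_splits)
  have "formal_sum (\<lambda>K. \<Sum>a\<in>S K. tscale (c a) (Et C r i (M + a))) (Esum i u)"
  proof (rule formal_sum_Esum[OF S _ supp])
    show "u (M + a) = c a" if "a \<in> S K" for K a using that by (auto simp: u_def)
  qed
  then have "f = Esum i u" by (rule formal_sum_unique[OF f])
  moreover have "good u"
    unfolding good_def
  proof
    fix c
    have "{n \<in> monoms u. c \<le> height n} \<subseteq> (\<Union>K\<in>{..nat \<lceil>height M - c\<rceil>}. (+) M ` S K)"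
    proof
      fix n assume n: "n \<in> {n \<in> monoms u. c \<le> height n}"
      then obtain K where K: "n - M \<in> S K" using supp by blast
      then have "height (n - M) = - real K" using S(2) height_Ainv_products by blast
      then have "K \<le> nat \<lceil>height M - c\<rceil>" using n by (simp add: height_diff) linarith
      moreover have "n = M + (n - M)" by simp
      ultimately show "n \<in> (\<Union>K\<in>{..nat \<lceil>height M - c\<rceil>}. (+) M ` S K)" using K by blast
    qed
    then show "finite {n \<in> monoms u. c \<le> height n}" by (rule finite_subset) (simp add: S(1))
  qed
  moreover have "n - M \<in> Acone C r \<and> n \<in> Bi i" if n: "n \<in> monoms u" for n
  proof -
    obtain K where "n - M \<in> S K" using supp[OF n] by blast
    then have "n - M \<in> Ainv_products C r K" "M + (n - M) \<in> Bi i" using S(2) by blast+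
    then show ?thesis by (auto simp: in_Acone)
  qed
  ultimately show "\<exists>u. good u \<and> (\<forall>n\<in>monoms u. n - M \<in> Acone C r) \<and> monoms u \<subseteq> Bi i \<and> f = Esum i u"
    by (intro exI[of _ u]) auto
next
  assume "\<exists>u. good u \<and> (\<forall>n\<in>monoms u. n - M \<in> Acone C r) \<and> monoms u \<subseteq> Bi i \<and> f = Esum i u"
  then obtain u where u: "good u" "\<And>n. n \<in> monoms u \<Longrightarrow> n - M \<in> Acone C r" "monoms u \<subseteq> Bi i"
    "f = Esum i u" by blast
  define S where "S = (\<lambda>K. {a \<in> Ainv_products C r K. M + a \<in> monoms u})"
  have fin: "finite (S K)" for K
  proof -
    have "(+) M ` S K \<subseteq> {n \<in> monoms u. height M - real K \<le> height n}"
      by (auto simp: S_def height_add height_Ainv_products)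
    moreover have "finite {n \<in> monoms u. height M - real K \<le> height n}" using u(1) by (simp add: good_def)
    ultimately have "finite ((+) M ` S K)" by (rule finite_subset)
    then show ?thesis by (rule finite_imageD) (simp add: inj_on_def)
  qed
  have sub: "S K \<subseteq> {a \<in> Ainv_products C r K. M + a \<in> Bi i}" for K
    using u(3) by (auto simp: S_def)
  have "formal_sum (\<lambda>K. \<Sum>a\<in>S K. tscale (u (M + a)) (Et C r i (M + a))) (Esum i u)"
  proof (rule formal_sum_Esum[OF fin sub refl])
    show "\<exists>K. n - M \<in> S K" if "n \<in> monoms u" for n
      using u(2)[OF that] that by (auto simp: S_def in_Acone)
  qed
  then show "f \<in> Ki_part C r i M" unfolding Ki_part_def u(4) using fin sub
    by (intro CollectI exI[of _ S] exI[of _ "\<lambda>a. u (M + a)"]) blast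
qed

text \<open>In one direction the finite sum over M is absorbed into one coefficient family, in the
  other \<open>cone_split\<close> distributes the family again. Membership in the completion follows
  from \<open>Esum_Yt_inf\<close>.\<close>

lemma Ki_inf_iff: "f \<in> Ki_inf C r i \<longleftrightarrow> (\<exists>u. admissible i u \<and> f = Esum i u)"
proof
  assume "f \<in> Ki_inf C r i"
  then obtain F g where F: "finite F" "\<And>M. M \<in> F \<Longrightarrow> g M \<in> Ki_part C r i M" "f = (\<Sum>M\<in>F. g M)"
    unfolding Ki_inf_def by blast
  have "\<exists>u. admissible i u \<and> g M = Esum i u" if M: "M \<in> F" for M
  proof -
    obtain u where "good u" "\<forall>n\<in>monoms u. n - M \<in> Acone C r" "monoms u \<subseteq> Bi i" "g M = Esum i u"
      using F(2)[OF M] unfolding Ki_part_iff by blast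
    then have "admissible i u \<and> g M = Esum i u"
      unfolding admissible_def cone_supp_def by (intro conjI exI[of _ "{M}"]) auto
    then show ?thesis by blast
  qed
  then have "\<forall>M\<in>F. \<exists>u. admissible i u \<and> g M = Esum i u" by blast
  then obtain u where u: "\<forall>M\<in>F. admissible i (u M) \<and> g M = Esum i (u M)" by (rule bchoice[THEN exE])
  have "admissible i (\<Sum>M\<in>F. u M) \<and> Esum i (\<Sum>M\<in>F. u M) = (\<Sum>M\<in>F. Esum i (u M))"
    using u by (intro admissible_sum F(1)) auto
  moreover have "f = (\<Sum>M\<in>F. Esum i (u M))" unfolding F(3) by (rule sum.cong) (use u in auto)
  ultimately show "\<exists>u. admissible i u \<and> f = Esum i u" by (intro exI[of _ "\<Sum>M\<in>F. u M"]) simp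
next
  assume "\<exists>u. admissible i u \<and> f = Esum i u"
  then obtain u where u: "admissible i u" "f = Esum i u" by blast
  then obtain F where F: "finite F" "\<And>m. m \<in> monoms u \<Longrightarrow> \<exists>M\<in>F. m - M \<in> Acone C r"
    unfolding admissible_def cone_supp_def by blast
  obtain g where g: "u = (\<Sum>M\<in>F. g M)" "\<And>M. monoms (g M) \<subseteq> monoms u"
    "\<And>M m. m \<in> monoms (g M) \<Longrightarrow> m - M \<in> Acone C r"
    using cone_split[OF F] by blast
  have adm: "admissible i (g M)" for M by (rule admissible_subset[OF u(1) g(2)])
  have "f = (\<Sum>M\<in>F. Esum i (g M))"
    unfolding u(2) g(1) by (rule conjunct2[OF admissible_sum[OF F(1) adm]])
  moreover have "Esum i (g M) \<in> Ki_part C r i M" for M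
    unfolding Ki_part_iff using adm[of M] g(3) by (intro exI[of _ "g M"]) (auto simp: admissible_def)
  ultimately have "\<exists>F g. finite F \<and> (\<forall>M\<in>F. g M \<in> Ki_part C r i M) \<and> f = (\<Sum>M\<in>F. g M)"
    using F(1) by (intro exI[of _ F] exI[of _ "\<lambda>M. Esum i (g M)"]) blast
  then show "f \<in> Ki_inf C r i"
    unfolding Ki_inf_def using Esum_Yt_inf[OF u(1)] u(2) by (intro CollectI conjI) simp_all
qed

section \<open>Module structure and products in each K_i\<close>

lemma Ki_inf_subspace: "series.subspace (Ki_inf C r i)"
proof (rule series.subspaceI)
  show "0 \<in> Ki_inf C r i" unfolding Ki_inf_iff by (intro exI[of _ 0] conjI admissible_0 Esum_0[symmetric])
  show "f + g \<in> Ki_inf C r i" if fg: "f \<in> Ki_inf C r i" "g \<in> Ki_inf C r i" for f g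
  proof -
    obtain u v where *: "admissible i u" "f = Esum i u" "admissible i v" "g = Esum i v"
      using fg unfolding Ki_inf_iff by blast
    have "f + g = Esum i (u + v)"
      unfolding *(2,4) by (rule Esum_add[symmetric]) (use * in \<open>auto simp: admissible_def\<close>)
    then show ?thesis unfolding Ki_inf_iff using admissible_add[OF *(1,3)] by blast
  qed
  show "tscale c f \<in> Ki_inf C r i" if f: "f \<in> Ki_inf C r i" for c f
  proof -
    obtain u where *: "admissible i u" "f = Esum i u" using f unfolding Ki_inf_iff by blast
    have "tscale c f = Esum i (tscale c u)"
      unfolding *(2) by (rule Esum_tscale[symmetric]) (use * in \<open>auto simp: admissible_def\<close>)
    then show ?thesis unfolding Ki_inf_iff using admissible_subset[OF *(1) monoms_tscale] by blast
  qed
qed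

lemma tone_Ki_inf: "tone \<in> Ki_inf C r i"
proof -
  have "0 \<in> Bi i" by (simp add: Bi_def)
  moreover have "admissible i (nord 0)"
    unfolding admissible_def cone_supp_def using \<open>0 \<in> Bi i\<close>
    by (intro conjI good_Yt Yt_nord exI[of _ "{0}"]) auto
  ultimately show ?thesis unfolding Ki_inf_iff using Esum_nord[of 0 i] by (intro exI[of _ "nord 0"]) (simp add: Et_0)
qed

text \<open>Applied to a product E(m) E(m'), this supplies its structure constants as a finitely
  supported family.\<close>

lemma Vspan_Esum:
  assumes "f \<in> Vspan i m"
  shows "\<exists>w. finite (monoms w) \<and> monoms w \<subseteq> {b \<in> Bi i. b - m \<in> Acone C r} \<and> f = Esum i w"
proof -
  let ?T = "{b \<in> Bi i. b - m \<in> Acone C r}"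
  let ?V = "{f. \<exists>w. finite (monoms w) \<and> monoms w \<subseteq> ?T \<and> f = Esum i w}"
  have "series.subspace ?V"
  proof (rule series.subspaceI)
    show "0 \<in> ?V" by (intro CollectI exI[of _ 0] conjI Esum_0[symmetric]) auto
    show "f + g \<in> ?V" if fg: "f \<in> ?V" "g \<in> ?V" for f g
    proof -
      obtain w w' where *: "finite (monoms w)" "monoms w \<subseteq> ?T" "f = Esum i w"
        "finite (monoms w')" "monoms w' \<subseteq> ?T" "g = Esum i w'" using fg by blast
      have "f + g = Esum i (w + w')"
        unfolding *(3,6) by (rule Esum_add[symmetric]) (use * in \<open>auto intro!: good_Yt simp: Yt_finite\<close>)
      moreover have "finite (monoms (w + w'))" using * finite_subset[OF monoms_add] by blast
      moreover have "monoms (w + w') \<subseteq> ?T" using * monoms_add[of w w'] by blast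
      ultimately show ?thesis by blast
    qed
    show "tscale c f \<in> ?V" if f: "f \<in> ?V" for c f
    proof -
      obtain w where *: "finite (monoms w)" "monoms w \<subseteq> ?T" "f = Esum i w" using f by blast
      have "tscale c f = Esum i (tscale c w)"
        unfolding *(3) by (rule Esum_tscale[symmetric]) (use * in \<open>auto intro!: good_Yt simp: Yt_finite\<close>)
      moreover have "finite (monoms (tscale c w))" using * finite_subset[OF monoms_tscale] by blast
      moreover have "monoms (tscale c w) \<subseteq> ?T" using * monoms_tscale[of c w] by blast
      ultimately show ?thesis by blast
    qed
  qed
  moreover have "Et C r i ` ?T \<subseteq> ?V"
  proof
    fix g assume "g \<in> Et C r i ` ?T"
    then obtain b where b: "b \<in> ?T" "g = Et C r i b" by blast
    then have "g = Esum i (nord b)" using Esum_nord[of b i] by simp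
    then show "g \<in> ?V" using b(1) by (intro CollectI exI[of _ "nord b"]) auto
  qed
  ultimately have "Vspan i m \<subseteq> ?V" unfolding Vspan_def by (intro series.span_minimal)
  then show ?thesis using assms by blast
qed

text \<open>At a monomial of height at least c, \<open>Esum\<close> involves only indices of at
  least that height.\<close>

lemma trunc_Esum: "trunc c (Esum i (trunc c u)) = trunc c (Esum i u)"
proof
  fix m
  show "trunc c (Esum i (trunc c u)) m = trunc c (Esum i u) m"
  proof (cases "c \<le> height m")
    case True
    then have "{n \<in> monoms (trunc c u). height m \<le> height n} = {n \<in> monoms u. height m \<le> height n}"
      by (auto simp: monoms_trunc)
    then show ?thesis using True
      unfolding Esum_def trunc_def[of c "\<lambda>m. _ m"] by (auto simp: trunc_def intro!: sum.cong)
  qed (simp add: trunc_def)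
qed

lemma Esum_bound:
  assumes "monoms u \<subseteq> Bi i" "\<And>n. n \<in> monoms u \<Longrightarrow> height n \<le> b" "m \<in> monoms (Esum i u)"
  shows "height m \<le> b"
  using assms(1,3)
proof (rule monoms_Esum)
  fix n assume "n \<in> monoms u" "height m \<le> height n"
  then show "height m \<le> b" using assms(2)[of n] by simp
qed

text \<open>For one coefficient the infinite sums may be replaced by finite ones. Both factors then
  lie in \<open>Yt\<close>, where the product is bilinear.\<close>

lemma Esum_tmult_trunc:
  assumes "admissible i u" "admissible i v"
    "\<And>n. n \<in> monoms u \<Longrightarrow> height n \<le> b" "\<And>n. n \<in> monoms v \<Longrightarrow> height n \<le> b" "c \<le> height m - b"
  shows "tmult C r (Esum i u) (Esum i v) m = tmult C r (Esum i (trunc c u)) (Esum i (trunc c v)) m"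
proof -
  have Bi: "monoms u \<subseteq> Bi i" "monoms v \<subseteq> Bi i" using assms(1,2) by (auto simp: admissible_def)
  have tr: "monoms (trunc c u) \<subseteq> Bi i" "monoms (trunc c v) \<subseteq> Bi i" using Bi by (auto simp: monoms_trunc)
  have "tmult C r (Esum i u) (Esum i v) m = tmult C r (trunc c (Esum i u)) (trunc c (Esum i v)) m"
    by (rule tmult_trunc[symmetric, of _ b])
      (use Esum_bound[OF Bi(1) assms(3)] Esum_bound[OF Bi(2) assms(4)] assms(5) in auto)
  also have "\<dots> = tmult C r (trunc c (Esum i (trunc c u))) (trunc c (Esum i (trunc c v))) m"
    by (simp only: trunc_Esum)
  also have "\<dots> = tmult C r (Esum i (trunc c u)) (Esum i (trunc c v)) m"
  proof (rule tmult_trunc[of _ b])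
    show "height a \<le> b" if "a \<in> monoms (Esum i (trunc c u))" for a
      by (rule Esum_bound[OF tr(1) _ that]) (simp add: monoms_trunc assms(3))
    show "height a \<le> b" if "a \<in> monoms (Esum i (trunc c v))" for a
      by (rule Esum_bound[OF tr(2) _ that]) (simp add: monoms_trunc assms(4))
  qed (rule assms(5))
  finally show ?thesis .
qed

text \<open>If E(a) E(b) is the sum of w_{ab}(p) E(p), the product must have the coefficients y(p),
  the sum of u(a) v(b) w_{ab}(p) over a and b. Heights make this sum finite and y admissible, and
  the identity is checked one coefficient at a time after truncation.\<close>

lemma Ki_inf_tmult:
  assumes "f \<in> Ki_inf C r i" "g \<in> Ki_inf C r i" shows "tmult C r f g \<in> Ki_inf C r i"
proof -
  obtain u v where u: "admissible i u" "f = Esum i u" and v: "admissible i v" "g = Esum i v"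
    using assms unfolding Ki_inf_iff by blast
  have good: "good u" "good v" and Bi: "monoms u \<subseteq> Bi i" "monoms v \<subseteq> Bi i"
    using u v by (auto simp: admissible_def)
  obtain b1 where b1: "\<And>n. n \<in> monoms u \<Longrightarrow> height n \<le> b1" using good_bound[OF good(1)] by blast
  obtain b2 where b2: "\<And>n. n \<in> monoms v \<Longrightarrow> height n \<le> b2" using good_bound[OF good(2)] by blast
  define b where "b = max b1 b2"
  have b: "\<And>n. n \<in> monoms u \<Longrightarrow> height n \<le> b" "\<And>n. n \<in> monoms v \<Longrightarrow> height n \<le> b"
    using b1 b2 by (auto simp: b_def intro: max.coboundedI1 max.coboundedI2)
  let ?P = "\<lambda>x w. finite (monoms w) \<and> monoms w \<subseteq> {p \<in> Bi i. p - (fst x + snd x) \<in> Acone C r}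
      \<and> tmult C r (Et C r i (fst x)) (Et C r i (snd x)) = Esum i w"
  have "\<exists>w. ?P x w" if "x \<in> Bi i \<times> Bi i" for x
    using Vspan_Esum[OF Et_mult[of "fst x" i "snd x"]] that by auto
  then have "\<forall>x\<in>Bi i \<times> Bi i. \<exists>w. ?P x w" by blast
  then obtain w where w: "\<forall>x\<in>Bi i \<times> Bi i. ?P x (w x)" by (rule bchoice[THEN exE])
  define X where "X = (\<lambda>h. {x \<in> monoms u \<times> monoms v. h \<le> height (fst x) + height (snd x)})"
  define F where "F = (\<lambda>h. {n \<in> monoms u. h - b \<le> height n})"
  define G where "G = (\<lambda>h. {n \<in> monoms v. h - b \<le> height n})"
  have fin: "finite (F h)" "finite (G h)" for h using good by (simp_all add: F_def G_def good_def)
  have XFG: "X h \<subseteq> F h \<times> G h" for h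
  proof
    fix x assume x: "x \<in> X h"
    then show "x \<in> F h \<times> G h" using b(1)[of "fst x"] b(2)[of "snd x"]
      by (cases x) (auto simp: X_def F_def G_def)
  qed
  have wx: "?P x (w x)" if "x \<in> monoms u \<times> monoms v" for x using w that Bi by blast
  have hw: "height p \<le> height (fst x) + height (snd x)" if "x \<in> monoms u \<times> monoms v" "p \<in> monoms (w x)" for x p
    using wx[OF that(1)] that(2) height_Acone[of "p - (fst x + snd x)"]
    by (auto simp: height_diff height_add)
  \<comment> \<open>A pair contributing to p has total height at least that of p, so restricting to
    \<open>X\<close> discards nothing and leaves a finite sum.\<close>
  define y where "y = (\<lambda>p. \<Sum>x\<in>X (height p). u (fst x) * v (snd x) * w x p)"
  have y: "y p = (\<Sum>x\<in>S. u (fst x) * v (snd x) * w x p)"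
    if "finite S" "X (height p) \<subseteq> S" "S \<subseteq> monoms u \<times> monoms v" for p S
    unfolding y_def
  proof (rule sum.mono_neutral_left[OF that(1,2)], rule ballI)
    fix x assume x: "x \<in> S - X (height p)"
    then have xuv: "x \<in> monoms u \<times> monoms v" using that(3) by blast
    then have "p \<notin> monoms (w x)" using hw[OF xuv, of p] x by (auto simp: X_def)
    then show "u (fst x) * v (snd x) * w x p = 0" by (simp add: in_monoms)
  qed
  have y_monoms: "\<exists>x\<in>X (height p). p \<in> monoms (w x)" if p: "p \<in> monoms y" for p
  proof (rule ccontr)
    assume "\<not> ?thesis"
    then have "w x p = 0" if "x \<in> X (height p)" for x using that by (auto simp: in_monoms)
    then have "y p = 0" unfolding y_def by (intro sum.neutral) simp
    then show False using p by (simp add: in_monoms)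
  qed
  have "admissible i y"
    unfolding admissible_def
  proof (intro conjI)
    show "good y"
    proof (rule good_mult[OF good, where T = "\<lambda>a b. monoms (w (a, b))"])
      fix p assume "p \<in> monoms y"
      then obtain x where "x \<in> X (height p)" "p \<in> monoms (w x)" using y_monoms by blast
      then show "\<exists>a\<in>monoms u. \<exists>b\<in>monoms v. height p \<le> height a + height b \<and> p \<in> monoms (w (a, b))"
        by (cases x) (auto simp: X_def)
    next
      fix a b assume "a \<in> monoms u" "b \<in> monoms v"
      then show "finite (monoms (w (a, b)))" using wx[of "(a, b)"] by simp
    qed
    show "cone_supp C r y"
    proof (rule cone_supp_mult[of C r u v])
      show "cone_supp C r u" "cone_supp C r v" using u(1) v(1) by (auto simp: admissible_def)
      fix p assume "p \<in> monoms y"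
      then obtain x where x: "x \<in> X (height p)" "p \<in> monoms (w x)" using y_monoms by blast
      then have xuv: "x \<in> monoms u \<times> monoms v" by (simp add: X_def)
      have "p - (fst x + snd x) \<in> Acone C r" using wx[OF xuv] x(2) by blast
      with xuv show "\<exists>a\<in>monoms u. \<exists>b\<in>monoms v. p - (a + b) \<in> Acone C r"
        by (intro bexI[of _ "fst x"] bexI[of _ "snd x"]) auto
    qed
    show "monoms y \<subseteq> Bi i"
    proof
      fix p assume "p \<in> monoms y"
      then obtain x where x: "x \<in> X (height p)" "p \<in> monoms (w x)" using y_monoms by blast
      then have "x \<in> monoms u \<times> monoms v" by (simp add: X_def)
      from wx[OF this] x(2) show "p \<in> Bi i" by blast
    qed
  qed
  moreover have "tmult C r f g = Esum i y"
  proof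
    fix m
    let ?e = "height m"
    let ?S = "F ?e \<times> G ?e"
    have S: "finite ?S" "?S \<subseteq> monoms u \<times> monoms v" using fin by (auto simp: F_def G_def)
    \<comment> \<open>A finite set containing every index p that can contribute to the coefficient
      of m, both for the individual products E(a) E(b) and for \<open>Esum i y\<close>.\<close>
    define T where "T = {p \<in> (\<Union>x\<in>?S. monoms (w x)). ?e \<le> height p}"
    have T: "finite T"
    proof -
      have "finite (\<Union>x\<in>?S. monoms (w x))"
        using S(1) by (rule finite_UN_I) (use wx S(2) in blast)
      then show ?thesis unfolding T_def by (rule finite_subset[rotated]) blast
    qed
    have Fu: "monoms (trunc (?e - b) u) = F ?e" "monoms (trunc (?e - b) v) = G ?e"
      by (simp_all add: monoms_trunc F_def G_def)
    have FB: "F ?e \<subseteq> Bi i" "G ?e \<subseteq> Bi i" using Bi by (auto simp: F_def G_def)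
    have ut: "trunc (?e - b) u n = u n" if "n \<in> F ?e" for n using that by (simp add: F_def trunc_def)
    have vt: "trunc (?e - b) v n = v n" if "n \<in> G ?e" for n using that by (simp add: G_def trunc_def)
    have "Esum i (trunc (?e - b) u) = (\<Sum>n\<in>F ?e. tscale (trunc (?e - b) u n) (Et C r i n))"
      by (rule Esum_Yt) (use Fu FB fin in simp_all)
    also have "\<dots> = (\<Sum>n\<in>F ?e. tscale (u n) (Et C r i n))"
      by (rule sum.cong) (simp_all add: ut)
    finally have Eu: "Esum i (trunc (?e - b) u) = (\<Sum>n\<in>F ?e. tscale (u n) (Et C r i n))" .
    have "Esum i (trunc (?e - b) v) = (\<Sum>n\<in>G ?e. tscale (trunc (?e - b) v n) (Et C r i n))"
      by (rule Esum_Yt) (use Fu FB fin in simp_all)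
    also have "\<dots> = (\<Sum>n\<in>G ?e. tscale (v n) (Et C r i n))"
      by (rule sum.cong) (simp_all add: vt)
    finally have Ev: "Esum i (trunc (?e - b) v) = (\<Sum>n\<in>G ?e. tscale (v n) (Et C r i n))" .
    have Yt: "tscale c (Et C r i n) \<in> Yt" if "n \<in> F ?e" for n c
      using Et_Yt[of n i] FB that by (intro Yt_tscale) auto
    have "tmult C r f g m = tmult C r (Esum i (trunc (?e - b) u)) (Esum i (trunc (?e - b) v)) m"
      unfolding u(2) v(2) by (rule Esum_tmult_trunc[OF u(1) v(1) b]) simp_all
    also have "\<dots> = (\<Sum>n\<in>F ?e. \<Sum>n'\<in>G ?e. tmult C r (tscale (u n) (Et C r i n)) (tscale (v n') (Et C r i n')) m)"
      unfolding Eu Ev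
      by (subst tmult_sum_left, rule Yt, assumption)
        (simp only: series_sum_apply tmult_sum_right[OF Yt] cong: sum.cong)
    also have "\<dots> = (\<Sum>n\<in>F ?e. \<Sum>n'\<in>G ?e. u n * v n' * Esum i (w (n, n')) m)"
    proof (intro sum.cong refl)
      fix n n' assume n: "n \<in> F ?e" "n' \<in> G ?e"
      have nB: "n \<in> Bi i" using n FB by auto
      have P: "tmult C r (Et C r i n) (Et C r i n') = Esum i (w (n, n'))"
        using wx[of "(n, n')"] S(2) n by auto
      show "tmult C r (tscale (u n) (Et C r i n)) (tscale (v n') (Et C r i n')) m
          = u n * v n' * Esum i (w (n, n')) m"
        by (simp only: tmult_tscale_left[OF Et_Yt[OF nB]] tmult_tscale_right[OF Et_Yt[OF nB]] P
            tscale_apply mult.assoc)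
    qed
    also have "\<dots> = (\<Sum>x\<in>?S. u (fst x) * v (snd x) * Esum i (w x) m)"
      by (subst sum.cartesian_product) (simp add: case_prod_unfold)
    also have "\<dots> = (\<Sum>x\<in>?S. \<Sum>p\<in>T. u (fst x) * v (snd x) * w x p * Et C r i p m)"
    proof (rule sum.cong[OF refl])
      fix x assume x: "x \<in> ?S"
      then have xuv: "x \<in> monoms u \<times> monoms v" using S(2) by blast
      have "Esum i (w x) m = (\<Sum>p\<in>T. w x p * Et C r i p m)"
      proof (rule Esum_eq[OF _ T])
        show "monoms (w x) \<subseteq> Bi i" using wx[OF xuv] by blast
        show "p \<in> T" if "p \<in> monoms (w x)" "?e \<le> height p" for p
          using that x unfolding T_def by blast
      qed
      then show "u (fst x) * v (snd x) * Esum i (w x) m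
          = (\<Sum>p\<in>T. u (fst x) * v (snd x) * w x p * Et C r i p m)"
        by (simp only: sum_distrib_left mult.assoc)
    qed
    also have "\<dots> = (\<Sum>p\<in>T. \<Sum>x\<in>?S. u (fst x) * v (snd x) * w x p * Et C r i p m)"
      by (rule sum.swap)
    \<comment> \<open>Indices in T are at least as high as m, so all pairs counted in y(p) already
      lie in the index set belonging to m, and the additional pairs contribute 0.\<close>
    also have "\<dots> = (\<Sum>p\<in>T. y p * Et C r i p m)"
    proof (rule sum.cong[OF refl])
      fix p assume "p \<in> T"
      then have "X (height p) \<subseteq> X ?e" by (auto simp: T_def X_def)
      then have "X (height p) \<subseteq> ?S" using XFG by blast
      then show "(\<Sum>x\<in>?S. u (fst x) * v (snd x) * w x p * Et C r i p m) = y p * Et C r i p m"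
        by (simp only: y[OF S(1) _ S(2)] sum_distrib_right)
    qed
    also have "\<dots> = Esum i y m"
    proof (rule Esum_eq[symmetric, OF _ T])
      show "monoms y \<subseteq> Bi i" using \<open>admissible i y\<close> by (simp add: admissible_def)
      fix p assume p: "p \<in> monoms y" "?e \<le> height p"
      then obtain x where x: "x \<in> X (height p)" "p \<in> monoms (w x)" using y_monoms by blast
      have "X (height p) \<subseteq> X ?e" using p(2) by (auto simp: X_def)
      then have "x \<in> ?S" using x(1) XFG by blast
      then show "p \<in> T" using x(2) p(2) unfolding T_def by blast
    qed
    finally show "tmult C r f g m = Esum i y m" .
  qed
  ultimately show ?thesis unfolding Ki_inf_iff by blast
qed

section \<open>Intersection over i and the submodule with finitely many dominant monomials\<close>

lemma K_inf_subspace: "series.subspace (K_inf C r)"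
  unfolding K_inf_def by (rule series.subspace_Inter) (auto simp: Ki_inf_subspace)

lemma K_inf_good: "f \<in> K_inf C r \<Longrightarrow> good f"
  unfolding K_inf_def Ki_inf_def by (auto simp: Yt_inf_iff)

lemma K_inf_f_eq: "K_inf_f C r = K_inf C r"
proof -
  have "{f \<in> K_inf C r. finite (monoms f \<inter> dominant_monoms)} = K_inf C r"
    using good_finite_dominant K_inf_good by blast
  then show ?thesis
    unfolding K_inf_f_def using series.span_eq_iff[of "K_inf C r"] K_inf_subspace by simp
qed

lemma K_inf_f_subalgebra: "is_subalgebra C r (K_inf_f C r) (K_inf C r)"
  unfolding is_subalgebra_def K_inf_f_eq
  using K_inf_subspace tone_Ki_inf Ki_inf_tmult by (auto simp: K_inf_def)

end

theorem lemma6p4: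
  fixes C :: "int ^ 'n::{finite,linorder} ^ 'n::{finite,linorder}" and r :: "'n \<Rightarrow> nat"
  assumes "finite_type_cartan C" and "coprime_symmetrizer C r"
  shows "is_subalgebra C r (K_inf_f C r) (K_inf C r)"
proof -
  obtain d where "finite_type C d" using assms(1) by (rule finite_type_cartanE)
  then have "cartan_linorder C d r"
    by (intro cartan_linorder.intro cartan_datum.intro cartan_datum_axioms.intro assms(2))
  then show ?thesis by (rule cartan_linorder.K_inf_f_subalgebra)
qed

end
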